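(* Let $G$ be a finite graph. Then the following conditions are equivalent. (1) There is a plane generic immersion $f:G\to\mathbb{R}^{2}$ such that $\mathrm{rot}(f(\gamma))=0$ for every cycle $\gamma$ of $G$. (2) The graph $G$ does not have $K_{4}$ (the complete graph on $4$ vertices) as a minor.
   Context: Graphs may have loops and multiple edges. A finite graph $G$ is regarded as a topological space in the usual way. A cycle of $G$ is a subgraph homeomorphic to a circle. A plane generic immersion of $G$ is an immersion $f:G\to\mathbb{R}^2$ (a continuous locally injective, piecewise smooth map) whose multiple points are only finitely many transversal double points between edges, i.e. between interior points of edges (possibly of the same edge). For a cycle $\gamma$ with a chosen orientation, $\mathrm{rot}(f(\gamma))$ is the rotation number (turning number) of the oriented immersed closed plane curve $f(\gamma)$, corners at vertices being smoothed; equivalently, parametrizing $f|_\gamma$ by $c:\mathbb{R}/\mathbb{Z}\to\mathbb{R}^2$, it is the degree of $t\mapsto (c(t+\epsilon)-c(t))/\|c(t+\epsilon)-c(t)\|$ for small $\epsilon>0$. Reversing the orientation of $\gamma$ changes only its sign, so the condition $\mathrm{rot}(f(\gamma))=0$ does not depend on orientation. *)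

theory Defs
  imports
    "HOL-Complex_Analysis.Winding_Numbers"
    "Graph_Theory.Digraph_Component"
begin

text \<open>
  A multigraph (loops and parallel edges allowed) is a \<^typ>\<open>('v, 'e) pre_digraph\<close>. The direction
  of an arc only serves to identify the edge with the interval \<open>[0,1]\<close>; none of the notions below
  depends on it. The plane is \<^typ>\<open>complex\<close>.
\<close>

subsection \<open>The topological realization\<close>

datatype ('v, 'e) gpoint = Vertex 'v | Inner 'e real

text \<open>The characteristic map of the edge \<open>e\<close>, for parameters in \<open>[0,1]\<close>.\<close>

definition edge_map :: "('v, 'e) pre_digraph \<Rightarrow> 'e \<Rightarrow> real \<Rightarrow> ('v, 'e) gpoint" where
  "edge_map G e t =
     (if t = 0 then Vertex (tail G e) else if t = 1 then Vertex (head G e) else Inner e t)"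

definition gpoints :: "('v, 'e) pre_digraph \<Rightarrow> ('v, 'e) gpoint set" where
  "gpoints G = Vertex ` verts G \<union> {Inner e t | e t. e \<in> arcs G \<and> t \<in> {0<..<1}}"

text \<open>
  The quotient topology of the disjoint union of the discrete space of vertices and one copy of
  \<open>[0,1]\<close> for each edge.
\<close>

definition gopen :: "('v, 'e) pre_digraph \<Rightarrow> ('v, 'e) gpoint set \<Rightarrow> bool" where
  "gopen G U \<longleftrightarrow> U \<subseteq> gpoints G \<and>
     (\<forall>e\<in>arcs G. openin (top_of_set {0..1}) {t \<in> {0..1}. edge_map G e t \<in> U})"

definition realization :: "('v, 'e) pre_digraph \<Rightarrow> ('v, 'e) gpoint topology" where
  "realization G = topology (gopen G)"

lemma istopology_gopen: "istopology (gopen G)"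
  unfolding istopology_def
proof (intro conjI allI impI)
  fix S T assume S: "gopen G S" and T: "gopen G T"
  have "{t \<in> {0..1}. edge_map G e t \<in> S \<inter> T} =
      {t \<in> {0..1}. edge_map G e t \<in> S} \<inter> {t \<in> {0..1}. edge_map G e t \<in> T}" for e
    by auto
  with S T show "gopen G (S \<inter> T)"
    unfolding gopen_def by (auto intro: openin_Int)
next
  fix \<K> assume K: "\<forall>K\<in>\<K>. gopen G K"
  have "{t \<in> {0..1}. edge_map G e t \<in> \<Union>\<K>} = (\<Union>K\<in>\<K>. {t \<in> {0..1}. edge_map G e t \<in> K})" for e
    by auto
  with K show "gopen G (\<Union>\<K>)"
    unfolding gopen_def by (auto intro!: openin_Union)
qed

lemma openin_realization: "openin (realization G) = gopen G"
  unfolding realization_def by (rule topology_inverse'[OF istopology_gopen])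

lemma (in wf_digraph) topspace_realization: "topspace (realization G) = gpoints G"
proof -
  have "edge_map G e t \<in> gpoints G" if "e \<in> arcs G" "t \<in> {0..1}" for e t
    using that by (auto simp: edge_map_def gpoints_def)
  then have "{t \<in> {0..1}. edge_map G e t \<in> gpoints G} = {0..1}" if "e \<in> arcs G" for e
    using that by blast
  then have "gopen G (gpoints G)"
    by (auto simp: gopen_def)
  then show ?thesis
    unfolding topspace_def openin_realization by (auto simp: gopen_def)
qed

subsection \<open>Plane generic immersions\<close>

text \<open>
  Being \<open>C\<^sup>\<infinity>\<close> on \<open>S\<close>: \<open>D k\<close> is the \<open>k\<close>-th derivative, one-sided at boundary points of \<open>S\<close>.
\<close>

definition smooth_curve_on :: "(real \<Rightarrow> complex) \<Rightarrow> real set \<Rightarrow> bool" where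
  "smooth_curve_on g S \<longleftrightarrow> (\<exists>D :: nat \<Rightarrow> real \<Rightarrow> complex. (\<forall>t\<in>S. D 0 t = g t) \<and>
     (\<forall>k. \<forall>t\<in>S. (D k has_vector_derivative D (Suc k) t) (at t within S)))"

definition piecewise_smooth :: "(real \<Rightarrow> complex) \<Rightarrow> bool" where
  "piecewise_smooth g \<longleftrightarrow> (\<exists>\<P>. \<P> division_of {0..1} \<and> (\<forall>K\<in>\<P>. smooth_curve_on g K))"

definition locally_injective :: "'a topology \<Rightarrow> ('a \<Rightarrow> 'b) \<Rightarrow> bool" where
  "locally_injective X f \<longleftrightarrow> (\<forall>x\<in>topspace X. \<exists>U. openin X U \<and> x \<in> U \<and> inj_on f U)"

definition plane_immersion :: "('v, 'e) pre_digraph \<Rightarrow> (('v, 'e) gpoint \<Rightarrow> complex) \<Rightarrow> bool" where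
  "plane_immersion G f \<longleftrightarrow>
     continuous_map (realization G) euclidean f \<and>
     locally_injective (realization G) f \<and>
     (\<forall>e\<in>arcs G. piecewise_smooth (f \<circ> edge_map G e))"

definition multiple_points :: "('v, 'e) pre_digraph \<Rightarrow> (('v, 'e) gpoint \<Rightarrow> complex) \<Rightarrow> complex set" where
  "multiple_points G f = {z. \<exists>x\<in>gpoints G. \<exists>y\<in>gpoints G. x \<noteq> y \<and> f x = z \<and> f y = z}"

text \<open>
  The point \<open>z\<close> has exactly two preimages, both interior to edges, and there the two tangent
  vectors \<open>u\<close>, \<open>v\<close> exist and span the plane over the reals.
\<close>

definition transversal_double_point ::
    "('v, 'e) pre_digraph \<Rightarrow> (('v, 'e) gpoint \<Rightarrow> complex) \<Rightarrow> complex \<Rightarrow> bool" where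
  "transversal_double_point G f z \<longleftrightarrow>
     (\<exists>a\<in>arcs G. \<exists>b\<in>arcs G. \<exists>s\<in>{0<..<1}. \<exists>t\<in>{0<..<1}. \<exists>u v.
        (a, s) \<noteq> (b, t) \<and>
        {x \<in> gpoints G. f x = z} = {Inner a s, Inner b t} \<and>
        ((f \<circ> edge_map G a) has_vector_derivative u) (at s) \<and>
        ((f \<circ> edge_map G b) has_vector_derivative v) (at t) \<and>
        span {u, v} = UNIV)"

definition plane_generic_immersion ::
    "('v, 'e) pre_digraph \<Rightarrow> (('v, 'e) gpoint \<Rightarrow> complex) \<Rightarrow> bool" where
  "plane_generic_immersion G f \<longleftrightarrow>
     plane_immersion G f \<and>
     finite (multiple_points G f) \<and>
     (\<forall>z\<in>multiple_points G f. transversal_double_point G f z)"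

subsection \<open>Cycles and rotation numbers\<close>

abbreviation circle :: "complex topology" where
  "circle \<equiv> top_of_set (sphere 0 1)"

definition is_cycle_of :: "('v, 'e) pre_digraph \<Rightarrow> ('v, 'e) pre_digraph \<Rightarrow> bool" where
  "is_cycle_of C G \<longleftrightarrow> subgraph C G \<and> realization C homeomorphic_space circle"

text \<open>
  For a curve \<open>c\<close> of period 1: the degree of \<open>t \<mapsto> (c (t + \<epsilon>) - c t) / \<parallel>c (t + \<epsilon>) - c t\<parallel>\<close>, a map from
  \<open>\<real>/\<int>\<close> to the unit circle, for all small \<open>\<epsilon> > 0\<close>. The degree of such a map is its winding number
  about 0.
\<close>

definition has_rotation_number :: "(real \<Rightarrow> complex) \<Rightarrow> int \<Rightarrow> bool" where
  "has_rotation_number c n \<longleftrightarrow>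
     (\<forall>\<^sub>F \<epsilon> in at_right 0. (\<forall>t. c (t + \<epsilon>) \<noteq> c t) \<and>
        winding_number (\<lambda>t. sgn (c (t + \<epsilon>) - c t)) 0 = of_int n)"

lemma has_rotation_number_unique:
  assumes "has_rotation_number c m" "has_rotation_number c n"
  shows "m = n"
proof -
  have "\<forall>\<^sub>F \<epsilon> in at_right (0::real). (of_int m :: complex) = of_int n"
    using assms unfolding has_rotation_number_def by eventually_elim simp
  then show ?thesis
    by simp
qed

text \<open>
  A homeomorphism \<open>h\<close> from the circle onto a cycle chooses an orientation and a parametrization of
  the cycle; this is the induced 1-periodic parametrization of its image.
\<close>

definition cycle_curve :: "(('v, 'e) gpoint \<Rightarrow> complex) \<Rightarrow> (complex \<Rightarrow> ('v, 'e) gpoint) \<Rightarrow> real \<Rightarrow> complex"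
  where "cycle_curve f h t = f (h (cis (2 * pi * t)))"

subsection \<open>Minors\<close>

text \<open>The head of \<open>a\<close> is identified with its tail; edges parallel to \<open>a\<close> become loops.\<close>

definition contract_arc :: "('v, 'e) pre_digraph \<Rightarrow> 'e \<Rightarrow> ('v, 'e) pre_digraph" where
  "contract_arc G a =
     (let r = (\<lambda>v. if v = head G a then tail G a else v)
      in \<lparr> verts = r ` verts G, arcs = arcs G - {a}, tail = r \<circ> tail G, head = r \<circ> head G \<rparr>)"

inductive is_minor_of :: "('v, 'e) pre_digraph \<Rightarrow> ('v, 'e) pre_digraph \<Rightarrow> bool" where
  refl: "is_minor_of G G"
| delete_edge: "is_minor_of H G \<Longrightarrow> a \<in> arcs H \<Longrightarrow> is_minor_of (pre_digraph.del_arc H a) G"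
| delete_vertex: "is_minor_of H G \<Longrightarrow> v \<in> verts H \<Longrightarrow> is_minor_of (pre_digraph.del_vert H v) G"
| contract_edge: "is_minor_of H G \<Longrightarrow> a \<in> arcs H \<Longrightarrow> is_minor_of (contract_arc H a) G"

text \<open>
  \<open>H\<close> is, up to isomorphism and direction of its arcs, the complete graph on \<open>n\<close> vertices: no loops
  and exactly one edge between any two distinct vertices.
\<close>

definition is_complete_graph :: "nat \<Rightarrow> ('v, 'e) pre_digraph \<Rightarrow> bool" where
  "is_complete_graph n H \<longleftrightarrow>
     loopfree_digraph H \<and> finite (verts H) \<and> card (verts H) = n \<and>
     (\<forall>u\<in>verts H. \<forall>v\<in>verts H. u \<noteq> v \<longrightarrow> (\<exists>!a. a \<in> arcs H \<and> {tail H a, head H a} = {u, v}))"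

definition has_complete_minor :: "nat \<Rightarrow> ('v, 'e) pre_digraph \<Rightarrow> bool" where
  "has_complete_minor n G \<longleftrightarrow> (\<exists>H. is_minor_of H G \<and> is_complete_graph n H)"

end

theory Submission
  imports Defs
begin

text \<open>
  Fix a small \<open>\<epsilon>\<close> and follow the direction of the secants of length \<open>\<epsilon>\<close> along a cycle. Up to the angles of
  the first secants of the half-edges, which cancel, this direction turns by an odd multiple \<open>k\<close> of \<open>\<pi>\<close>
  along every edge and by an odd multiple \<open>c\<close> of \<open>\<pi>\<close> at every corner, both changing sign under reversal.
  If all rotation numbers vanish, then the numbers \<open>k\<close>, \<open>c\<close> sum to zero along every cycle. Such a system is
  inherited by minors, and on \<open>K\<^sub>4\<close> the seven equations, one for each cycle, contradict each other modulo 4.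

  Conversely, a graph with an edge and without \<open>K\<^sub>4\<close> minor has a loop, two parallel edges, or a vertex of
  degree 1 or 2. By induction its half-edges can be labelled with distinct reals such that along every cycle
  the labels have as many ascents as descents. Drawing every edge as a polygon with a bend near each end, where
  the bends are placed on a line according to their labels, makes twice the rotation number of a
  cycle the difference of these two counts. A perturbation to general position makes the drawing generic.
\<close>

section \<open>Darts and cycles\<close>

text \<open>Rotation numbers are defined by secants, so no tangent directions at vertices are
  available; secants of a fixed small length replace them, and local injectivity alone keeps them
  nonzero. The odd multiples arise because the last secant of an edge is the first secant of the
  reversed edge with the opposite direction. Two obstacles come from the topological definitions. A
  cycle is any subgraph whose realization is a circle, which has to be identified with a closed
  walk; and its parametrization is an arbitrary homeomorphism of uncontrolled speed, so the
  vanishing of the rotation number has to be shown independent of the parametrization. In the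
  converse direction the polygons go up and down alternately. Each exterior angle is then a
  difference of line angles in (0, \<pi>) plus \<pi> times the sign of the turn; the line angles
  telescope, and the rotation number becomes half of a sum of signs. Such signs depend only on the
  order of the labels and survive a small perturbation, which is why distinct real labels are all
  that has to be constructed.\<close>

type_synonym 'e dart = "'e \<times> bool"

definition rev_dart :: "'e dart \<Rightarrow> 'e dart" where
  "rev_dart d = (fst d, \<not> snd d)"

text \<open>A dart also serves as the half-edge at its start; the flag is \<open>True\<close> for
  the direction from tail to head. The two darts of a loop have the same start but remain distinct,
  so a loop contributes two half-edges to its vertex.\<close>

definition dstart :: "('v, 'e) pre_digraph \<Rightarrow> 'e dart \<Rightarrow> 'v" where
  "dstart G d = (if snd d then tail G (fst d) else head G (fst d))"

abbreviation dend :: "('v, 'e) pre_digraph \<Rightarrow> 'e dart \<Rightarrow> 'v" where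
  "dend G d \<equiv> dstart G (rev_dart d)"

definition darts :: "('v, 'e) pre_digraph \<Rightarrow> 'e dart set" where
  "darts G = arcs G \<times> UNIV"

lemma rev_dart_simps [simp]:
  "rev_dart (rev_dart d) = d" "fst (rev_dart d) = fst d" "snd (rev_dart d) = (\<not> snd d)"
  "rev_dart d \<noteq> d" "d \<noteq> rev_dart d" "rev_dart (e, b) = (e, \<not> b)"
  by (auto simp: rev_dart_def prod_eq_iff)

lemma rev_dart_eq_iff [simp]: "rev_dart d = rev_dart d' \<longleftrightarrow> d = d'"
  by (metis rev_dart_simps(1))

lemma rev_dart_in_darts [simp]: "rev_dart d \<in> darts G \<longleftrightarrow> d \<in> darts G"
  by (auto simp: darts_def rev_dart_def mem_Times_iff)

lemma fst_eq_dart: "fst d = fst d' \<longleftrightarrow> d = d' \<or> d = rev_dart d'"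
  by (cases d; cases d') auto

lemma (in wf_digraph) dstart_in_verts: "d \<in> darts G \<Longrightarrow> dstart G d \<in> verts G"
  by (auto simp: darts_def dstart_def)

fun dwalk :: "('v, 'e) pre_digraph \<Rightarrow> 'v \<Rightarrow> 'e dart list \<Rightarrow> 'v \<Rightarrow> bool" where
  "dwalk G u [] v \<longleftrightarrow> u = v"
| "dwalk G u (d # ds) v \<longleftrightarrow> dstart G d = u \<and> dwalk G (dend G d) ds v"

text \<open>Distinct starting vertices alone would admit the walk that runs along an edge and back,
  hence the condition on the underlying edges. A loop is a cycle of length 1, and a pair of parallel
  edges gives one of length 2.\<close>

definition cyc :: "('v, 'e) pre_digraph \<Rightarrow> 'e dart list \<Rightarrow> bool" where
  "cyc G ds \<longleftrightarrow> ds \<noteq> [] \<and> set ds \<subseteq> darts G \<and> distinct (map fst ds) \<and>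
     distinct (map (dstart G) ds) \<and> dwalk G (dstart G (hd ds)) ds (dstart G (hd ds))"

lemma dwalk_append: "dwalk G u (xs @ ys) v \<longleftrightarrow> (\<exists>w. dwalk G u xs w \<and> dwalk G w ys v)"
  by (induction xs arbitrary: u) auto

lemma dwalk_end: "dwalk G u ds v \<Longrightarrow> ds \<noteq> [] \<Longrightarrow> v = dend G (last ds)"
  by (induction ds arbitrary: u) (auto split: if_splits)

lemma cyc_rotate: "cyc G (xs @ ys) \<Longrightarrow> cyc G (ys @ xs)"
proof (cases "xs = [] \<or> ys = []")
  case False
  assume c: "cyc G (xs @ ys)"
  with False obtain w where w: "dwalk G (dstart G (hd xs)) xs w" "dwalk G w ys (dstart G (hd xs))"
    by (auto simp: cyc_def dwalk_append)
  with False have "w = dstart G (hd ys)"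
    by (cases ys) auto
  with c w False show ?thesis
    by (auto simp: cyc_def dwalk_append)
qed auto

lemma cyc_subset:
  assumes "cyc H ds" "darts H \<subseteq> darts G" "dstart H = dstart G"
  shows "cyc G ds"
proof -
  have "dwalk H u xs v = dwalk G u xs v" for u xs v
    by (induction xs arbitrary: u) (auto simp: assms(3))
  then show ?thesis
    using assms unfolding cyc_def by auto
qed

text \<open>Terms of edges and corners alternate. A corner is recorded by the two half-edges leaving
  its vertex, so the arriving dart enters \<open>c\<close> reversed; traversing the walk backwards
  swaps the arguments of \<open>c\<close>.\<close>

fun wsum :: "('e dart \<Rightarrow> 'a) \<Rightarrow> ('e dart \<Rightarrow> 'e dart \<Rightarrow> 'a) \<Rightarrow> 'e dart list \<Rightarrow> 'a::comm_monoid_add" where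
  "wsum k c [] = 0"
| "wsum k c [d] = k d"
| "wsum k c (d # d' # ds) = k d + c (rev_dart d) d' + wsum k c (d' # ds)"

definition csum :: "('e dart \<Rightarrow> 'a) \<Rightarrow> ('e dart \<Rightarrow> 'e dart \<Rightarrow> 'a) \<Rightarrow> 'e dart list \<Rightarrow> 'a::comm_monoid_add" where
  "csum k c ds = wsum k c ds + c (rev_dart (last ds)) (hd ds)"

lemma wsum_append:
  "xs \<noteq> [] \<Longrightarrow> ys \<noteq> [] \<Longrightarrow>
    wsum k c (xs @ ys) = wsum k c xs + c (rev_dart (last xs)) (hd ys) + wsum k c ys"
proof (induction xs rule: induct_list012)
  case (2 x)
  then show ?case by (cases ys) auto
qed (auto simp: add.assoc)

lemma csum_rotate: "csum k c (xs @ ys) = csum k c (ys @ xs)"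
  by (cases "xs = [] \<or> ys = []") (auto simp: csum_def wsum_append add_ac)

lemma wsum_nth:
  "ds \<noteq> [] \<Longrightarrow> wsum k c ds =
     (\<Sum>i<length ds. k (ds ! i)) + (\<Sum>i<length ds - 1. c (rev_dart (ds ! i)) (ds ! Suc i))"
proof (induction ds rule: induct_list012)
  case (3 x y zs)
  then show ?case
    by (simp add: sum.lessThan_Suc_shift add_ac del: sum.lessThan_Suc)
qed auto

lemma csum_nth:
  assumes "ds \<noteq> []"
  shows "csum k c ds =
    (\<Sum>i<length ds. k (ds ! i) + c (rev_dart (ds ! i)) (ds ! (Suc i mod length ds)))"
proof -
  obtain n where n: "length ds = Suc n"
    using assms by (cases ds) auto
  have "(\<Sum>i<n. c (rev_dart (ds ! i)) (ds ! (Suc i mod length ds))) =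
      (\<Sum>i<n. c (rev_dart (ds ! i)) (ds ! Suc i))"
    by (rule sum.cong) (auto simp: n)
  then show ?thesis
    using assms by (simp add: csum_def wsum_nth sum.distrib n last_conv_nth hd_conv_nth add_ac)
qed

lemma dwalk_nth:
  "dwalk G u ds v \<Longrightarrow> Suc i < length ds \<Longrightarrow> dend G (ds ! i) = dstart G (ds ! Suc i)"
proof (induction ds arbitrary: u i)
  case (Cons d ds)
  then show ?case
    by (cases i; cases ds) auto
qed auto

lemma cyc_nth:
  assumes "cyc G ds" "i < length ds"
  shows "dend G (ds ! i) = dstart G (ds ! (Suc i mod length ds))"
proof (cases "Suc i < length ds")
  case True
  then show ?thesis
    using assms dwalk_nth unfolding cyc_def by fastforce
next
  case False
  then have "Suc i = length ds"
    using assms by auto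
  moreover from this have "dend G (last ds) = dstart G (hd ds)"
    using assms unfolding cyc_def by (metis dwalk_end)
  ultimately show ?thesis
    using assms by (simp add: cyc_def last_conv_nth hd_conv_nth flip: \<open>Suc i = length ds\<close>)
qed

lemma wsum_cong:
  assumes "\<And>d. d \<in> set ds \<Longrightarrow> k d = k' d"
    "\<And>d d'. d \<in> set ds \<Longrightarrow> d' \<in> set ds \<Longrightarrow> c (rev_dart d) d' = c' (rev_dart d) d'"
  shows "wsum k c ds = wsum k' c' ds"
  using assms by (induction ds rule: induct_list012) auto

section \<open>Odd systems and minors\<close>

text \<open>Corners are constrained for all pairs of distinct half-edges at a vertex, whether or not
  some cycle passes there: a contraction builds its new corners from such pairs.\<close>

definition odd_system :: "('v, 'e) pre_digraph \<Rightarrow> ('e dart \<Rightarrow> int) \<Rightarrow> ('e dart \<Rightarrow> 'e dart \<Rightarrow> int) \<Rightarrow> bool" where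
  "odd_system G k c \<longleftrightarrow>
     (\<forall>d\<in>darts G. odd (k d) \<and> k (rev_dart d) = - k d) \<and>
     (\<forall>d\<in>darts G. \<forall>d'\<in>darts G. d \<noteq> d' \<and> dstart G d = dstart G d' \<longrightarrow>
        odd (c d d') \<and> c d' d = - c d d') \<and>
     (\<forall>ds. cyc G ds \<longrightarrow> csum k c ds = 0)"

lemma odd_system_subset:
  assumes "odd_system G k c" "darts H \<subseteq> darts G" "dstart H = dstart G"
  shows "odd_system H k c"
  unfolding odd_system_def
proof (intro conjI ballI allI impI)
  fix ds assume "cyc H ds"
  then show "csum k c ds = 0"
    using assms(1) cyc_subset[OF _ assms(2,3)] unfolding odd_system_def by blast
qed (use assms(1) subsetD[OF assms(2)] assms(3) in \<open>auto simp: odd_system_def\<close>)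

definition merge_head :: "('v, 'e) pre_digraph \<Rightarrow> 'e \<Rightarrow> 'v \<Rightarrow> 'v" where
  "merge_head G a v = (if v = head G a then tail G a else v)"

lemma contract_arc_simps [simp]:
  "verts (contract_arc G a) = merge_head G a ` verts G"
  "arcs (contract_arc G a) = arcs G - {a}"
  "tail (contract_arc G a) e = merge_head G a (tail G e)"
  "head (contract_arc G a) e = merge_head G a (head G e)"
  by (simp_all add: contract_arc_def Let_def merge_head_def[abs_def])

lemma dstart_contract_arc [simp]: "dstart (contract_arc G a) d = merge_head G a (dstart G d)"
  by (simp add: dstart_def)

lemma darts_contract_arc: "darts (contract_arc G a) = {d \<in> darts G. fst d \<noteq> a}"
  by (auto simp: darts_def)

text \<open>The merged vertex, represented by \<open>tail G a\<close>, is the only one that can have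
  several preimages. If no dart after the first starts there, consecutive darts already meet in
  \<open>G\<close>; only the closing up of a walk can fail.\<close>

lemma contract_dwalk:
  assumes "dwalk (contract_arc G a) u ds v" "ds \<noteq> []"
    "\<And>d. d \<in> set (tl ds) \<Longrightarrow> merge_head G a (dstart G d) \<noteq> tail G a"
  shows "dwalk G (dstart G (hd ds)) ds (dend G (last ds))"
  using assms
proof (induction ds arbitrary: u rule: induct_list012)
  case (3 x y zs)
  have "dwalk G (dstart G (hd (y # zs))) (y # zs) (dend G (last (y # zs)))"
    by (rule "3.IH"(2)[of "merge_head G a (dend G x)"]) (use 3 in auto)
  moreover have "merge_head G a (dstart G y) = merge_head G a (dend G x)"
    using 3 by simp
  then have "dstart G y = dend G x"
    using "3.prems"(3)[of y] by (auto simp: merge_head_def split: if_splits)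
  ultimately show ?case
    by simp
qed auto

lemma wsum_dwalk_cong:
  assumes "dwalk G u ds v" "\<And>d d'. dstart G d = dstart G d' \<Longrightarrow> c d d' = c' d d'"
  shows "wsum k c ds = wsum k c' ds"
  using assms(1)
proof (induction ds arbitrary: u rule: induct_list012)
  case (3 x y zs)
  then have "wsum k c (y # zs) = wsum k c' (y # zs)" "dstart G (rev_dart x) = dstart G y"
    by auto
  then show ?case
    using assms(2) by simp
qed auto

text \<open>A new corner at the merged vertex is a sum of three odd numbers, hence odd, and
  reversing the passage negates it. A cycle meets the merged vertex at most once, so it is already a
  cycle of \<open>G\<close> or becomes one when the contracted edge is inserted there; the two sums
  agree by the choice of \<open>c'\<close>. Contracting a loop amounts to deleting it.\<close>

lemma odd_system_contract_arc:
  assumes sys: "odd_system G k c" and a: "a \<in> arcs G"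
  shows "\<exists>c'. odd_system (contract_arc G a) k c'"
proof (cases "tail G a = head G a")
  case True
  then have "merge_head G a v = v" for v
    by (simp add: merge_head_def)
  then have "odd_system (contract_arc G a) k c"
    by (intro odd_system_subset[OF sys]) (auto simp: darts_contract_arc)
  then show ?thesis
    by blast
next
  case False
  define t where "t = tail G a"
  define h where "h = head G a"
  define A where "A = (a, True)"
  have A: "dstart G A = t" "dend G A = h" "A \<in> darts G" "fst A = a" and th: "t \<noteq> h"
    using a False by (auto simp: A_def t_def h_def dstart_def darts_def)
  \<comment> \<open>A corner at the merged vertex is replaced by the passage along the contracted edge.\<close>
  define c' where "c' d d' =
     (if dstart G d = dstart G d' then c d d'
      else if dstart G d = t then c d A + k A + c (rev_dart A) d'
      else c d (rev_dart A) + k (rev_dart A) + c A d')" for d d'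
  have merge_eq: "merge_head G a u = merge_head G a v \<longleftrightarrow> u = v \<or> {u, v} = {t, h}" for u v
    by (auto simp: merge_head_def t_def h_def)
  have k: "odd (k d)" "k (rev_dart d) = - k d" if "d \<in> darts G" for d
    using sys that unfolding odd_system_def by blast+
  have c: "odd (c d d')" "c d' d = - c d d'"
    if "d \<in> darts G" "d' \<in> darts G" "d \<noteq> d'" "dstart G d = dstart G d'" for d d'
    using sys that unfolding odd_system_def by blast+
  have "odd (c' d d') \<and> c' d' d = - c' d d'"
    if d: "d \<in> darts (contract_arc G a)" "d' \<in> darts (contract_arc G a)" "d \<noteq> d'"
      "dstart (contract_arc G a) d = dstart (contract_arc G a) d'" for d d'
  proof (cases "dstart G d = dstart G d'")
    case True
    then show ?thesis
      using that c[of d d'] by (auto simp: c'_def darts_contract_arc)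
  next
    case False
    have D: "d \<in> darts G" "d' \<in> darts G" "fst d \<noteq> a" "fst d' \<noteq> a"
      using d by (auto simp: darts_contract_arc)
    then have ne: "d \<noteq> A" "d \<noteq> rev_dart A" "d' \<noteq> A" "d' \<noteq> rev_dart A"
      using A by auto
    have "{dstart G d, dstart G d'} = {t, h}"
      using d(4) False by (simp add: merge_eq)
    then consider "dstart G d = t" "dstart G d' = h" | "dstart G d = h" "dstart G d' = t"
      by (auto simp: doubleton_eq_iff)
    then show ?thesis
    proof cases
      case 1
      then show ?thesis
        using c[of d A] c[of "rev_dart A" d'] k[of A] D A ne th by (auto simp: c'_def)
    next
      case 2
      then show ?thesis
        using c[of d "rev_dart A"] c[of A d'] k[of A] D A ne th by (auto simp: c'_def)
    qed
  qed
  moreover have "csum k c' ds = 0" if ds: "cyc (contract_arc G a) ds" for ds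
  proof -
    have walk_sum: "wsum k c' xs = wsum k c xs" if "dwalk G u xs v" for xs u v
      by (rule wsum_dwalk_cong[OF that]) (simp add: c'_def)
    \<comment> \<open>Every cycle can be rotated so that the merged vertex, if it is visited, is the
      start of the first dart. The walk then lifts to \<open>G\<close> and can fail to close up only
      at its two ends.\<close>
    have *: "csum k c' xs = 0"
      if xs: "cyc (contract_arc G a) xs" and tl: "\<And>d. d \<in> set (tl xs) \<Longrightarrow> merge_head G a (dstart G d) \<noteq> t" for xs
    proof -
      have ne: "xs \<noteq> []"
        using xs by (simp add: cyc_def)
      have w: "dwalk G (dstart G (hd xs)) xs (dend G (last xs))"
        using contract_dwalk[of G a _ xs] xs tl ne by (auto simp: cyc_def t_def)
      have "merge_head G a (dend G (last xs)) = merge_head G a (dstart G (hd xs))"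
        using xs dwalk_end unfolding cyc_def by fastforce
      then have cs: "dend G (last xs) = dstart G (hd xs) \<or> {dend G (last xs), dstart G (hd xs)} = {t, h}"
        by (simp add: merge_eq)
      have dist: "distinct (map (merge_head G a) (map (dstart G) xs))" "distinct (map fst xs)"
        "set xs \<subseteq> darts G" "a \<notin> fst ` set xs"
        using xs by (auto simp: cyc_def darts_contract_arc o_def dstart_contract_arc[abs_def])
      then have dist': "distinct (map (dstart G) xs)"
        using distinct_map by blast
      show ?thesis
      proof (cases "dend G (last xs) = dstart G (hd xs)")
        case True
        then have "cyc G xs"
          using w dist dist' ne by (auto simp: cyc_def)
        then have "csum k c xs = 0"
          using sys by (auto simp: odd_system_def)
        then show ?thesis
          using walk_sum[OF w] True by (simp add: csum_def c'_def)
      next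
        case False
        \<comment> \<open>The lift ends at one end of the contracted edge and begins at the other;
          \<open>X\<close> is that edge, directed so as to close the cycle.\<close>
        define X where "X = (if dend G (last xs) = t then A else rev_dart A)"
        have X: "dstart G X = dend G (last xs)" "dend G X = dstart G (hd xs)" "fst X = a" "X \<in> darts G"
          using cs False A by (auto simp: X_def doubleton_eq_iff)
        have mX: "merge_head G a (dstart G X) = t"
          using cs False X by (auto simp: merge_head_def t_def h_def doubleton_eq_iff)
        obtain x ys where x: "xs = x # ys"
          using ne by (cases xs) auto
        have "dstart G X \<notin> dstart G ` set xs"
        proof
          assume "dstart G X \<in> dstart G ` set xs"
          then obtain d where d: "d \<in> set xs" "dstart G d = dstart G X"
            by force
          then show False
            using tl[of d] mX X(1) False x by auto
        qed
        then have "cyc G (xs @ [X])"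
          using w dist dist' ne X by (auto simp: cyc_def dwalk_append)
        then have "csum k c (xs @ [X]) = 0"
          using sys by (auto simp: odd_system_def)
        then have "wsum k c xs + (c (rev_dart (last xs)) X + k X + c (rev_dart X) (hd xs)) = 0"
          using ne by (simp add: csum_def wsum_append add_ac)
        moreover have "c' (rev_dart (last xs)) (hd xs) = c (rev_dart (last xs)) X + k X + c (rev_dart X) (hd xs)"
          using False by (simp add: c'_def X_def)
        ultimately show ?thesis
          using walk_sum[OF w] by (simp add: csum_def)
      qed
    qed
    show ?thesis
    proof (cases "\<exists>d\<in>set ds. merge_head G a (dstart G d) = t")
      case True
      then obtain d where d: "d \<in> set ds" "merge_head G a (dstart G d) = t"
        by blast
      then obtain ys zs where split: "ds = ys @ d # zs"
        by (meson split_list)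
      then have rot: "cyc (contract_arc G a) (d # zs @ ys)"
        using ds cyc_rotate[of _ ys "d # zs"] by simp
      have "csum k c' (d # zs @ ys) = 0"
      proof (rule *[OF rot])
        fix d' assume "d' \<in> set (tl (d # zs @ ys))"
        then have "dstart (contract_arc G a) d' \<in> dstart (contract_arc G a) ` set (zs @ ys)"
          by simp
        moreover have "dstart (contract_arc G a) d \<notin> dstart (contract_arc G a) ` set (zs @ ys)"
          using rot by (simp add: cyc_def image_Un del: dstart_contract_arc)
        ultimately show "merge_head G a (dstart G d') \<noteq> t"
          using d(2) by auto
      qed
      then show ?thesis
        using csum_rotate[of k c' ys "d # zs"] split by simp
    next
      case False
      then show ?thesis
        using ds by (intro *) (auto dest: list.set_sel(2)[rotated] simp: cyc_def)
    qed
  qed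
  ultimately have "odd_system (contract_arc G a) k c'"
    using k unfolding odd_system_def by (simp add: darts_contract_arc)
  then show ?thesis
    by blast
qed

lemma odd_system_minor:
  assumes "is_minor_of H G" "odd_system G k c"
  shows "\<exists>k c. odd_system H k c"
  using assms
proof (induction)
  case (refl G)
  then show ?case by blast
next
  case (delete_edge H G a)
  then obtain k c where "odd_system H k c"
    by blast
  then have "odd_system (pre_digraph.del_arc H a) k c"
    by (rule odd_system_subset)
      (auto simp: darts_def dstart_def fun_eq_iff pre_digraph.del_arc_def)
  then show ?case by blast
next
  case (delete_vertex H G v)
  then obtain k c where "odd_system H k c"
    by blast
  then have "odd_system (pre_digraph.del_vert H v) k c"
    by (rule odd_system_subset)
      (auto simp: darts_def dstart_def fun_eq_iff pre_digraph.del_vert_def)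
  then show ?case by blast
next
  case (contract_edge H G a)
  then obtain k' c' where "odd_system H k' c'"
    by blast
  from odd_system_contract_arc[OF this contract_edge.hyps(2)] show ?case
    by blast
qed

text \<open>In the sum of all seven cycle equations every edge occurs four times (two triangles, two
  4-cycles) and every corner twice (one triangle, one 4-cycle). As all numbers are odd, changing the
  sign of one of them, or the orientation of one cycle, changes the total by a multiple of 4. The
  total therefore has a fixed residue modulo 4, and this residue is 2 instead of 0.\<close>

lemma no_odd_system_K4:
  assumes K4: "is_complete_graph 4 H"
  shows "\<not> odd_system H k c"
proof
  assume sys: "odd_system H k c"
  interpret loopfree_digraph H
    using K4 by (simp add: is_complete_graph_def)
  have "card (verts H) = 4"
    using K4 by (simp add: is_complete_graph_def)
  then obtain p q r s where V: "verts H = {p, q, r, s}" and D: "distinct [p, q, r, s]"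
    by (auto simp: card_Suc_eq numeral_eq_Suc)
  define E where "E u v = (THE a. a \<in> arcs H \<and> {tail H a, head H a} = {u, v})" for u v
  define D' where "D' u v = (E u v, tail H (E u v) = u)" for u v
  have E: "E u v \<in> arcs H \<and> {tail H (E u v), head H (E u v)} = {u, v}"
    if "u \<in> verts H" "v \<in> verts H" "u \<noteq> v" for u v
    unfolding E_def by (rule theI') (use K4 that in \<open>auto simp: is_complete_graph_def\<close>)
  have E_sym: "E u v = E v u" for u v
    by (simp add: E_def insert_commute)
  have D': "dstart H (D' u v) = u" "rev_dart (D' u v) = D' v u" "D' u v \<in> darts H" "fst (D' u v) = E u v"
    if "u \<in> verts H" "v \<in> verts H" "u \<noteq> v" for u v
    using E[OF that] E_sym[of u v] that no_loops[of "E u v"]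
    by (auto simp: D'_def dstart_def darts_def doubleton_eq_iff)
  have E_eq: "E u v = E u' v' \<longleftrightarrow> {u, v} = {u', v'}"
    if "u \<in> verts H" "v \<in> verts H" "u \<noteq> v" "u' \<in> verts H" "v' \<in> verts H" "u' \<noteq> v'" for u v u' v'
    using E[OF that(1-3)] E[OF that(4-6)] E_sym by (metis doubleton_eq_iff)
  have K: "odd (k (D' u v))" "k (D' v u) = - k (D' u v)"
    if "u \<in> verts H" "v \<in> verts H" "u \<noteq> v" for u v
    using sys D'[OF that] unfolding odd_system_def by metis+
  have C: "odd (c (D' u v) (D' u w))" "c (D' u w) (D' u v) = - c (D' u v) (D' u w)"
    if "u \<in> verts H" "v \<in> verts H" "w \<in> verts H" "distinct [u, v, w]" for u v w
  proof -
    have "D' u v \<noteq> D' u w"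
      using D'(2)[of u v] D'(2)[of u w] D'(1)[of v u] D'(1)[of w u] that by auto
    then show "odd (c (D' u v) (D' u w))" "c (D' u w) (D' u v) = - c (D' u v) (D' u w)"
      using sys D'[of u v] D'[of u w] that unfolding odd_system_def by (metis distinct_length_2_or_more)+
  qed
  have three: "k (D' u v) + c (D' v u) (D' v w) + k (D' v w) + c (D' w v) (D' w u) + k (D' w u)
      + c (D' u w) (D' u v) = 0"
    if "u \<in> verts H" "v \<in> verts H" "w \<in> verts H" "distinct [u, v, w]" for u v w
  proof -
    have ne: "u \<noteq> v" "v \<noteq> w" "w \<noteq> u" "v \<noteq> u" "w \<noteq> v" "u \<noteq> w"
      using that by auto
    have "cyc H [D' u v, D' v w, D' w u]"
      using that(1-3) ne by (simp add: cyc_def D' E_eq doubleton_eq_iff)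
    then have "csum k c [D' u v, D' v w, D' w u] = 0"
      using sys by (simp add: odd_system_def)
    then show ?thesis
      using that ne by (simp add: csum_def D' add_ac)
  qed
  have four: "k (D' u v) + c (D' v u) (D' v w) + k (D' v w) + c (D' w v) (D' w x) + k (D' w x)
      + c (D' x w) (D' x u) + k (D' x u) + c (D' u x) (D' u v) = 0"
    if "u \<in> verts H" "v \<in> verts H" "w \<in> verts H" "x \<in> verts H" "distinct [u, v, w, x]" for u v w x
  proof -
    have ne: "u \<noteq> v" "v \<noteq> w" "w \<noteq> u" "v \<noteq> u" "w \<noteq> v" "u \<noteq> w" "u \<noteq> x" "v \<noteq> x" "w \<noteq> x" "x \<noteq> u" "x \<noteq> v" "x \<noteq> w"
      using that by auto
    have "cyc H [D' u v, D' v w, D' w x, D' x u]"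
      using that(1-4) ne by (simp add: cyc_def D' E_eq doubleton_eq_iff)
    then have "csum k c [D' u v, D' v w, D' w x, D' x u] = 0"
      using sys by (simp add: odd_system_def)
    then show ?thesis
      using that ne by (simp add: csum_def D' add_ac)
  qed
  have Dd: "p \<noteq> q" "p \<noteq> r" "p \<noteq> s" "q \<noteq> r" "q \<noteq> s" "r \<noteq> s"
    using D by auto
  have pV: "p \<in> verts H" "q \<in> verts H" "r \<in> verts H" "s \<in> verts H"
    using V by auto
  have ds: "distinct [p, q, r]" "distinct [p, q, s]" "distinct [p, r, s]" "distinct [q, p, r]" "distinct [q, p, s]" "distinct [q, r, s]" "distinct [r, p, q]" "distinct [r, p, s]" "distinct [r, q, s]" "distinct [s, p, q]" "distinct [s, p, r]" "distinct [s, q, r]" "distinct [p, q, r, s]" "distinct [p, q, s, r]" "distinct [p, r, q, s]"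
    using D by auto
  note kk = K(2)[OF pV(1) pV(2) Dd(1)] K(2)[OF pV(1) pV(3) Dd(2)] K(2)[OF pV(1) pV(4) Dd(3)] K(2)[OF pV(2) pV(3) Dd(4)] K(2)[OF pV(2) pV(4) Dd(5)] K(2)[OF pV(3) pV(4) Dd(6)]
  note cc = C(2)[OF pV(1) pV(2) pV(3) ds(1)] C(2)[OF pV(1) pV(2) pV(4) ds(2)] C(2)[OF pV(1) pV(3) pV(4) ds(3)] C(2)[OF pV(2) pV(1) pV(3) ds(4)] C(2)[OF pV(2) pV(1) pV(4) ds(5)] C(2)[OF pV(2) pV(3) pV(4) ds(6)] C(2)[OF pV(3) pV(1) pV(2) ds(7)] C(2)[OF pV(3) pV(1) pV(4) ds(8)] C(2)[OF pV(3) pV(2) pV(4) ds(9)] C(2)[OF pV(4) pV(1) pV(2) ds(10)] C(2)[OF pV(4) pV(1) pV(3) ds(11)] C(2)[OF pV(4) pV(2) pV(3) ds(12)]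
  \<comment> \<open>Writing every odd number as twice an integer plus 1 allows the equations to be
    halved; the contradiction modulo 4 becomes one of parity.\<close>
  have odd_def_ex: "odd x \<longleftrightarrow> (\<exists>y. x = 2 * y + 1)" for x :: int
    by (auto elim: oddE)
  obtain k1 k2 k3 k4 k5 k6 where ks:
    "k (D' p q) = 2*k1+1" "k (D' p r) = 2*k2+1" "k (D' p s) = 2*k3+1"
    "k (D' q r) = 2*k4+1" "k (D' q s) = 2*k5+1" "k (D' r s) = 2*k6+1"
    using K(1)[OF pV(1) pV(2) Dd(1)] K(1)[OF pV(1) pV(3) Dd(2)] K(1)[OF pV(1) pV(4) Dd(3)] K(1)[OF pV(2) pV(3) Dd(4)] K(1)[OF pV(2) pV(4) Dd(5)] K(1)[OF pV(3) pV(4) Dd(6)]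
    unfolding odd_def_ex by blast
  obtain c1 c2 c3 c4 c5 c6 c7 c8 c9 c10 c11 c12 where cs:
    "c (D' p q) (D' p r) = 2*c1+1" "c (D' p q) (D' p s) = 2*c2+1" "c (D' p r) (D' p s) = 2*c3+1"
    "c (D' q p) (D' q r) = 2*c4+1" "c (D' q p) (D' q s) = 2*c5+1" "c (D' q r) (D' q s) = 2*c6+1"
    "c (D' r p) (D' r q) = 2*c7+1" "c (D' r p) (D' r s) = 2*c8+1" "c (D' r q) (D' r s) = 2*c9+1"
    "c (D' s p) (D' s q) = 2*c10+1" "c (D' s p) (D' s r) = 2*c11+1" "c (D' s q) (D' s r) = 2*c12+1"
    using C(1)[OF pV(1) pV(2) pV(3) ds(1)] C(1)[OF pV(1) pV(2) pV(4) ds(2)] C(1)[OF pV(1) pV(3) pV(4) ds(3)] C(1)[OF pV(2) pV(1) pV(3) ds(4)] C(1)[OF pV(2) pV(1) pV(4) ds(5)] C(1)[OF pV(2) pV(3) pV(4) ds(6)] C(1)[OF pV(3) pV(1) pV(2) ds(7)] C(1)[OF pV(3) pV(1) pV(4) ds(8)] C(1)[OF pV(3) pV(2) pV(4) ds(9)] C(1)[OF pV(4) pV(1) pV(2) ds(10)] C(1)[OF pV(4) pV(1) pV(3) ds(11)] C(1)[OF pV(4) pV(2) pV(3) ds(12)]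
    unfolding odd_def_ex by blast
  have e1: "k1 + c4 + k4 - c7 - k2 - c1 = 0"
    using three[OF pV(1) pV(2) pV(3) ds(1)] kk cc ks cs by linarith
  have e2: "k1 + c5 + k5 - c10 - k3 - c2 = 0"
    using three[OF pV(1) pV(2) pV(4) ds(2)] kk cc ks cs by linarith
  have e3: "k2 + c8 + k6 - c11 - k3 - c3 = 0"
    using three[OF pV(1) pV(3) pV(4) ds(3)] kk cc ks cs by linarith
  have e4: "k4 + c9 + k6 - c12 - k5 - c6 = 0"
    using three[OF pV(2) pV(3) pV(4) ds(6)] kk cc ks cs by linarith
  have e5: "k1 + c4 + k4 + c9 + k6 - c11 - k3 - c2 + 1 = 0"
    using four[OF pV(1) pV(2) pV(3) pV(4) ds(13)] kk cc ks cs by linarith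
  have e6: "k1 + c5 + k5 + c12 - k6 - c8 - k2 - c1 = 0"
    using four[OF pV(1) pV(2) pV(4) pV(3) ds(14)] kk cc ks cs by linarith
  have e7: "k2 + c7 - k4 + c6 + k5 - c10 - k3 - c3 = 0"
    using four[OF pV(1) pV(3) pV(2) pV(4) ds(15)] kk cc ks cs by linarith
  \<comment> \<open>Every unknown has an even coefficient in this sum, and the only constant left is
    the 1 from the 4-cycle \<open>p\<close>, \<open>q\<close>, \<open>r\<close>,
    \<open>s\<close>.\<close>
  have "(k1 + c4 + k4 - c7 - k2 - c1) + (k1 + c5 + k5 - c10 - k3 - c2) + (k2 + c8 + k6 - c11 - k3 - c3) + (k4 + c9 + k6 - c12 - k5 - c6) + (k1 + c4 + k4 + c9 + k6 - c11 - k3 - c2 + 1) + (k1 + c5 + k5 + c12 - k6 - c8 - k2 - c1) + (k2 + c7 - k4 + c6 + k5 - c10 - k3 - c3) = 0"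
    by (simp only: e1 e2 e3 e4 e5 e6 e7)
  then have "2 * (2 * k1 + c4 + k4 - c1 + c5 + k5 - c10 - 2 * k3 - c2 + k6 - c11 - c3 + c9) = -1"
    by (simp add: algebra_simps)
  then show False
    by presburger
qed

section \<open>Complete minors from long paths\<close>

lemma is_minor_of_trans: "is_minor_of K H \<Longrightarrow> is_minor_of H G \<Longrightarrow> is_minor_of K G"
  by (induction rule: is_minor_of.induct) (auto intro: is_minor_of.intros)

lemma fin_digraph_contract_arc:
  assumes "fin_digraph G"
  shows "fin_digraph (contract_arc G a)"
proof -
  interpret fin_digraph G by fact
  show ?thesis
    by unfold_locales auto
qed

lemma is_minor_of_restrict_arcs:
  assumes "finite (arcs G)" "A \<subseteq> arcs G"
  shows "is_minor_of (G\<lparr>arcs := A\<rparr>) G"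
proof -
  have "is_minor_of (G\<lparr>arcs := arcs G - B\<rparr>) G" if "finite B" "B \<subseteq> arcs G" for B
    using that
  proof (induction B rule: finite_induct)
    case empty
    then show ?case by (simp add: is_minor_of.refl)
  next
    case (insert a B)
    then have "is_minor_of (pre_digraph.del_arc (G\<lparr>arcs := arcs G - B\<rparr>) a) G"
      by (intro is_minor_of.delete_edge) auto
    moreover have "pre_digraph.del_arc (G\<lparr>arcs := arcs G - B\<rparr>) a = G\<lparr>arcs := arcs G - insert a B\<rparr>"
      by (intro pre_digraph.equality) (auto simp: pre_digraph.del_arc_def)
    ultimately show ?case by simp
  qed
  from this[of "arcs G - A"] show ?thesis
    using assms by (simp add: double_diff finite_subset)
qed

lemma is_minor_of_restrict_verts:
  assumes "finite (verts G)" "W \<subseteq> verts G" "\<And>a. a \<in> arcs G \<Longrightarrow> tail G a \<in> W \<and> head G a \<in> W"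
  shows "is_minor_of (G\<lparr>verts := W\<rparr>) G"
proof -
  have "is_minor_of (G\<lparr>verts := verts G - B\<rparr>) G" if "finite B" "B \<subseteq> verts G - W" for B
    using that
  proof (induction B rule: finite_induct)
    case empty
    then show ?case by (simp add: is_minor_of.refl)
  next
    case (insert v B)
    then have "is_minor_of (pre_digraph.del_vert (G\<lparr>verts := verts G - B\<rparr>) v) G"
      by (intro is_minor_of.delete_vertex) auto
    moreover have "{a \<in> arcs G. tail G a \<noteq> v \<and> head G a \<noteq> v} = arcs G"
      using assms(3) insert.prems by auto
    then have "pre_digraph.del_vert (G\<lparr>verts := verts G - B\<rparr>) v = G\<lparr>verts := verts G - insert v B\<rparr>"
      by (intro pre_digraph.equality) (auto simp: pre_digraph.del_vert_def)
    ultimately show ?case by simp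
  qed
  from this[of "verts G - W"] show ?thesis
    using assms by (simp add: double_diff finite_subset)
qed

text \<open>Reachability by this relation expresses that a colour class induces a connected
  subgraph.\<close>

definition class_step :: "('v, 'e) pre_digraph \<Rightarrow> ('v \<Rightarrow> nat) \<Rightarrow> nat \<Rightarrow> ('v \<times> 'v) set" where
  "class_step G col i = {(dstart G d, dend G d) | d. d \<in> darts G \<and> col (dstart G d) = i \<and> col (dend G d) = i}"

text \<open>The vertices of colour less than \<open>n\<close> form the branch sets; the other vertices are not used.\<close>

definition complete_model :: "nat \<Rightarrow> ('v, 'e) pre_digraph \<Rightarrow> ('v \<Rightarrow> nat) \<Rightarrow> bool" where
  "complete_model n G col \<longleftrightarrow>
     (\<forall>i<n. \<exists>v\<in>verts G. col v = i) \<and>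
     (\<forall>i<n. \<forall>v\<in>verts G. \<forall>w\<in>verts G. col v = i \<and> col w = i \<longrightarrow> (v, w) \<in> (class_step G col i)\<^sup>*) \<and>
     (\<forall>i<n. \<forall>j<n. i < j \<longrightarrow> (\<exists>d\<in>darts G. col (dstart G d) = i \<and> col (dend G d) = j))"

text \<open>The ends of the contracted edge have the same colour, so \<open>col\<close> still makes
  sense on the quotient, and walks inside a class project to walks inside it. An edge between two
  classes is never the contracted one.\<close>

lemma complete_model_contract_arc:
  assumes model: "complete_model n G col" and a: "a \<in> arcs G" "col (tail G a) = col (head G a)"
  shows "complete_model n (contract_arc G a) col"
proof -
  have col: "col (merge_head G a v) = col v" for v
    using a by (simp add: merge_head_def)
  have "(merge_head G a v, merge_head G a w) \<in> (class_step (contract_arc G a) col i)\<^sup>*"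
    if "(v, w) \<in> (class_step G col i)\<^sup>*" for v w i
    using that
  proof induction
    case (step w x)
    then obtain d where d: "d \<in> darts G" "dstart G d = w" "dend G d = x" "col w = i" "col x = i"
      by (auto simp: class_step_def)
    show ?case
    proof (cases "fst d = a")
      case True
      then have "merge_head G a w = merge_head G a x"
        using d by (auto simp: dstart_def merge_head_def)
      then show ?thesis
        using step.IH by simp
    next
      case False
      then have "(merge_head G a w, merge_head G a x) \<in> class_step (contract_arc G a) col i"
        using d col unfolding class_step_def
        by (intro CollectI exI[of _ d]) (auto simp: darts_contract_arc)
      then show ?thesis
        using step.IH by (rule rtrancl_into_rtrancl[rotated])
    qed
  qed auto
  moreover have "\<exists>d\<in>darts (contract_arc G a). col (dstart (contract_arc G a) d) = i \<and> col (dend (contract_arc G a) d) = j"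
    if ij: "i < n" "j < n" "i < j" for i j
  proof -
    obtain d where d: "d \<in> darts G" "col (dstart G d) = i" "col (dend G d) = j"
      using model ij unfolding complete_model_def by (meson order.strict_trans)
    then have "fst d \<noteq> a"
      using a ij by (auto simp: dstart_def split: if_splits)
    then show ?thesis
      using d col by (intro bexI[of _ d]) (auto simp: darts_contract_arc)
  qed
  ultimately show ?thesis
    using model col by (simp add: complete_model_def)
qed

text \<open>This is the end of the contraction process: a connected class whose inner edges are all
  loops is a single vertex. Keeping one edge for each pair of classes and discarding everything else
  leaves a complete graph.\<close>

lemma complete_model_singletons:
  assumes "fin_digraph G" and model: "complete_model n G col"
    and inner: "\<And>a. a \<in> arcs G \<Longrightarrow> col (tail G a) = col (head G a) \<Longrightarrow> col (head G a) < n \<Longrightarrow>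
      tail G a = head G a"
  shows "has_complete_minor n G"
proof -
  interpret fin_digraph G by fact
  have "\<forall>i<n. \<exists>v\<in>verts G. col v = i"
    using model by (simp add: complete_model_def)
  then obtain b where b: "\<And>i. i < n \<Longrightarrow> b i \<in> verts G \<and> col (b i) = i"
    by metis
  have b_unique: "v = b i" if "v \<in> verts G" "col v = i" "i < n" for v i
  proof -
    have "class_step G col i \<subseteq> Id"
    proof
      fix x assume "x \<in> class_step G col i"
      then obtain d where d: "x = (dstart G d, dend G d)" "fst d \<in> arcs G" "col (dstart G d) = i" "col (dend G d) = i"
        by (auto simp: class_step_def darts_def)
      then have "tail G (fst d) = head G (fst d)"
        using inner[of "fst d"] that(3) by (cases "snd d") (auto simp: dstart_def)
      then show "x \<in> Id"
        using d(1) by (simp add: dstart_def)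
    qed
    then have "(class_step G col i)\<^sup>* \<subseteq> Id\<^sup>*"
      by (rule rtrancl_mono)
    moreover have "(v, b i) \<in> (class_step G col i)\<^sup>*"
      using model that b[of i] by (auto simp: complete_model_def)
    ultimately show ?thesis
      by auto
  qed
  have "\<exists>d. i < j \<and> j < n \<longrightarrow> d \<in> darts G \<and> col (dstart G d) = i \<and> col (dend G d) = j" for i j
  proof (cases "i < j \<and> j < n")
    case True
    moreover from model have "\<forall>i<n. \<forall>j<n. i < j \<longrightarrow> (\<exists>d\<in>darts G. col (dstart G d) = i \<and> col (dend G d) = j)"
      by (simp add: complete_model_def)
    ultimately obtain d where "d \<in> darts G" "col (dstart G d) = i" "col (dend G d) = j"
      using less_trans by metis
    then show ?thesis
      by blast
  qed auto
  then obtain E where E: "\<And>i j. i < j \<Longrightarrow> j < n \<Longrightarrow> E i j \<in> darts G \<and> col (dstart G (E i j)) = i \<and> col (dend G (E i j)) = j"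
    by metis
  have E_ends: "E i j \<in> darts G" "dstart G (E i j) = b i" "dend G (E i j) = b j" if "i < j" "j < n" for i j
    using E[OF that] b_unique that by (auto simp: dstart_in_verts)
  have b_inj: "b i = b j \<longleftrightarrow> i = j" if "i < n" "j < n" for i j
    using b that by metis
  define A where "A = {fst (E i j) | i j. i < j \<and> j < n}"
  define H where "H = G\<lparr>arcs := A\<rparr>\<lparr>verts := b ` {..<n}\<rparr>"
  have A_sub: "A \<subseteq> arcs G"
    using E_ends(1) by (force simp: A_def darts_def)
  have A_ends: "{tail G (fst (E i j)), head G (fst (E i j))} = {b i, b j}" if "i < j" "j < n" for i j
    using E_ends(2,3)[OF that] by (auto simp: dstart_def split: if_splits)
  have tips: "tail G a \<in> b ` {..<n} \<and> head G a \<in> b ` {..<n} \<and> tail G a \<noteq> head G a" if a: "a \<in> A" for a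
  proof -
    obtain i j where ij: "a = fst (E i j)" "i < j" "j < n"
      using a unfolding A_def by blast
    with A_ends[of i j] b_inj[of i j] show ?thesis
      by (auto simp: doubleton_eq_iff)
  qed
  have "is_minor_of H (G\<lparr>arcs := A\<rparr>)"
    unfolding H_def using b tips by (intro is_minor_of_restrict_verts) auto
  moreover have "is_minor_of (G\<lparr>arcs := A\<rparr>) G"
    using A_sub by (intro is_minor_of_restrict_arcs) auto
  ultimately have "is_minor_of H G"
    by (rule is_minor_of_trans)
  moreover have "is_complete_graph n H"
    unfolding is_complete_graph_def
  proof (intro conjI ballI impI)
    show "loopfree_digraph H"
      using tips by unfold_locales (auto simp: H_def)
    show "finite (verts H)"
      by (simp add: H_def)
    have "inj_on b {..<n}"
      using b_inj by (auto simp: inj_on_def)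
    then show "card (verts H) = n"
      by (simp add: H_def card_image)
    fix u v assume "u \<in> verts H" "v \<in> verts H" "u \<noteq> v"
    then obtain i j where ij: "i < j" "j < n" "{u, v} = {b i, b j}"
      by (auto simp: H_def) (metis insert_commute nat_neq_iff)
    show "\<exists>!a. a \<in> arcs H \<and> {tail H a, head H a} = {u, v}"
    proof (rule ex1I)
      show "fst (E i j) \<in> arcs H \<and> {tail H (fst (E i j)), head H (fst (E i j))} = {u, v}"
        using ij A_ends[of i j] by (auto simp: H_def A_def)
      fix a assume "a \<in> arcs H \<and> {tail H a, head H a} = {u, v}"
      then obtain i' j' where ij': "a = fst (E i' j')" "i' < j'" "j' < n" "{b i', b j'} = {b i, b j}"
        using A_ends ij by (auto simp: H_def A_def)
      then have "i = i'" "j = j'"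
        using ij b_inj by (auto simp: doubleton_eq_iff)
      then show "a = fst (E i j)"
        using ij' by simp
    qed
  qed
  ultimately show ?thesis
    by (auto simp: has_complete_minor_def)
qed

text \<open>Contracting a non-loop edge inside a class keeps the model and removes an edge, so
  induction on the number of edges leads to classes without such edges.\<close>

lemma complete_model_minor:
  assumes "fin_digraph G" "complete_model n G col"
  shows "has_complete_minor n G"
  using assms
proof (induction "card (arcs G)" arbitrary: G rule: less_induct)
  case less
  interpret fin_digraph G by fact
  show ?case
  proof (cases "\<exists>a\<in>arcs G. tail G a \<noteq> head G a \<and> col (tail G a) = col (head G a)")
    case True
    then obtain a where a: "a \<in> arcs G" "col (tail G a) = col (head G a)"
      by blast
    have "card (arcs (contract_arc G a)) < card (arcs G)"
      using card_Diff1_less[OF finite_arcs a(1)] by simp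
    then have "has_complete_minor n (contract_arc G a)"
      by (rule less.hyps[OF _ fin_digraph_contract_arc[OF less.prems(1)] complete_model_contract_arc[OF less.prems(2) a]])
    moreover have "is_minor_of (contract_arc G a) G"
      using a by (intro is_minor_of.intros)
    ultimately show ?thesis
      unfolding has_complete_minor_def using is_minor_of_trans by blast
  next
    case False
    then show ?thesis
      using less.prems by (intro complete_model_singletons) auto
  qed
qed

text \<open>
  Among all longest paths take one whose first vertex has a neighbour of smallest possible index
  \<open>i \<ge> 2\<close> on it. Reversing the initial segment of length \<open>i\<close> gives another longest path, so the
  vertex of index \<open>i - 1\<close> cannot have a further neighbour of smaller index.
\<close>

lemma crossing_chords:
  fixes adj :: "'v \<Rightarrow> 'v \<Rightarrow> bool"
  assumes fin: "finite V" and V: "\<And>u v. adj u v \<Longrightarrow> u \<in> V"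
    and sym: "\<And>u v. adj u v \<Longrightarrow> adj v u" and irrefl: "\<And>u. \<not> adj u u" and ex: "adj u0 v0"
    and deg: "\<And>v z x y. adj v z \<Longrightarrow> \<exists>z. adj v z \<and> z \<noteq> x \<and> z \<noteq> y"
  shows "\<exists>vs i j m. distinct vs \<and> (\<forall>k. Suc k < length vs \<longrightarrow> adj (vs ! k) (vs ! Suc k)) \<and>
    2 \<le> i \<and> i < j \<and> i < m \<and> j < length vs \<and> m < length vs \<and>
    adj (vs ! 0) (vs ! i) \<and> adj (vs ! 0) (vs ! j) \<and> adj (vs ! (i - 1)) (vs ! m)"
proof -
  define path where "path vs \<longleftrightarrow> distinct vs \<and> set vs \<subseteq> V \<and> successively adj vs" for vs
  have "length vs \<le> card V" if "path vs" for vs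
    using that fin by (metis card_mono distinct_card path_def)
  moreover have "path [u0, v0]"
    using ex V sym irrefl by (auto simp: path_def)
  ultimately obtain vs0 where vs0: "path vs0" "\<And>vs. path vs \<Longrightarrow> length vs \<le> length vs0"
    using ex_has_greatest_nat[of path "[u0, v0]" length "Suc (card V)"] by (metis le_imp_less_Suc)
  define N where "N = length vs0"
  have N: "2 \<le> N"
    using vs0(2)[OF \<open>path [u0, v0]\<close>] by (simp add: N_def)
  have step: "adj (vs ! k) (vs ! Suc k)" if "path vs" "Suc k < length vs" for vs k
    using that by (simp add: path_def successively_conv_nth)
  have nbr: "\<exists>j. j < N \<and> z = vs ! j" if "path vs" "length vs = N" "adj (vs ! 0) z" for vs z
  proof -
    have "z \<in> set vs"
    proof (rule ccontr)
      assume z: "z \<notin> set vs"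
      have "vs \<noteq> []"
        using that N by auto
      then have "path (z # vs)"
        using that z sym V by (auto simp: path_def successively_Cons hd_conv_nth)
      then show False
        using vs0(2) that by (fastforce simp: N_def)
    qed
    then show ?thesis
      using that by (metis in_set_conv_nth)
  qed
  have first: "\<exists>j. 2 \<le> j \<and> j < N \<and> vs ! j \<noteq> x \<and> adj (vs ! 0) (vs ! j)"
    if vs: "path vs" "length vs = N" for vs x
  proof -
    have "adj (vs ! 0) (vs ! 1)"
      using step[of vs 0] vs N by simp
    from deg[OF this, of "vs ! 1" x] obtain z where z: "adj (vs ! 0) z" "z \<noteq> vs ! 1" "z \<noteq> x"
      by blast
    with nbr[OF vs z(1)] obtain j where j: "j < N" "z = vs ! j"
      by blast
    then have "j \<noteq> 0" "j \<noteq> 1"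
      using z irrefl by metis+
    then show ?thesis
      using z j by (intro exI[of _ j]) auto
  qed
  define Q where "Q i \<longleftrightarrow> (\<exists>vs. path vs \<and> length vs = N \<and> 2 \<le> i \<and> i < N \<and> adj (vs ! 0) (vs ! i))" for i
  define i where "i = (LEAST i. Q i)"
  have "\<exists>i. Q i"
    using first[of vs0] vs0(1) unfolding Q_def N_def by blast
  then have "Q i"
    unfolding i_def by (rule LeastI_ex)
  then obtain vs where vs: "path vs" "length vs = N" and i: "2 \<le> i" "i < N" "adj (vs ! 0) (vs ! i)"
    unfolding Q_def by blast
  have least: "i \<le> k" if "Q k" for k
    unfolding i_def using that by (rule Least_le)
  obtain j where j: "2 \<le> j" "j < N" "vs ! j \<noteq> vs ! i" "adj (vs ! 0) (vs ! j)"
    using first[OF vs] by blast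
  then have "i \<le> j"
    using vs by (intro least) (auto simp: Q_def)
  with j have "i < j"
    by (cases "i = j") auto
  define us where "us = rev (take i vs) @ drop i vs"
  have ne: "take i vs \<noteq> []" "drop i vs \<noteq> []"
    using i vs by auto
  have "successively adj (take i vs)" "successively adj (drop i vs)"
    using vs(1) unfolding path_def by (metis append_take_drop_id successively_append_iff)+
  moreover have "adj (hd (take i vs)) (hd (drop i vs))"
    using i vs ne by (simp add: hd_drop_conv_nth hd_conv_nth)
  moreover have "successively (\<lambda>x y. adj y x) xs = successively adj xs" for xs
    using sym by (induction xs rule: induct_list012) auto
  ultimately have "successively adj us"
    using ne by (simp add: us_def successively_append_iff successively_rev last_rev)
  moreover have "distinct us" "set us = set vs"
    using vs(1) unfolding path_def us_def
    by (metis append_take_drop_id distinct_append distinct_rev set_rev, metis append_take_drop_id set_append set_rev)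
  ultimately have us: "path us" "length us = N"
    using vs i by (auto simp: path_def us_def)
  have us_nth: "us ! k = vs ! (i - 1 - k)" if "k < i" for k
    using that i vs by (simp add: us_def nth_append rev_nth)
  \<comment> \<open>An index from 2 to \<open>i - 1\<close> would contradict the minimality of
    \<open>i\<close>, and the index \<open>i\<close> itself is excluded because \<open>us\<close>
    and \<open>vs\<close> agree from there on. So this third neighbour lies beyond
    \<open>i\<close>.\<close>
  obtain z where z: "adj (us ! 0) z" "z \<noteq> us ! 1" "z \<noteq> vs ! i"
    using deg[OF step[OF us(1), of 0], of "us ! 1" "vs ! i"] us N by auto
  then obtain k where k: "k < N" "z = us ! k"
    using nbr[OF us] by blast
  then have k0: "k \<noteq> 0" "k \<noteq> 1"
    using z irrefl by metis+
  have "\<not> k < i"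
  proof
    assume "k < i"
    then show False
      using least[of k] us k k0 z by (auto simp: Q_def)
  qed
  then have "z = vs ! k"
    using k i vs by (simp add: us_def nth_append min_def)
  moreover from this have "k \<noteq> i"
    using z by auto
  ultimately have "i < k" "adj (vs ! (i - 1)) (vs ! k)"
    using z(1) us_nth[of 0] i \<open>\<not> k < i\<close> by auto
  then show ?thesis
    using vs i j \<open>i < j\<close> k step[OF vs(1)] by (intro exI[of _ vs] exI[of _ i] exI[of _ j] exI[of _ k]) (auto simp: path_def)
qed

lemma K4_minor_of_crossing_chords:
  assumes "fin_digraph G"
    and adj: "\<And>u v. adj u v \<longleftrightarrow> (\<exists>d\<in>darts G. dstart G d = u \<and> dend G d = v)"
    and vs: "distinct vs" "\<And>k. Suc k < length vs \<Longrightarrow> adj (vs ! k) (vs ! Suc k)"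
    and ijm: "2 \<le> i" "i < j" "i < m" "j < length vs" "m < length vs"
    and chords: "adj (vs ! 0) (vs ! i)" "adj (vs ! 0) (vs ! j)" "adj (vs ! (i - 1)) (vs ! m)"
  shows "has_complete_minor 4 G"
proof -
  interpret fin_digraph G by fact
  define f where "f k = (if k < i - 1 then 0 else if k < i then 1 else if k < min j m then 2
    else if k \<le> max j m then 3 else 4 :: nat)" for k
  define ix where "ix v = (THE k. k < length vs \<and> vs ! k = v)" for v
  define col where "col v = (if v \<in> set vs then f (ix v) else 4)" for v
  have ix: "ix (vs ! k) = k" if "k < length vs" for k
    unfolding ix_def using that vs(1) by (auto simp: nth_eq_iff_index_eq)
  have col: "col (vs ! k) = f k" if "k < length vs" for k
    using that by (simp add: col_def ix)
  have f_mono: "f k \<le> f l" if "k \<le> l" for k l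
    using that by (auto simp: f_def)
  have step: "(vs ! k, vs ! l) \<in> (class_step G col c)\<^sup>* \<and> (vs ! l, vs ! k) \<in> (class_step G col c)\<^sup>*"
    if "k \<le> l" "l < length vs" "f k = c" "f l = c" for k l c
    using that
  proof (induction l rule: dec_induct)
    case (step l)
    then have "f l = c"
      using f_mono[of k l] f_mono[of l "Suc l"] by auto
    obtain d where d: "d \<in> darts G" "dstart G d = vs ! l" "dend G d = vs ! Suc l"
      using vs(2)[of l] step.prems adj by auto
    have cc: "col (vs ! l) = c" "col (vs ! Suc l) = c"
      using step.prems \<open>f l = c\<close> col[of l] col[of "Suc l"] by auto
    have "(vs ! l, vs ! Suc l) \<in> class_step G col c"
      unfolding class_step_def using d cc by (intro CollectI exI[of _ d]) simp
    moreover have "(vs ! Suc l, vs ! l) \<in> class_step G col c"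
      unfolding class_step_def using d cc by (intro CollectI exI[of _ "rev_dart d"]) simp
    moreover note \<open>f l = c\<close>
    ultimately show ?case
      using step
      by (auto intro: rtrancl_into_rtrancl converse_rtrancl_into_rtrancl)
  qed auto
  have vs_verts: "vs ! k \<in> verts G" if "k < length vs" for k
  proof -
    have "adj (vs ! k) (vs ! Suc k) \<or> (\<exists>l. k = Suc l \<and> adj (vs ! l) (vs ! Suc l))"
      using vs(2)[of k] vs(2)[of "k - 1"] that ijm by (cases k) auto
    then show ?thesis
      using adj by (metis dstart_in_verts rev_dart_in_darts)
  qed
  have "complete_model 4 G col"
    unfolding complete_model_def
  proof (intro conjI allI impI ballI)
    fix c :: nat assume c: "c < 4"
    have "\<exists>k<length vs. f k = c"
      using c ijm
      by (intro exI[of _ "if c = 0 then 0 else if c = 1 then i - 1 else if c = 2 then i else max j m"])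
        (auto simp: f_def)
    then show "\<exists>v\<in>verts G. col v = c"
      using col vs_verts by metis
    fix v w assume vw: "col v = c \<and> col w = c"
    with c have "v \<in> set vs" "w \<in> set vs"
      by (auto simp: col_def split: if_splits)
    then obtain k l where "k < length vs" "l < length vs" "v = vs ! k" "w = vs ! l"
      by (auto simp: in_set_conv_nth)
    with vw show "(v, w) \<in> (class_step G col c)\<^sup>*"
      using step[of k l c] step[of l k c] col by (cases "k \<le> l") auto
  next
    fix c c' :: nat assume c: "c < 4" "c' < 4" "c < c'"
    have link: "\<exists>d\<in>darts G. col (dstart G d) = f k \<and> col (dend G d) = f l"
      if "adj (vs ! k) (vs ! l)" "k < length vs" "l < length vs" for k l
      using that adj col by metis
    have fs: "f 0 = 0" "f (i - 2) = 0" "f (i - 1) = 1" "f i = 2" "f j = 3" "f m = 3"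
        "f (min j m - 1) = 2" "f (min j m) = 3"
      and Sucs: "Suc (i - 2) = i - 1" "Suc (i - 1) = i" "Suc (min j m - 1) = min j m"
      using ijm by (auto simp: f_def)
    have l1: "\<exists>d\<in>darts G. col (dstart G d) = 0 \<and> col (dend G d) = 1"
      using link[of "i - 2" "i - 1"] vs(2)[of "i - 2"] Sucs fs ijm by force
    have l2: "\<exists>d\<in>darts G. col (dstart G d) = 0 \<and> col (dend G d) = 2"
      using link[of "0" "i"] chords fs ijm by force
    have l3: "\<exists>d\<in>darts G. col (dstart G d) = 0 \<and> col (dend G d) = 3"
      using link[of "0" "j"] chords fs ijm by force
    have l4: "\<exists>d\<in>darts G. col (dstart G d) = 1 \<and> col (dend G d) = 2"
      using link[of "i - 1" "i"] vs(2)[of "i - 1"] Sucs fs ijm by force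
    have l5: "\<exists>d\<in>darts G. col (dstart G d) = 1 \<and> col (dend G d) = 3"
      using link[of "i - 1" "m"] chords fs ijm by force
    have l6: "\<exists>d\<in>darts G. col (dstart G d) = 2 \<and> col (dend G d) = 3"
      using link[of "min j m - 1" "min j m"] vs(2)[of "min j m - 1"] Sucs fs ijm by force
    have "(c, c') \<in> {(0, 1), (0, 2), (0, 3), (1, 2), (1, 3), (2, 3)}"
      using c by auto
    then show "\<exists>d\<in>darts G. col (dstart G d) = c \<and> col (dend G d) = c'"
      using l1 l2 l3 l4 l5 l6 by auto
  qed
  then show ?thesis
    using assms(1) by (rule complete_model_minor[rotated])
qed

section \<open>Balanced labellings\<close>

definition ysum :: "('e dart \<Rightarrow> real) \<Rightarrow> 'e dart list \<Rightarrow> real" where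
  "ysum y = csum (\<lambda>d. sgn (y (rev_dart d) - y d)) (\<lambda>d d'. sgn (y d' - y d))"

text \<open>
  Along every cycle \<open>d\<^sub>1, \<dots>, d\<^sub>n\<close>, the cyclic sequence of the labels of
  \<open>d\<^sub>1, rev_dart d\<^sub>1, \<dots>, d\<^sub>n, rev_dart d\<^sub>n\<close> has as many ascents as descents.
\<close>

definition balanced :: "('v, 'e) pre_digraph \<Rightarrow> ('e dart \<Rightarrow> real) \<Rightarrow> bool" where
  "balanced G y \<longleftrightarrow> inj_on y (darts G) \<and> (\<forall>ds. cyc G ds \<longrightarrow> ysum y ds = 0)"

text \<open>Only comparisons of labels enter \<open>ysum\<close>. It is therefore preserved by a map
  of darts that commutes with reversal and keeps the order of the labels that occur.\<close>

lemma ysum_map: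
  assumes "ds \<noteq> []" "\<And>d. g (rev_dart d) = rev_dart (g d)"
    "\<And>a b. a \<in> set ds \<union> rev_dart ` set ds \<Longrightarrow> b \<in> set ds \<union> rev_dart ` set ds \<Longrightarrow>
      sgn (y' (g a) - y' (g b)) = sgn (y a - y b)"
  shows "ysum y' (map g ds) = ysum y ds"
proof -
  have "wsum (\<lambda>d. sgn (y' (rev_dart d) - y' d)) (\<lambda>d d'. sgn (y' d' - y' d)) (map g ds) =
      wsum (\<lambda>d. sgn (y (rev_dart d) - y d)) (\<lambda>d d'. sgn (y d' - y d)) ds"
    using assms(3)
  proof (induction ds rule: induct_list012)
    case (3 d d' ds)
    have "wsum (\<lambda>d. sgn (y' (rev_dart d) - y' d)) (\<lambda>d d'. sgn (y' d' - y' d)) (map g (d' # ds)) =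
      wsum (\<lambda>d. sgn (y (rev_dart d) - y d)) (\<lambda>d d'. sgn (y d' - y d)) (d' # ds)"
      by (rule 3) (auto intro!: 3)
    moreover have "sgn (y' (g (rev_dart d)) - y' (g d)) = sgn (y (rev_dart d) - y d)"
      "sgn (y' (g d') - y' (g (rev_dart d))) = sgn (y d' - y (rev_dart d))"
      by (rule 3; simp)+
    ultimately show ?case
      by (simp add: assms(2))
  qed (simp_all flip: assms(2))
  moreover have "sgn (y' (g (hd ds)) - y' (g (rev_dart (last ds)))) = sgn (y (hd ds) - y (rev_dart (last ds)))"
    using assms(1) by (intro assms(3)) auto
  ultimately show ?thesis
    using assms(1,2) by (simp add: ysum_def csum_def last_map hd_map)
qed

lemma ysum_cong:
  assumes "ds \<noteq> []" "\<And>d. d \<in> set ds \<Longrightarrow> y' d = y d \<and> y' (rev_dart d) = y (rev_dart d)"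
  shows "ysum y' ds = ysum y ds"
proof -
  have "ysum y' (map id ds) = ysum y ds"
    using assms by (intro ysum_map) auto
  then show ?thesis
    by simp
qed

lemma cyc_cong:
  assumes "dstart H = dstart G" "set ds \<subseteq> darts H" "cyc G ds"
  shows "cyc H ds"
proof -
  have "dwalk H u xs v = dwalk G u xs v" for u xs v
    by (induction xs arbitrary: u) (auto simp: assms(1))
  then show ?thesis
    using assms unfolding cyc_def by auto
qed

lemma cyc_rotate_to:
  assumes "cyc G ds" "d \<in> set ds"
  obtains xs where "cyc G (d # xs)" "set (d # xs) = set ds" "ysum y ds = ysum y (d # xs)"
proof -
  obtain ys zs where ds: "ds = ys @ d # zs"
    using assms(2) by (meson split_list)
  show ?thesis
  proof (rule that[of "zs @ ys"])
    show "cyc G (d # zs @ ys)"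
      using assms(1) ds cyc_rotate[of G ys "d # zs"] by simp
    show "ysum y ds = ysum y (d # zs @ ys)"
      using csum_rotate[of _ _ ys "d # zs"] ds by (simp add: ysum_def)
  qed (auto simp: ds)
qed

lemma cyc_start_eq:
  assumes "cyc G ds" "d \<in> set ds" "d' \<in> set ds" "dstart G d = dstart G d'"
  shows "d = d'"
  using assms by (auto simp: cyc_def distinct_map inj_on_def)

lemma cyc_rev_notin:
  assumes "cyc G ds" "d \<in> set ds"
  shows "rev_dart d \<notin> set ds"
proof
  assume "rev_dart d \<in> set ds"
  then have "d = rev_dart d"
    using assms unfolding cyc_def distinct_map inj_on_def by (metis rev_dart_simps(2))
  then show False
    by simp
qed

lemma cyc_Cons_next:
  assumes "cyc G (d # xs)" "xs \<noteq> []"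
  shows "dstart G (hd xs) = dend G d"
  using assms by (cases xs) (auto simp: cyc_def)

lemma cyc_last:
  assumes "cyc G ds"
  shows "dend G (last ds) = dstart G (hd ds)"
  using assms dwalk_end unfolding cyc_def by metis

lemma cyc_next:
  assumes "cyc G ds" "d \<in> set ds"
  shows "\<exists>d'\<in>set ds. dstart G d' = dend G d"
proof -
  obtain xs where xs: "cyc G (d # xs)" "set (d # xs) = set ds"
    by (rule cyc_rotate_to[OF assms, where y = "\<lambda>_. 0"]) (rule that)
  show ?thesis
  proof (cases "xs = []")
    case True
    then show ?thesis
      using cyc_last[OF xs(1)] assms(2) by (intro bexI[of _ d]) simp_all
  next
    case False
    then show ?thesis
      using cyc_Cons_next[OF xs(1) False] False unfolding xs(2)[symmetric] by (intro bexI[of _ "hd xs"]) simp_all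
  qed
qed

lemma cyc_prev:
  assumes "cyc G ds" "d \<in> set ds"
  shows "\<exists>d'\<in>set ds. dend G d' = dstart G d"
proof -
  obtain xs where xs: "cyc G (d # xs)" "set (d # xs) = set ds"
    by (rule cyc_rotate_to[OF assms, where y = "\<lambda>_. 0"]) (rule that)
  show ?thesis
    using cyc_last[OF xs(1)] unfolding xs(2)[symmetric] by (intro bexI[of _ "last (d # xs)"]) simp_all
qed

section \<open>Reductions at loops, pendant edges, parallel edges and vertices of degree two\<close>

lemma darts_del_arc: "darts (pre_digraph.del_arc G e) = {d \<in> darts G. fst d \<noteq> e}"
  by (auto simp: darts_def pre_digraph.del_arc_def)

lemma dstart_del_arc: "dstart (pre_digraph.del_arc G e) = dstart G"
  by (auto simp: dstart_def pre_digraph.del_arc_def fun_eq_iff)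

lemma cyc_del_arc: "cyc G ds \<Longrightarrow> e \<notin> fst ` set ds \<Longrightarrow> cyc (pre_digraph.del_arc G e) ds"
  by (rule cyc_cong[of _ G]) (auto simp: dstart_del_arc darts_del_arc cyc_def)

text \<open>Serves the reductions in which cycles through \<open>e\<close> balance for any labels:
  loops, and edges that lie on no cycle. The two new labels only have to differ from the old ones
  and from each other, so they are put above all of them.\<close>

lemma balanced_extend:
  assumes fin: "fin_digraph G" and H: "balanced (pre_digraph.del_arc G e) y"
    and cyc: "\<And>ds y. cyc G ds \<Longrightarrow> e \<in> fst ` set ds \<Longrightarrow> ysum y ds = 0"
  shows "\<exists>y. balanced G y"
proof -
  interpret fin_digraph G by fact
  have "finite (y ` darts G)"
    by (simp add: darts_def)
  then have "y d < Max (y ` darts G) + 1" if "d \<in> darts G" for d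
  proof -
    have "y d \<le> Max (y ` darts G)"
      using that \<open>finite (y ` darts G)\<close> by (intro Max_ge) auto
    then show ?thesis
      by linarith
  qed
  then obtain M where M: "\<And>d. d \<in> darts G \<Longrightarrow> y d < M"
    by blast
  define y' where "y' d = (if fst d = e then if snd d then M + 1 else M + 2 else y d)" for d
  have "inj_on y' (darts G)"
  proof (rule inj_onI)
    fix d d' assume "d \<in> darts G" "d' \<in> darts G" "y' d = y' d'"
    moreover have "d = d'" if "fst d \<noteq> e" "fst d' \<noteq> e" "y d = y d'" "d \<in> darts G" "d' \<in> darts G"
      using H that by (intro inj_onD[of y "darts (pre_digraph.del_arc G e)"]) (auto simp: balanced_def darts_del_arc)
    ultimately show "d = d'"
      using M[of d] M[of d']
      by (cases "fst d = e"; cases "fst d' = e") (auto simp: y'_def prod_eq_iff split: if_splits)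
  qed
  moreover have "ysum y' ds = 0" if ds: "cyc G ds" for ds
  proof (cases "e \<in> fst ` set ds")
    case False
    then have "ysum y' ds = ysum y ds"
      using ds by (intro ysum_cong) (auto simp: y'_def cyc_def)
    then show ?thesis
      using cyc_del_arc[OF ds False] H by (simp add: balanced_def)
  qed (use ds cyc in auto)
  ultimately show ?thesis
    by (auto simp: balanced_def)
qed

text \<open>A further dart would start at the vertex of the loop again, so the loop is the whole
  cycle. The step between its two labels is taken once in each direction.\<close>

lemma ysum_loop:
  assumes "cyc G ds" "d \<in> set ds" "dstart G d = dend G d"
  shows "ysum y ds = 0"
proof -
  obtain xs where xs: "cyc G (d # xs)" "ysum y ds = ysum y (d # xs)"
    by (rule cyc_rotate_to[OF assms(1,2), where y = y]) (rule that)
  have "xs = []"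
  proof (rule ccontr)
    assume ne: "xs \<noteq> []"
    then have "d = hd xs"
      using cyc_Cons_next[OF xs(1) ne] assms(3) by (intro cyc_start_eq[OF xs(1)]) auto
    then show False
      using xs(1) ne by (auto simp: cyc_def)
  qed
  then show ?thesis
    using xs(2) by (simp add: ysum_def csum_def sgn_if)
qed

text \<open>A cycle through the edge would have to enter or leave its end of degree one, where the
  only continuation is the same edge backwards; a cycle never does that.\<close>

lemma pendant_notin_cyc:
  assumes "cyc G ds" and d: "\<And>d'. d' \<in> darts G \<Longrightarrow> dstart G d' = dstart G d \<Longrightarrow> d' = d"
  shows "fst d \<notin> fst ` set ds"
proof
  assume "fst d \<in> fst ` set ds"
  then obtain d' where d': "d' \<in> set ds" "d' = d \<or> d' = rev_dart d"
    by (metis fst_eq_dart imageE rev_dart_simps(1))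
  have sub: "set ds \<subseteq> darts G"
    using assms(1) by (simp add: cyc_def)
  from d'(2) show False
  proof
    assume "d' = d"
    then obtain d'' where "d'' \<in> set ds" "dend G d'' = dstart G d"
      using cyc_prev[OF assms(1) d'(1)] by auto
    then have "rev_dart d'' = d"
      using sub by (intro d) auto
    then show False
      using cyc_rev_notin[OF assms(1), of d''] \<open>d'' \<in> set ds\<close> d'(1) \<open>d' = d\<close> by auto
  next
    assume d'_eq: "d' = rev_dart d"
    then obtain d'' where "d'' \<in> set ds" "dstart G d'' = dstart G d"
      using cyc_next[OF assms(1) d'(1)] by auto
    then have "d'' = d"
      using sub by (intro d) auto
    then show False
      using cyc_rev_notin[OF assms(1), of d''] \<open>d'' \<in> set ds\<close> d'(1) d'_eq by auto
  qed
qed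

text \<open>The factor 3 is the slack of the reductions below: two labels moved by at most \<delta>
  each keep their order, and a label moved by 2\<delta> still misses all the others.\<close>

lemma finite_separated:
  fixes S :: "real set"
  assumes "finite S"
  shows "\<exists>\<delta>>0. \<forall>x\<in>S. \<forall>z\<in>S. x \<noteq> z \<longrightarrow> 3 * \<delta> < \<bar>x - z\<bar>"
proof -
  \<comment> \<open>The extra element 1 makes \<open>Min D\<close> exist and be positive when
    \<open>S\<close> has fewer than two points.\<close>
  define D where "D = insert 1 ((\<lambda>(x, z). \<bar>x - z\<bar>) ` {(x, z) \<in> S \<times> S. x \<noteq> z})"
  have fin: "finite D"
  proof -
    have "finite {(x, z) \<in> S \<times> S. x \<noteq> z}"
      by (rule finite_subset[of _ "S \<times> S"]) (use assms in auto)
    then show ?thesis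
      by (simp add: D_def)
  qed
  have pos: "0 < Min D"
    using fin by (subst Min_gr_iff) (auto simp: D_def)
  have "Min D \<le> \<bar>x - z\<bar>" if "x \<in> S" "z \<in> S" "x \<noteq> z" for x z
  proof (rule Min_le[OF fin])
    show "\<bar>x - z\<bar> \<in> D"
      unfolding D_def by (rule insertI2, rule image_eqI[of _ _ "(x, z)"]) (simp_all add: that)
  qed
  then have "3 * (Min D / 4) < \<bar>x - z\<bar>" if "x \<in> S" "z \<in> S" "x \<noteq> z" for x z
    using that pos by fastforce
  then show ?thesis
    using pos by (intro exI[of _ "Min D / 4"]) auto
qed

lemma sgn_diff_near:
  fixes x z x' z' \<delta> :: real
  assumes "3 * \<delta> < \<bar>x - z\<bar>" "\<bar>x' - x\<bar> \<le> \<delta>" "\<bar>z' - z\<bar> \<le> \<delta>"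
  shows "sgn (x' - z') = sgn (x - z)"
  using assms by (auto simp: sgn_if abs_if split: if_splits)

text \<open>The new edge copies the labels of the parallel one, shifted up by \<delta> at both ends.
  A cycle through the new edge only then compares labels exactly like its copy through
  \<open>D\<close>. A cycle through both edges is the digon, whose four signs cancel.\<close>

lemma balanced_parallel:
  assumes fin: "fin_digraph G"
    and D: "D \<in> darts G" "D' \<in> darts G" "fst D \<noteq> fst D'" "dstart G D = dstart G D'" "dend G D = dend G D'"
      "dstart G D \<noteq> dend G D"
    and H: "balanced (pre_digraph.del_arc G (fst D')) y"
  shows "\<exists>y. balanced G y"
proof -
  interpret fin_digraph G by fact
  define H where "H = pre_digraph.del_arc G (fst D')"
  have dH: "darts H = {d \<in> darts G. fst d \<noteq> fst D'}" "dstart H = dstart G"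
    by (simp_all add: H_def darts_del_arc dstart_del_arc)
  have "finite (y ` darts G)"
    by (simp add: darts_def)
  then obtain \<delta> where \<delta>: "\<delta> > 0"
    "\<And>d d'. d \<in> darts G \<Longrightarrow> d' \<in> darts G \<Longrightarrow> y d \<noteq> y d' \<Longrightarrow> 3 * \<delta> < \<bar>y d - y d'\<bar>"
    using finite_separated by (metis image_eqI)
  have y_sep: "3 * \<delta> < \<bar>y d - y d'\<bar>" if "d \<in> darts H" "d' \<in> darts H" "d \<noteq> d'" for d d'
  proof (rule \<delta>(2))
    show "y d \<noteq> y d'"
      using H that by (auto simp: balanced_def inj_on_def H_def)
  qed (use that dH in auto)
  define g where "g d = (if d = D' then D else if d = rev_dart D' then rev_dart D else d)" for d
  define y' where "y' d = (if fst d = fst D' then y (g d) + \<delta> else y d)" for d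
  have g_rev: "g (rev_dart d) = rev_dart (g d)" for d
    by (auto simp: g_def)
  have g_id: "g d = d" if "fst d \<noteq> fst D'" for d
    using that by (auto simp: g_def)
  have g_darts: "g d \<in> darts H" if "d \<in> darts G" for d
    using that D by (auto simp: g_def dH fst_eq_dart)
  have g_start: "dstart G (g d) = dstart G d" for d
    using D by (auto simp: g_def)
  have y'_near: "\<bar>y' d - y (g d)\<bar> \<le> \<delta>" for d
    using \<delta>(1) g_id by (auto simp: y'_def)
  have sgn_y': "sgn (y' a - y' b) = sgn (y (g a) - y (g b))"
    if "a \<in> darts G" "b \<in> darts G" "g a \<noteq> g b" for a b
    by (rule sgn_diff_near[OF y_sep[OF g_darts[OF that(1)] g_darts[OF that(2)] that(3)]]) (rule y'_near)+
  have g_eq: "a = b \<or> fst a = fst D' \<and> b = g a \<or> fst b = fst D' \<and> a = g b" if "g a = g b" for a b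
    using that by (auto simp: g_def fst_eq_dart split: if_splits)
  have "inj_on y' (darts G)"
  proof (rule inj_onI)
    fix a b assume ab: "a \<in> darts G" "b \<in> darts G" "y' a = y' b"
    show "a = b"
    proof (cases "g a = g b")
      case True
      with g_eq[OF this] ab \<delta>(1) show ?thesis
        using D(3) by (auto simp: y'_def g_def split: if_splits)
    next
      case False
      with sgn_y'[OF ab(1,2)] y_sep[OF g_darts g_darts, of a b] ab \<delta>(1) show ?thesis
        by (auto simp: sgn_zero_iff)
    qed
  qed
  moreover have "ysum y' ds = 0" if ds: "cyc G ds" for ds
  proof (cases "fst D' \<in> fst ` set ds")
    case False
    then have "fst d \<noteq> fst D'" if "d \<in> set ds" for d
      using that by (metis imageI)
    then have "ysum y' ds = ysum y ds"
      using ds by (intro ysum_cong) (simp_all add: y'_def cyc_def)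
    then show ?thesis
      using cyc_del_arc[OF ds False] H by (simp add: balanced_def)
  next
    case D'_in: True
    show ?thesis
    proof (cases "fst D \<in> fst ` set ds")
      case False
      have sub: "set ds \<subseteq> darts G" and ne: "ds \<noteq> []"
        using ds by (auto simp: cyc_def)
      have aux: "fst x \<noteq> fst D" "x \<in> darts G" if x: "x \<in> set ds \<union> rev_dart ` set ds" for x
      proof -
        obtain x' where x': "x' \<in> set ds" "x = x' \<or> x = rev_dart x'"
          using x by blast
        then show "x \<in> darts G"
          using sub by auto
        have "fst x' \<noteq> fst D"
          using False x'(1) by (metis imageI)
        then show "fst x \<noteq> fst D"
          using x'(2) by auto
      qed
      have "ysum y (map g ds) = ysum y' ds"
      proof (rule ysum_map[where g = g, OF ne g_rev])
        fix a b assume ab: "a \<in> set ds \<union> rev_dart ` set ds" "b \<in> set ds \<union> rev_dart ` set ds"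
        then have not_D: "fst a \<noteq> fst D" "fst b \<noteq> fst D" and G: "a \<in> darts G" "b \<in> darts G"
          using aux by simp_all
        show "sgn (y (g a) - y (g b)) = sgn (y' a - y' b)"
        proof (cases "g a = g b")
          case True
          then have "a = b"
            using g_eq[OF True] not_D by (auto simp: g_def split: if_splits)
          then show ?thesis
            by simp
        qed (use sgn_y' G in simp)
      qed
      moreover have "cyc H (map g ds)"
      proof -
        have walk: "dwalk H u (map g xs) v" if "dwalk G u xs v" for u xs v
          using that by (induction xs arbitrary: u) (auto simp: dH g_start simp flip: g_rev)
        have "inj_on (fst \<circ> g) (set ds)"
        proof (rule inj_onI)
          fix a b assume ab: "a \<in> set ds" "b \<in> set ds" "(fst \<circ> g) a = (fst \<circ> g) b"
          then have "fst a = fst b"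
            using aux(1)[of a] aux(1)[of b] by (auto simp: g_def split: if_splits)
          then show "a = b"
            using ab ds by (auto simp: cyc_def distinct_map inj_on_def)
        qed
        then have "distinct (map fst (map g ds))"
          using ds by (simp add: distinct_map cyc_def)
        moreover have "dstart G \<circ> g = dstart G"
          by (simp add: fun_eq_iff g_start)
        ultimately show ?thesis
          using ds sub g_darts walk by (auto simp: cyc_def hd_map dH g_start)
      qed
      ultimately show ?thesis
        using H by (simp add: balanced_def H_def)
    next
      case True
      then obtain d where d1: "d \<in> set ds" "fst d = fst D"
        by auto
      obtain d' where d2: "d' \<in> set ds" "fst d' = fst D'"
        using D'_in by auto
      note d = d1(1) d1(2)[unfolded fst_eq_dart] d2(1) d2(2)[unfolded fst_eq_dart]
      have ne: "d \<noteq> d'"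
        using d D(3) by (auto simp: fst_eq_dart)
      \<comment> \<open>Two darts of a cycle never have the same start, so the parallel edges are
        traversed in opposite directions.\<close>
      have eq: "d = D \<and> d' = rev_dart D' \<or> d = rev_dart D \<and> d' = D'"
        using d(2,4) ne cyc_start_eq[OF ds d(1,3)] D by auto
      then have ends: "dstart G d' = dend G d" "dend G d' = dstart G d" "dstart G d \<noteq> dend G d"
        using D by auto
      obtain xs where xs: "cyc G (d # xs)" "set (d # xs) = set ds" "ysum y' ds = ysum y' (d # xs)"
        by (rule cyc_rotate_to[OF ds d(1)])
      have "xs \<noteq> []"
        using cyc_last[OF xs(1)] ends by auto
      then have hd_in: "hd xs \<in> set (d # xs)" and hd_start: "dstart G (hd xs) = dend G d"
        using cyc_Cons_next[OF xs(1)] by simp_all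
      have "d' \<in> set (d # xs)"
        unfolding xs(2) by (rule d(3))
      then have "hd xs = d'"
        by (rule cyc_start_eq[OF xs(1) hd_in]) (simp add: hd_start ends)
      then obtain xs' where xs': "xs = d' # xs'"
        using \<open>xs \<noteq> []\<close> by (cases xs) auto
      have "xs' = []"
      proof (rule ccontr)
        assume "xs' \<noteq> []"
        then have "dstart G (hd xs') = dend G d'"
          using xs(1) xs' by (cases xs') (auto simp: cyc_def)
        then have "hd xs' = d"
          using ends \<open>xs' \<noteq> []\<close> xs' by (intro cyc_start_eq[OF xs(1)]) auto
        then show False
          using xs(1) xs' \<open>xs' \<noteq> []\<close> by (auto simp: cyc_def)
      qed
      then have "ysum y' ds = sgn (y' (rev_dart d) - y' d) + sgn (y' d' - y' (rev_dart d)) +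
          sgn (y' (rev_dart d') - y' d') + sgn (y' d - y' (rev_dart d'))"
        using xs(3) xs' by (simp add: ysum_def csum_def)
      moreover have "y' D' = y' D + \<delta>" "y' (rev_dart D') = y' (rev_dart D) + \<delta>"
        using D(3) by (auto simp: y'_def g_def)
      \<comment> \<open>The shift \<delta> is gained at one corner of the digon and lost at the
        other, and the two edge terms are opposite.\<close>
      moreover have "sgn (b - a) + sgn (b + \<delta> - b) + sgn (a + \<delta> - (b + \<delta>)) + sgn (a - (a + \<delta>)) = 0" for a b
        using \<delta>(1) by (simp add: sgn_if)
      ultimately show ?thesis
        using eq by (elim disjE conjE) (simp_all only: rev_dart_simps(1))
    qed
  qed
  ultimately show ?thesis
    by (auto simp: balanced_def)
qed


text \<open>The vertex \<open>w\<close> has degree two; \<open>D\<close> enters it and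
  \<open>E\<close> leaves it. In the contraction \<open>D\<close> has the labels \<open>p\<close>
  and \<open>q\<close>; let \<open>s\<close> be the sign of \<open>q - p\<close>. Passing along
  \<open>D\<close> and \<open>E\<close>, the new labels are p, p + 2s\<delta>, p + s\<delta>, q,
  with signs s, -s, s, whose sum is the single sign \<open>s\<close> of the contracted
  graph.\<close>

lemma balanced_series:
  assumes fin: "fin_digraph G"
    and D: "D \<in> darts G" "E \<in> darts G" "dend G D = w" "dstart G E = w" "fst D \<noteq> fst E"
      "dstart G D \<noteq> w" "dend G E \<noteq> w" "dstart G D \<noteq> dend G E"
    and w: "\<And>d. d \<in> darts G \<Longrightarrow> dstart G d = w \<Longrightarrow> d = rev_dart D \<or> d = E"
    and H: "balanced (contract_arc G (fst E)) y"
  shows "\<exists>y. balanced G y"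
proof -
  interpret fin_digraph G by fact
  define H where "H = contract_arc G (fst E)"
  define m where "m = merge_head G (fst E)"
  have dH: "darts H = {d \<in> darts G. fst d \<noteq> fst E}" "dstart H d = m (dstart G d)" for d
    by (simp_all add: H_def m_def darts_contract_arc)
  have m_eq: "m u = m v \<longleftrightarrow> u = v \<or> {u, v} = {w, dend G E}" for u v
    using D(4) by (auto simp: m_def merge_head_def dstart_def split: if_splits)
  have "finite (y ` darts G)"
    by (simp add: darts_def)
  then obtain \<delta> where \<delta>: "\<delta> > 0"
    "\<And>d d'. d \<in> darts G \<Longrightarrow> d' \<in> darts G \<Longrightarrow> y d \<noteq> y d' \<Longrightarrow> 3 * \<delta> < \<bar>y d - y d'\<bar>"
    using finite_separated by (metis image_eqI)
  have y_sep: "3 * \<delta> < \<bar>y d - y d'\<bar>" if "d \<in> darts H" "d' \<in> darts H" "d \<noteq> d'" for d d'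
  proof (rule \<delta>(2))
    show "y d \<noteq> y d'"
      using H that by (auto simp: balanced_def inj_on_def H_def)
  qed (use that dH in auto)
  define p where "p = y D"
  define q where "q = y (rev_dart D)"
  define s where "s = sgn (q - p)"
  have DH: "D \<in> darts H" "rev_dart D \<in> darts H"
    using D by (auto simp: dH)
  have pq: "3 * \<delta> < \<bar>q - p\<bar>"
    using y_sep[OF DH(2,1)] by (simp add: p_def q_def)
  have s: "s = 1 \<or> s = -1" "sgn (q - p) = s" "sgn (p - q) = - s"
    using pq \<delta>(1) by (auto simp: s_def sgn_if)
  define y' where "y' d = (if d = rev_dart D then p + 2 * s * \<delta> else if d = E then p + s * \<delta>
    else if d = rev_dart E then q else y d)" for d
  have DE: "D \<noteq> E" "D \<noteq> rev_dart E" "rev_dart D \<noteq> E" "rev_dart D \<noteq> rev_dart E"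
    using D(5) by (auto simp: fst_eq_dart)
  have y': "y' D = p" "y' (rev_dart D) = p + 2 * s * \<delta>" "y' E = p + s * \<delta>" "y' (rev_dart E) = q"
    "\<And>d. fst d \<noteq> fst D \<Longrightarrow> fst d \<noteq> fst E \<Longrightarrow> y' d = y d"
    using DE by (auto simp: y'_def p_def)
  have far: "3 * \<delta> < \<bar>y' d - p\<bar>" "3 * \<delta> < \<bar>y' d - q\<bar>"
    if "d \<in> darts G" "fst d \<noteq> fst D" "fst d \<noteq> fst E" for d
  proof -
    have "d \<in> darts H" "d \<noteq> D" "d \<noteq> rev_dart D"
      using that by (auto simp: dH)
    then show "3 * \<delta> < \<bar>y' d - p\<bar>" "3 * \<delta> < \<bar>y' d - q\<bar>"
      using y_sep[of d D] y_sep[of d "rev_dart D"] DH y'(5)[OF that(2,3)] unfolding p_def q_def by simp_all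
  qed
  have "inj_on y' (darts G)"
  proof (rule inj_onI)
    have *: "d = d'" if dd: "d \<in> darts G" "d' \<in> darts G" "y' d = y' d'" "fst d \<noteq> fst D" "fst d \<noteq> fst E" for d d'
    proof (cases "fst d' = fst D \<or> fst d' = fst E")
      case True
      then have "d' \<in> {D, rev_dart D, E, rev_dart E}"
        by (auto simp: fst_eq_dart)
      then have "y' d' \<in> {p, p + 2 * s * \<delta>, p + s * \<delta>, q}"
        using y' by auto
      then show ?thesis
        using far[OF dd(1,4,5)] dd(3) s(1) \<delta>(1) by (auto simp: abs_if split: if_splits)
    next
      case False
      then have "y d = y d'" "d \<in> darts H" "d' \<in> darts H"
        using dd y'(5) by (simp_all add: dH)
      then show ?thesis
        using y_sep[of d d'] \<delta>(1) by auto
    qed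
    fix d d' assume dd: "d \<in> darts G" "d' \<in> darts G" "y' d = y' d'"
    show "d = d'"
    proof (cases "(fst d = fst D \<or> fst d = fst E) \<and> (fst d' = fst D \<or> fst d' = fst E)")
      case True
      then have "d \<in> {D, rev_dart D, E, rev_dart E}" "d' \<in> {D, rev_dart D, E, rev_dart E}"
        by (auto simp: fst_eq_dart)
      then show ?thesis
        using dd(3) y'(1-4) s pq \<delta>(1) by (auto simp: abs_if split: if_splits)
    next
      case False
      then show ?thesis
        using *[of d d'] *[of d' d] dd by metis
    qed
  qed
  moreover have "ysum y' ds = 0" if ds: "cyc G ds" for ds
  proof -
    have sub: "set ds \<subseteq> darts G" and ne: "ds \<noteq> []"
      using ds by (auto simp: cyc_def)
    have walk: "dwalk H (m u) xs (m v)" if "dwalk G u xs v" for u xs v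
      using that by (induction xs arbitrary: u) (auto simp: dH)
    \<comment> \<open>Merging identifies only \<open>w\<close> with the far end of \<open>E\<close>,
      so it is injective on starts that avoid \<open>w\<close>.\<close>
    have m_inj: "distinct (map (dstart H) xs)" if "distinct (map (dstart G) xs)" "w \<notin> dstart G ` set xs" for xs
    proof -
      have "inj_on m (dstart G ` set xs)"
        using that(2) by (auto simp: inj_on_def m_eq doubleton_eq_iff)
      moreover have "dstart H = m \<circ> dstart G"
        by (auto simp: dH)
      ultimately show ?thesis
        using that(1) by (simp add: distinct_map comp_inj_on)
    qed
    show ?thesis
    proof (cases "w \<in> dstart G ` set ds")
      case False
      have avoid: "fst d \<noteq> fst D \<and> fst d \<noteq> fst E" if d: "d \<in> set ds" for d
      proof -
        obtain d' where "d' \<in> set ds" "dstart G d' = dend G d"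
          using cyc_next[OF ds d] by blast
        then have "dstart G d \<noteq> w" "dend G d \<noteq> w"
          using False d by (metis imageI)+
        then show ?thesis
          using D(3,4) by (auto simp: fst_eq_dart)
      qed
      then have "ysum y' ds = ysum y ds"
        by (intro ysum_cong[OF ne]) (auto simp: y'(5))
      moreover have "set ds \<subseteq> darts H"
        using avoid sub by (auto simp: dH)
      then have "cyc H ds"
        using ds m_inj[OF _ False] walk by (auto simp: cyc_def dH)
      ultimately show ?thesis
        using H by (simp add: balanced_def H_def)
    next
      case True
      then obtain d where d: "d \<in> set ds" "dstart G d = w"
        by auto
      obtain xs where xs: "cyc G (d # xs)" "set (d # xs) = set ds" "ysum y' ds = ysum y' (d # xs)"
        by (rule cyc_rotate_to[OF ds d(1)])
      define d' where "d' = last (d # xs)"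
      have d'_in: "d' \<in> set (d # xs)"
        unfolding d'_def by (rule last_in_set) simp
      have d'_end: "dend G d' = w"
        using cyc_last[OF xs(1)] d(2) by (simp add: d'_def)
      have in_G: "d \<in> darts G" "d' \<in> darts G"
        using sub d(1) d'_in xs(2) by auto
      have d_cases: "d = rev_dart D \<or> d = E"
        using w in_G d by auto
      have "rev_dart d' = rev_dart D \<or> rev_dart d' = E"
        using w[of "rev_dart d'"] in_G d'_end by auto
      then have d'_cases: "d' = D \<or> d' = rev_dart E"
        by (metis rev_dart_simps(1))
      have not_rev: "d' \<noteq> rev_dart d"
        using cyc_rev_notin[OF xs(1), of d] d'_in by auto
      have cs: "d = E \<and> d' = D \<or> d = rev_dart D \<and> d' = rev_dart E"
        using d_cases d'_cases not_rev by auto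
      then have "d \<noteq> d'"
        using DE by auto
      then obtain zs where zs: "xs = zs @ [d']"
        unfolding d'_def by (cases xs rule: rev_cases) auto
      have cyc1: "cyc G (d' # d # zs)"
        using cyc_rotate[of G "d # zs" "[d']"] xs(1) zs by simp
      have sum1: "ysum y' ds = ysum y' (d' # d # zs)"
        using csum_rotate[of _ _ "d # zs" "[d']"] xs(3) zs by (simp add: ysum_def)
      have zs_avoid: "fst z \<noteq> fst D \<and> fst z \<noteq> fst E" "z \<in> darts G" "dstart G z \<noteq> w" if "z \<in> set zs" for z
      proof -
        have z: "z \<in> darts G" "fst z \<noteq> fst d" "fst z \<noteq> fst d'" "dstart G z \<noteq> dstart G d"
          using that cyc1 unfolding cyc_def by (auto simp: image_iff)
        then show "fst z \<noteq> fst D \<and> fst z \<noteq> fst E" "z \<in> darts G" "dstart G z \<noteq> w"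
          using cs d(2) by auto
      qed
      define X where "X = (if d = E then D else rev_dart D)"
      have start_X: "m (dstart G X) = m (dstart G d')" "m (dend G X) = m (dend G d)"
        using cs D DE by (auto simp: X_def m_eq)
      \<comment> \<open>The far ends of \<open>D\<close> and \<open>E\<close> differ, so these two
        edges alone do not form a cycle.\<close>
      have "zs \<noteq> []"
      proof
        assume "zs = []"
        then have "dend G d = dstart G d'"
          using cyc_last[OF cyc1] by simp
        then show False
          using cs D by auto
      qed
      then obtain z zs' where z: "zs = z # zs'"
        by (cases zs) auto
      have "cyc H (X # zs)"
      proof -
        have "dwalk G (dend G d) zs (dstart G d')"
          using cyc1 by (simp add: cyc_def)
        then have "dwalk H (m (dend G X)) zs (m (dstart G X))"
          using walk start_X by simp
        moreover have "distinct (map (dstart H) (X # zs))"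
        proof -
          have "dstart G d' \<noteq> w"
            using cs D by auto
          then have "distinct (map (dstart H) (d' # zs))"
            using cyc1 zs_avoid(3) by (intro m_inj) (auto simp: cyc_def)
          then show ?thesis
            using start_X by (simp add: dH)
        qed
        moreover have "distinct (map fst (X # zs))" "set (X # zs) \<subseteq> darts H"
        proof -
          have "fst X = fst D" "X \<in> darts H"
            using DH by (auto simp: X_def)
          moreover have "fst D \<notin> fst ` set zs"
            using zs_avoid(1) by force
          moreover have "set zs \<subseteq> darts H"
            using zs_avoid(1,2) unfolding dH by blast
          ultimately show "distinct (map fst (X # zs))" "set (X # zs) \<subseteq> darts H"
            using cyc1 by (simp_all add: cyc_def)
        qed
        ultimately show ?thesis
          by (simp add: cyc_def dH)
      qed
      then have "ysum y (X # zs) = 0"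
        using H by (simp add: balanced_def H_def)
      moreover have "ysum y' (d' # d # zs) = ysum y (X # zs)"
      proof -
        have last_in: "last (z # zs') \<in> set zs" "z \<in> set zs"
          unfolding z by (rule last_in_set) simp_all
        have W: "wsum (\<lambda>d. sgn (y' (rev_dart d) - y' d)) (\<lambda>d d'. sgn (y' d' - y' d)) (z # zs') =
            wsum (\<lambda>d. sgn (y (rev_dart d) - y d)) (\<lambda>d d'. sgn (y d' - y d)) (z # zs')"
          using zs_avoid(1) z y'(5) by (intro wsum_cong) auto
        have Y: "y' z = y z" "y' (rev_dart (last (z # zs'))) = y (rev_dart (last (z # zs')))"
          using zs_avoid(1)[OF last_in(1)] zs_avoid(1)[OF last_in(2)] y'(5) by auto
        have sg: "sgn (q - (p + s * \<delta>)) = s" "sgn ((p + s * \<delta>) - q) = - s" "sgn (s * \<delta>) = s"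
            "sgn (2 * s * \<delta>) = s" "sgn (\<delta> * s) = s" "sgn (2 * (s * \<delta>)) = s" "sgn (\<delta> * (s * 2)) = s"
          using pq s \<delta>(1) by (auto simp: sgn_if abs_if split: if_splits)
        from cs show ?thesis
        proof
          assume c: "d = E \<and> d' = D"
          then have "X = D"
            by (simp add: X_def)
          then show ?thesis
            using c W Y y'(1-4) s sg by (simp add: ysum_def csum_def z p_def[symmetric] q_def[symmetric])
        next
          assume c: "d = rev_dart D \<and> d' = rev_dart E"
          then have "X = rev_dart D"
            using DE by (auto simp: X_def)
          then show ?thesis
            using c W Y y'(1-4) s sg by (simp add: ysum_def csum_def z p_def[symmetric] q_def[symmetric] sgn_minus)
        qed
      qed
      ultimately show ?thesis
        using sum1 by simp
    qed
  qed
  ultimately show ?thesis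
    by (auto simp: balanced_def)
qed

lemma has_complete_minor_mono:
  "has_complete_minor n H \<Longrightarrow> is_minor_of H G \<Longrightarrow> has_complete_minor n G"
  unfolding has_complete_minor_def using is_minor_of_trans by blast

text \<open>In a minimal counterexample the reductions exclude loops, parallel edges and vertices of
  degree one or two. Different darts at a vertex then lead to different neighbours, so every vertex
  with a neighbour has at least three, and crossing chords yield the forbidden minor.\<close>

lemma balanced_exists:
  fixes G :: "('v, 'e) pre_digraph"
  assumes "fin_digraph G" "\<not> has_complete_minor 4 G"
  shows "\<exists>y. balanced G y"
  using assms
proof (induction "card (arcs G)" arbitrary: G rule: less_induct)
  case less
  interpret fin_digraph G by fact
  have del: "\<exists>y. balanced (pre_digraph.del_arc G e) y" if "e \<in> arcs G" for e
  proof (rule less.hyps)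
    have "is_minor_of (pre_digraph.del_arc G e) G"
      using that by (intro is_minor_of.intros)
    then show "\<not> has_complete_minor 4 (pre_digraph.del_arc G e)"
      using less.prems(2) has_complete_minor_mono by blast
    show "fin_digraph (pre_digraph.del_arc G e)"
      by unfold_locales auto
    show "card (arcs (pre_digraph.del_arc G e)) < card (arcs G)"
      using card_Diff1_less[OF finite_arcs that] by simp
  qed
  have con: "\<exists>y. balanced (contract_arc G e) y" if "e \<in> arcs G" for e
  proof (rule less.hyps)
    have "is_minor_of (contract_arc G e) G"
      using that by (intro is_minor_of.intros)
    then show "\<not> has_complete_minor 4 (contract_arc G e)"
      using less.prems(2) has_complete_minor_mono by blast
    show "fin_digraph (contract_arc G e)"
      using less.prems(1) by (rule fin_digraph_contract_arc)
    show "card (arcs (contract_arc G e)) < card (arcs G)"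
      using card_Diff1_less[OF finite_arcs that] by simp
  qed
  have arc: "fst d \<in> arcs G" if "d \<in> darts G" for d
    using that by (auto simp: darts_def)
  define adj where "adj u v \<longleftrightarrow> (\<exists>d\<in>darts G. dstart G d = u \<and> dend G d = v)" for u v
  show ?case
  proof (rule ccontr)
    assume contra: "\<nexists>y. balanced G y"
    have no_loop: "dstart G d \<noteq> dend G d" if d: "d \<in> darts G" for d
    proof
      assume loop: "dstart G d = dend G d"
      obtain y where y: "balanced (pre_digraph.del_arc G (fst d)) y"
        using del[OF arc[OF d]] by blast
      have "\<exists>y. balanced G y"
      proof (rule balanced_extend[OF less.prems(1) y])
        fix ds and z :: "'e dart \<Rightarrow> real" assume ds: "cyc G ds" "fst d \<in> fst ` set ds"
        then obtain d' where d': "d' \<in> set ds" "fst d' = fst d"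
          by auto
        then have "dstart G d' = dend G d'"
          using loop by (auto simp: fst_eq_dart)
        then show "ysum z ds = 0"
          using ysum_loop ds d' by blast
      qed
      then show False
        using contra by blast
    qed
    have no_parallel: "d = d'"
      if d: "d \<in> darts G" "d' \<in> darts G" "dstart G d = dstart G d'" "dend G d = dend G d'" for d d'
    proof (rule ccontr)
      assume "d \<noteq> d'"
      then have "fst d \<noteq> fst d'"
        using d(3,4) no_loop[OF d(2)] by (auto simp: fst_eq_dart)
      then have "\<exists>y. balanced G y"
        using balanced_parallel[OF less.prems(1) d(1,2) _ d(3,4) no_loop[OF d(1)]] del[OF arc[OF d(2)]] by blast
      then show False
        using contra by blast
    qed
    have no_pendant: "\<exists>d'\<in>darts G. dstart G d' = dstart G d \<and> d' \<noteq> d" if d: "d \<in> darts G" for d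
    proof (rule ccontr)
      assume "\<not> ?thesis"
      then have pend: "fst d \<notin> fst ` set ds" if "cyc G ds" for ds
        using pendant_notin_cyc[OF that, of d] by blast
      obtain y where y: "balanced (pre_digraph.del_arc G (fst d)) y"
        using del[OF arc[OF d]] by blast
      have "\<exists>y. balanced G y"
        using pend by (intro balanced_extend[OF less.prems(1) y]) blast
      then show False
        using contra by blast
    qed
    have no_series: "\<exists>f\<in>darts G. dstart G f = dstart G d \<and> f \<noteq> d \<and> f \<noteq> d'"
      if d: "d \<in> darts G" "d' \<in> darts G" "dstart G d = dstart G d'" "d \<noteq> d'" for d d'
    proof (rule ccontr)
      assume only: "\<not> ?thesis"
      obtain y where y: "balanced (contract_arc G (fst d')) y"
        using con[OF arc[OF d(2)]] by blast
      have "\<exists>y. balanced G y"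
      proof (rule balanced_series[where D = "rev_dart d" and E = d' and w = "dstart G d", OF less.prems(1) _ d(2) _ _ _ _ _ _ _ y])
        show "fst (rev_dart d) \<noteq> fst d'"
          using d no_loop[OF d(2)] by (auto simp: fst_eq_dart)
        show "dstart G (rev_dart d) \<noteq> dend G d'"
          using no_parallel[OF d(1,2,3)] d(4) by auto
        show "dstart G (rev_dart d) \<noteq> dstart G d" "dend G d' \<noteq> dstart G d"
          using no_loop[OF d(1)] no_loop[OF d(2)] d(3) by auto
        show "f = rev_dart (rev_dart d) \<or> f = d'" if "f \<in> darts G" "dstart G f = dstart G d" for f
          using only that by auto
      qed (use d in auto)
      then show False
        using contra by blast
    qed
    have "arcs G \<noteq> {}"
    proof
      assume "arcs G = {}"
      then have "balanced G (\<lambda>_. 0)"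
        by (auto simp: balanced_def cyc_def darts_def)
      then show False
        using contra by blast
    qed
    then obtain e where e: "(e, True) \<in> darts G"
      by (auto simp: darts_def)
    have "\<exists>vs i j m. distinct vs \<and> (\<forall>k. Suc k < length vs \<longrightarrow> adj (vs ! k) (vs ! Suc k)) \<and>
      2 \<le> i \<and> i < j \<and> i < m \<and> j < length vs \<and> m < length vs \<and>
      adj (vs ! 0) (vs ! i) \<and> adj (vs ! 0) (vs ! j) \<and> adj (vs ! (i - 1)) (vs ! m)"
    proof (rule crossing_chords[of "verts G"])
      show "adj (dstart G (e, True)) (dend G (e, True))"
        using e unfolding adj_def by blast
      show "u \<in> verts G" if "adj u v" for u v
        using that dstart_in_verts unfolding adj_def by blast
      show "adj v u" if "adj u v" for u v
        using that unfolding adj_def by (metis rev_dart_in_darts rev_dart_simps(1))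
      show "\<not> adj u u" for u
        using no_loop unfolding adj_def by metis
      fix v z a b assume "adj v z"
      then obtain d1 where d1: "d1 \<in> darts G" "dstart G d1 = v"
        unfolding adj_def by blast
      then obtain d2 where d2: "d2 \<in> darts G" "dstart G d2 = v" "d2 \<noteq> d1"
        using no_pendant by metis
      then obtain d3 where d3: "d3 \<in> darts G" "dstart G d3 = v" "d3 \<noteq> d1" "d3 \<noteq> d2"
        using no_series[of d1 d2] d1 by metis
      have "dend G d1 \<noteq> dend G d2" "dend G d1 \<noteq> dend G d3" "dend G d2 \<noteq> dend G d3"
        using no_parallel d1 d2 d3 by metis+
      moreover have "adj v (dend G d1)" "adj v (dend G d2)" "adj v (dend G d3)"
        using d1 d2 d3 unfolding adj_def by blast+
      ultimately show "\<exists>z. adj v z \<and> z \<noteq> a \<and> z \<noteq> b"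
        by metis
    qed simp
    then have "has_complete_minor 4 G"
      using K4_minor_of_crossing_chords[OF less.prems(1) adj_def] by blast
    then show False
      using less.prems(2) by blast
  qed
qed

section \<open>Cycles as circles in the realization\<close>

lemma cis_2pi_eq_iff: "cis (2 * pi * x) = cis (2 * pi * y) \<longleftrightarrow> x - y \<in> \<int>"
proof -
  have "cis (2 * pi * x) = cis (2 * pi * y) \<longleftrightarrow> cis (2 * pi * (x - y)) = 1"
    by (simp add: right_diff_distrib flip: cis_divide)
  also have "\<dots> \<longleftrightarrow> cos (2 * pi * (x - y)) = 1"
    by (auto simp: complex_eq_iff sin_eq_0_pi cos_one_sin_zero)
  also have "\<dots> \<longleftrightarrow> x - y \<in> \<int>"
    by (auto simp: cos_one_2pi_int Ints_def)
  finally show ?thesis .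
qed

lemma continuous_map_realization:
  fixes g :: "('v, 'e) gpoint \<Rightarrow> 'a::topological_space"
  assumes "wf_digraph G" "\<And>e. e \<in> arcs G \<Longrightarrow> continuous_on {0..1} (g \<circ> edge_map G e)"
  shows "continuous_map (realization G) euclidean g"
  unfolding continuous_map
proof (intro conjI allI impI)
  interpret wf_digraph G by fact
  fix U :: "'a set" assume "openin euclidean U"
  then have "open U"
    by simp
  have "{t \<in> {0..1}. edge_map G e t \<in> {x \<in> gpoints G. g x \<in> U}} = {0..1} \<inter> (g \<circ> edge_map G e) -` U"
    if "e \<in> arcs G" for e
    using that by (auto simp: edge_map_def gpoints_def)
  moreover have "openin (top_of_set {0..1}) ({0..1} \<inter> (g \<circ> edge_map G e) -` U)" if "e \<in> arcs G" for e
    using assms(2)[OF that] \<open>open U\<close> by (rule continuous_openin_preimage_gen)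
  ultimately show "openin (realization G) {x \<in> topspace (realization G). g x \<in> U}"
    by (auto simp: openin_realization topspace_realization gopen_def)
qed auto

lemma edge_map_in_gpoints:
  assumes "wf_digraph G" "e \<in> arcs G" "t \<in> {0..1}"
  shows "edge_map G e t \<in> gpoints G"
proof -
  interpret wf_digraph G by fact
  show ?thesis
    using assms by (auto simp: edge_map_def gpoints_def)
qed

lemma continuous_map_edge_map:
  assumes "wf_digraph G" "e \<in> arcs G"
  shows "continuous_map (top_of_set {0..1}) (realization G) (edge_map G e)"
  unfolding continuous_map
proof (intro conjI allI impI)
  interpret wf_digraph G by fact
  show "edge_map G e ` topspace (top_of_set {0..1}) \<subseteq> topspace (realization G)"
    using edge_map_in_gpoints[OF assms] by (auto simp: topspace_realization)
  show "openin (top_of_set {0..1}) {x \<in> topspace (top_of_set {0..1}). edge_map G e x \<in> U}"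
    if "openin (realization G) U" for U
    using that assms(2) by (simp add: openin_realization gopen_def)
qed

text \<open>Compactness is what turns a continuous bijection onto the circle into a
  homeomorphism.\<close>

lemma compact_space_realization:
  assumes "fin_digraph G"
  shows "compact_space (realization G)"
proof -
  interpret fin_digraph G by fact
  have "compactin (realization G) (\<Union> ((\<lambda>v. {Vertex v}) ` verts G \<union> (\<lambda>e. edge_map G e ` {0..1}) ` arcs G))"
  proof (rule compactin_Union)
    fix S assume "S \<in> (\<lambda>v. {Vertex v}) ` verts G \<union> (\<lambda>e. edge_map G e ` {0..1}) ` arcs G"
    then show "compactin (realization G) S"
    proof
      assume "S \<in> (\<lambda>v. {Vertex v}) ` verts G"
      then show ?thesis
        by (auto simp: topspace_realization gpoints_def)
    next
      assume "S \<in> (\<lambda>e. edge_map G e ` {0..1}) ` arcs G"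
      then obtain e where e: "e \<in> arcs G" "S = edge_map G e ` {0..1}"
        by auto
      have "compactin (top_of_set {0..1::real}) {0..1}"
        by (simp add: compactin_subtopology)
      then show ?thesis
        using image_compactin[OF _ continuous_map_edge_map[OF wf_digraph e(1)]] e(2) by blast
    qed
  qed auto
  moreover have "\<Union> ((\<lambda>v. {Vertex v}) ` verts G \<union> (\<lambda>e. edge_map G e ` {0..1}) ` arcs G) = gpoints G"
  proof
    show "\<Union> ((\<lambda>v. {Vertex v}) ` verts G \<union> (\<lambda>e. edge_map G e ` {0..1}) ` arcs G) \<subseteq> gpoints G"
    proof -
      have "Vertex v \<in> gpoints G" if "v \<in> verts G" for v
        using that by (simp add: gpoints_def)
      then show ?thesis
        using edge_map_in_gpoints[OF wf_digraph] by auto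
    qed
    have "Inner e t \<in> edge_map G e ` {0..1}" if "t \<in> {0<..<1}" for e t
      using that by (intro image_eqI[of _ _ t]) (auto simp: edge_map_def)
    then show "gpoints G \<subseteq> \<Union> ((\<lambda>v. {Vertex v}) ` verts G \<union> (\<lambda>e. edge_map G e ` {0..1}) ` arcs G)"
      by (fastforce simp: gpoints_def)
  qed
  ultimately show ?thesis
    by (simp add: compact_space_def topspace_realization)
qed

definition dpoint :: "('v, 'e) pre_digraph \<Rightarrow> 'e dart \<Rightarrow> real \<Rightarrow> ('v, 'e) gpoint" where
  "dpoint G d s = edge_map G (fst d) (if snd d then s else 1 - s)"

lemma dpoint_rev: "dpoint G (rev_dart d) s = dpoint G d (1 - s)"
  by (simp add: dpoint_def)

lemma dpoint_simps:
  "dpoint G d 0 = Vertex (dstart G d)" "dpoint G d 1 = Vertex (dend G d)"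
  "0 < s \<Longrightarrow> s < 1 \<Longrightarrow> dpoint G d s = Inner (fst d) (if snd d then s else 1 - s)"
  by (auto simp: dpoint_def edge_map_def dstart_def)

lemma dpoint_in_gpoints:
  assumes "wf_digraph G" "d \<in> darts G" "s \<in> {0..1}"
  shows "dpoint G d s \<in> gpoints G"
  unfolding dpoint_def by (rule edge_map_in_gpoints) (use assms in \<open>auto simp: darts_def\<close>)

text \<open>Listing the starts is enough when \<open>ds\<close> is a cycle, since every end is the
  start of the next dart.\<close>

definition cyc_graph :: "('v, 'e) pre_digraph \<Rightarrow> 'e dart list \<Rightarrow> ('v, 'e) pre_digraph" where
  "cyc_graph G ds = \<lparr>verts = dstart G ` set ds, arcs = fst ` set ds, tail = tail G, head = head G\<rparr>"

lemma edge_map_cong: "tail H = tail G \<Longrightarrow> head H = head G \<Longrightarrow> edge_map H = edge_map G"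
  by (simp add: edge_map_def fun_eq_iff)

lemma edge_map_cyc_graph [simp]: "edge_map (cyc_graph G ds) = edge_map G"
  by (rule edge_map_cong) (auto simp: cyc_graph_def)

lemma dpoint_cyc_graph [simp]: "dpoint (cyc_graph G ds) = dpoint G"
  by (simp add: dpoint_def fun_eq_iff)

lemma wf_cyc_graph:
  assumes "cyc G ds"
  shows "wf_digraph (cyc_graph G ds)"
proof -
  have "tail G e \<in> dstart G ` set ds \<and> head G e \<in> dstart G ` set ds" if e: "e \<in> fst ` set ds" for e
  proof -
    obtain d where d: "d \<in> set ds" "fst d = e"
      using e by auto
    obtain d' where d': "d' \<in> set ds" "dstart G d' = dend G d"
      using cyc_next[OF assms d(1)] by blast
    have "{tail G e, head G e} = {dstart G d, dstart G d'}"
      using d(2) d'(2) by (auto simp: dstart_def)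
    then show ?thesis
      using d(1) d'(1) by (auto simp: doubleton_eq_iff)
  qed
  then show ?thesis
    by unfold_locales (auto simp: cyc_graph_def)
qed

lemma subgraph_cyc_graph:
  assumes "wf_digraph G" "cyc G ds"
  shows "subgraph (cyc_graph G ds) G"
proof -
  interpret wf_digraph G by fact
  have "set ds \<subseteq> darts G"
    using assms by (auto simp: cyc_def)
  then have "fst ` set ds \<subseteq> arcs G" "dstart G ` set ds \<subseteq> verts G"
    using dstart_in_verts by (auto simp: darts_def)
  then show ?thesis
    using assms wf_cyc_graph[OF assms(2)] by (simp add: subgraph_def cyc_graph_def compatible_def)
qed

text \<open>With half-open parameter intervals each vertex of the cycle is assigned to the dart that
  leaves it, so every point is counted once.\<close>

lemma dpoint_eq_iff:
  assumes ds: "cyc G ds" and "i < length ds" "j < length ds" "s \<in> {0..<1}" "t \<in> {0..<1}"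
  shows "dpoint G (ds ! i) s = dpoint G (ds ! j) t \<longleftrightarrow> i = j \<and> s = t"
proof -
  have fst_eq: "fst (ds ! i) = fst (ds ! j) \<longleftrightarrow> i = j"
    using assms nth_eq_iff_index_eq[of "map fst ds" i j] by (auto simp: cyc_def)
  have start_eq: "dstart G (ds ! i) = dstart G (ds ! j) \<longleftrightarrow> i = j"
    using assms nth_eq_iff_index_eq[of "map (dstart G) ds" i j] by (auto simp: cyc_def)
  show ?thesis
  proof (cases "s = 0 \<or> t = 0")
    case True
    then show ?thesis
      using assms(4,5) start_eq
      by (cases "s = 0"; cases "t = 0") (auto simp: dpoint_simps)
  next
    case False
    then show ?thesis
      using assms(4,5) fst_eq by (auto simp: dpoint_simps)
  qed
qed

lemma circle_pos_eq_iff: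
  assumes "i < n" "j < n" "s \<in> {0..<1}" "t \<in> {0..<1::real}"
  shows "cis (2 * pi * ((real i + s) / real n)) = cis (2 * pi * ((real j + t) / real n)) \<longleftrightarrow> i = j \<and> s = t"
proof
  assume "cis (2 * pi * ((real i + s) / real n)) = cis (2 * pi * ((real j + t) / real n))"
  then have "(real i + s) / real n - (real j + t) / real n \<in> \<int>"
    by (simp only: cis_2pi_eq_iff)
  then obtain k :: int where k: "(real i + s) / real n - (real j + t) / real n = k"
    by (auto simp: Ints_def)
  have "real i + s < real n" "real j + t < real n"
    using assms by (auto simp: less_eq_real_def)
  then have "(real i + s) / real n < 1" "(real j + t) / real n < 1"
      "0 \<le> (real i + s) / real n" "0 \<le> (real j + t) / real n"
    using assms by auto
  then have "k = 0"
    using k by linarith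
  then have eq: "real i + s = real j + t"
    using k assms by simp
  then have "\<lfloor>real i + s\<rfloor> = \<lfloor>real j + t\<rfloor>"
    by simp
  moreover have "\<lfloor>real i + s\<rfloor> = int i" "\<lfloor>real j + t\<rfloor> = int j"
    using assms by (auto intro!: floor_unique)
  ultimately show "i = j \<and> s = t"
    using eq by simp
qed auto

lemma circle_pos_exists:
  assumes "z \<in> sphere 0 1" "0 < n"
  shows "\<exists>i<n. \<exists>s\<in>{0..<1}. z = cis (2 * pi * ((real i + s) / real n))"
proof -
  have "z = cis (Arg2pi z)"
    using assms(1) Arg2pi_eq[of z] by (simp add: cis_conv_exp)
  moreover define x where "x = Arg2pi z / (2 * pi)"
  ultimately have z: "z = cis (2 * pi * x)"
    by simp
  have x: "0 \<le> x" "x < 1"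
    using Arg2pi_ge_0[of z] Arg2pi_lt_2pi[of z] by (auto simp: x_def)
  define i where "i = nat \<lfloor>n * x\<rfloor>"
  have "real n * x < real n"
    using x assms(2) by simp
  moreover have "real i = of_int \<lfloor>n * x\<rfloor>"
    using x by (simp add: i_def)
  ultimately have "i < n" "n * x - i \<in> {0..<1}"
    by (simp_all add: floor_correct) linarith+
  then show ?thesis
    using z assms(2) by (intro exI[of _ i] conjI bexI[of _ "n * x - i"]) auto
qed

text \<open>The homeomorphism is built backwards, from the realization to the circle: there
  continuity can be checked edge by edge, and a continuous bijection from a compact space to a
  Hausdorff space is a homeomorphism. The darts occupy equal arcs of the circle.\<close>

lemma cyc_parametrization:
  assumes "wf_digraph G" and ds: "cyc G ds"
  obtains h where "homeomorphic_map circle (realization (cyc_graph G ds)) h"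
    "\<And>i s. i < length ds \<Longrightarrow> s \<in> {0..1} \<Longrightarrow>
      h (cis (2 * pi * ((real i + s) / real (length ds)))) = dpoint G (ds ! i) s"
proof -
  define n where "n = length ds"
  define C where "C = cyc_graph G ds"
  have n: "0 < n"
    using ds by (simp add: n_def cyc_def)
  interpret C: wf_digraph C
    unfolding C_def by (rule wf_cyc_graph[OF ds])
  have finC: "fin_digraph C"
    by unfold_locales (auto simp: C_def cyc_graph_def)
  define S where "S = {..<n} \<times> {0..<1::real}"
  define P where "P = (\<lambda>(i, s). dpoint G (ds ! i) s)"
  define Q where "Q = (\<lambda>(i, s). cis (2 * pi * ((real i + s) / real n)))"
  have P_inj: "inj_on P S"
    using dpoint_eq_iff[OF ds] by (auto simp: inj_on_def P_def S_def n_def)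
  have Q_inj: "inj_on Q S"
    unfolding inj_on_def Q_def S_def using circle_pos_eq_iff by (auto simp del: cis_inverse)
  have nth_darts: "ds ! i \<in> darts C" "fst (ds ! i) \<in> arcs C" if "i < n" for i
    using that by (auto simp: n_def C_def cyc_graph_def darts_def mem_Times_iff)
  have P_img: "P ` S = gpoints C"
  proof
    show "P ` S \<subseteq> gpoints C"
      using dpoint_in_gpoints[OF C.wf_digraph nth_darts(1)] by (auto simp: P_def S_def C_def)
    show "gpoints C \<subseteq> P ` S"
    proof
      fix x assume "x \<in> gpoints C"
      then consider (v) v where "x = Vertex v" "v \<in> dstart G ` set ds"
        | (e) e t where "x = Inner e t" "e \<in> fst ` set ds" "t \<in> {0<..<1}"
        by (auto simp: gpoints_def C_def cyc_graph_def)
      then show "x \<in> P ` S"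
      proof cases
        case v
        then obtain i where i: "i < n" "v = dstart G (ds ! i)"
          by (auto simp: in_set_conv_nth n_def)
        then have "x = P (i, 0)" "(i, 0) \<in> S"
          using v by (auto simp: P_def S_def dpoint_simps)
        then show ?thesis
          by blast
      next
        case e
        then obtain i where i: "i < n" "e = fst (ds ! i)"
          by (auto simp: in_set_conv_nth n_def)
        then have "x = P (i, if snd (ds ! i) then t else 1 - t)" "(i, if snd (ds ! i) then t else 1 - t) \<in> S"
          using e by (auto simp: P_def S_def dpoint_simps)
        then show ?thesis
          by blast
      qed
    qed
  qed
  have Q_img: "Q ` S = sphere 0 1"
  proof
    show "sphere 0 1 \<subseteq> Q ` S"
      using circle_pos_exists[OF _ n] by (force simp: Q_def S_def)
  qed (auto simp: Q_def)
  define H where "H x = Q (inv_into S P x)" for x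
  have H_P: "H (dpoint G (ds ! i) s) = cis (2 * pi * ((real i + s) / real n))"
    if "i < n" "s \<in> {0..<1}" for i s
  proof -
    have "inv_into S P (P (i, s)) = (i, s)"
      using that by (intro inv_into_f_f[OF P_inj]) (auto simp: S_def)
    then show ?thesis
      by (simp add: H_def P_def Q_def)
  qed
  \<comment> \<open>At the parameter 1 the point is represented by the next dart, through which
    \<open>H\<close> is defined; the two positions on the circle agree modulo a full turn.\<close>
  have H_dpoint: "H (dpoint G (ds ! i) s) = cis (2 * pi * ((real i + s) / real n))"
    if "i < n" "s \<in> {0..1}" for i s
  proof (cases "s = 1")
    case True
    define j where "j = Suc i mod n"
    have "dpoint G (ds ! i) 1 = dpoint G (ds ! j) 0"
      using cyc_nth[OF ds, of i] that by (simp add: dpoint_simps j_def n_def)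
    then have "H (dpoint G (ds ! i) s) = cis (2 * pi * (real j / real n))"
      using H_P[of j 0] n True by (simp add: j_def)
    also have "\<dots> = cis (2 * pi * ((real i + s) / real n))"
      unfolding cis_2pi_eq_iff
    proof (cases "Suc i = n")
      case True
      then show "real j / real n - (real i + s) / real n \<in> \<int>"
        using \<open>s = 1\<close> n by (simp add: j_def flip: of_nat_Suc minus_divide_left)
           (metis Suc_eq_plus1 True add.commute divide_self_if of_nat_Suc of_nat_0_eq_iff Ints_1 Ints_minus nat.simps(3))
    next
      case False
      then have "j = Suc i"
        using that by (simp add: j_def)
      then show "real j / real n - (real i + s) / real n \<in> \<int>"
        using \<open>s = 1\<close> by (simp add: add.commute)
    qed
    finally show ?thesis .
  qed (use H_P that in auto)
  have bij_H: "H ` gpoints C = sphere 0 1" "inj_on H (gpoints C)"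
  proof -
    have "inv_into S P ` gpoints C = S"
      unfolding P_img[symmetric] by (rule inv_into_image_cancel[OF P_inj subset_refl, THEN trans]) simp
    then show "H ` gpoints C = sphere 0 1"
      unfolding H_def image_comp[symmetric, unfolded o_def] Q_img[symmetric] by (metis image_image)
    show "inj_on H (gpoints C)"
    proof (rule inj_onI)
      fix x y assume xy: "x \<in> gpoints C" "y \<in> gpoints C" "H x = H y"
      then have "inv_into S P x = inv_into S P y"
        using Q_inj P_img by (auto simp: H_def inj_on_def inv_into_into)
      then show "x = y"
        using xy P_img by (metis inv_into_injective)
    qed
  qed
  have "continuous_map (realization C) euclidean H"
  proof (rule continuous_map_realization[OF C.wf_digraph])
    fix e assume "e \<in> arcs C"
    then obtain i where i: "i < n" "e = fst (ds ! i)"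
      by (auto simp: C_def cyc_graph_def in_set_conv_nth n_def)
    define r where "r t = (if snd (ds ! i) then t else 1 - t)" for t :: real
    have "(H \<circ> edge_map C e) t = cis (2 * pi * ((real i + r t) / real n))" if "t \<in> {0..1}" for t
    proof -
      have "edge_map C e t = dpoint G (ds ! i) (r t)"
        by (simp add: C_def dpoint_def i r_def)
      then show ?thesis
        using H_dpoint[OF i(1), of "r t"] that by (simp add: r_def)
    qed
    moreover have "continuous_on {0..1} (\<lambda>t. cis (2 * pi * ((real i + r t) / real n)))"
      unfolding r_def by (cases "snd (ds ! i)") (use n in \<open>auto intro!: continuous_intros\<close>)
    ultimately show "continuous_on {0..1} (H \<circ> edge_map C e)"
      using continuous_on_eq[of "{0..1}" "\<lambda>t. cis (2 * pi * ((real i + r t) / real n))" "H \<circ> edge_map C e"] by simp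
  qed
  then have "continuous_map (realization C) circle H"
    using bij_H(1) by (intro continuous_map_into_subtopology) (auto simp: C.topspace_realization)
  moreover have "Hausdorff_space circle"
    by (simp add: Hausdorff_space_subtopology)
  ultimately have homeo: "homeomorphic_map (realization C) circle H"
    using compact_space_realization[OF finC] bij_H
    by (intro continuous_imp_homeomorphic_map) (auto simp: C.topspace_realization)
  then obtain h where h: "homeomorphic_maps (realization C) circle H h"
    by (auto simp: homeomorphic_map_maps)
  have "homeomorphic_map circle (realization C) h"
    using h by (auto simp: homeomorphic_maps_map)
  moreover have "h (cis (2 * pi * ((real i + s) / real n))) = dpoint G (ds ! i) s" if "i < n" "s \<in> {0..1}" for i s
  proof -
    have "dpoint G (ds ! i) s \<in> topspace (realization C)"
      using dpoint_in_gpoints[OF C.wf_digraph nth_darts(1)[OF that(1)] that(2)] by (simp add: C_def C.topspace_realization[unfolded C_def])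
    then show ?thesis
      using h H_dpoint[OF that] by (metis homeomorphic_maps_def)
  qed
  ultimately show ?thesis
    using that by (simp add: C_def n_def)
qed

section \<open>Subgraphs homeomorphic to the circle are closed walks\<close>

lemma circle_not_inj_real:
  fixes u :: "complex \<Rightarrow> real"
  assumes "continuous_on (sphere 0 1) u"
  shows "\<not> inj_on u (sphere 0 1)"
proof
  assume inj: "inj_on u (sphere 0 1)"
  \<comment> \<open>The difference of the values at antipodal points changes sign over half a turn,
    so it vanishes somewhere.\<close>
  define g where "g t = u (cis t) - u (- cis t)" for t
  have cont: "continuous_on {0..pi} g"
    unfolding g_def by (intro continuous_intros continuous_on_compose2[OF assms]) auto
  have g_pi: "g pi = - g 0"
    by (simp add: g_def)
  have "\<exists>t. 0 \<le> t \<and> t \<le> pi \<and> g t = 0"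
  proof (cases "g 0 \<le> 0")
    case True
    then show ?thesis
      using g_pi cont by (intro IVT') auto
  next
    case False
    then show ?thesis
      using g_pi cont by (intro IVT2') auto
  qed
  then obtain t where "u (cis t) = u (- cis t)"
    by (auto simp: g_def)
  then have "cis t = - cis t"
    using inj by (auto simp: inj_on_def)
  then show False
    by simp
qed

lemma connected_punctured_circle:
  assumes "a \<in> sphere 0 (1::real)"
  shows "topological_space_class.connected (sphere 0 1 - {a::complex})"
proof -
  have a: "a \<noteq> 0" "norm a = 1"
    using assms by auto
  have "sphere 0 1 - {a} = (\<lambda>t. a * cis t) ` {0<..<2 * pi}"
  proof
    show "(\<lambda>t. a * cis t) ` {0<..<2 * pi} \<subseteq> sphere 0 1 - {a}"
    proof (rule image_subsetI)
      fix t :: real assume "t \<in> {0<..<2 * pi}"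
      then have t: "0 < t" "t < 2 * pi"
        by auto
      have "cis t \<noteq> 1"
      proof
        assume "cis t = 1"
        then have "t / (2 * pi) - 0 \<in> \<int>"
          using cis_2pi_eq_iff[of "t / (2 * pi)" 0] by simp
        then obtain k :: int where "t = k * (2 * pi)"
          by (auto simp: Ints_def field_simps)
        then have "0 < k" "k < 1"
          using t by (simp_all add: zero_less_mult_iff)
        then show False
          by simp
      qed
      then show "a * cis t \<in> sphere 0 1 - {a}"
        using a by (simp add: norm_mult)
    qed
    show "sphere 0 1 - {a} \<subseteq> (\<lambda>t. a * cis t) ` {0<..<2 * pi}"
    proof
      fix z assume z: "z \<in> sphere 0 1 - {a}"
      have eq: "z / a = cis (Arg2pi (z / a))"
        using z a Arg2pi_eq[of "z / a"] by (simp add: norm_divide cis_conv_exp)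
      have "Arg2pi (z / a) \<noteq> 0"
      proof
        assume "Arg2pi (z / a) = 0"
        then have "z / a = 1"
          using eq by simp
        then show False
          using z a by simp
      qed
      then have "Arg2pi (z / a) \<in> {0<..<2 * pi}"
        using Arg2pi_ge_0[of "z / a"] Arg2pi_lt_2pi[of "z / a"] by auto
      moreover have "z = a * cis (Arg2pi (z / a))"
        using eq a by (metis nonzero_mult_div_cancel_left times_divide_eq_right)
      ultimately show "z \<in> (\<lambda>t. a * cis t) ` {0<..<2 * pi}"
        by blast
    qed
  qed
  moreover have "topological_space_class.connected ((\<lambda>t. a * cis t) ` {0<..<2 * pi})"
    by (intro connected_continuous_image continuous_intros) auto
  ultimately show ?thesis
    by simp
qed

lemma connectedin_circle_image:
  assumes h: "homeomorphic_map circle X h" and p: "p \<in> topspace X"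
  shows "connectedin X (topspace X - {p})"
proof -
  have img: "h ` sphere 0 1 = topspace X" and inj: "inj_on h (sphere 0 1)" and cont: "continuous_map circle X h"
    using h by (auto simp: homeomorphic_eq_everything_map)
  then obtain q where q: "q \<in> sphere 0 1" "p = h q"
    using p by blast
  have "connectedin circle (sphere 0 1 - {q})"
    using connected_punctured_circle[OF q(1)] by (simp add: connectedin_subtopology)
  then have "connectedin X (h ` (sphere 0 1 - {q}))"
    by (rule connectedin_continuous_map_image[OF cont])
  moreover have "h ` (sphere 0 1 - {q}) = topspace X - {p}"
    using img inj q by (auto simp: inj_on_def)
  ultimately show ?thesis
    by simp
qed

text \<open>An isolated vertex would split off from the connected circle. A pendant edge would be
  cut at its midpoint, but a circle without one point is still connected. Both are detected by a
  continuous real function that takes the values 0 and 1 but misses 1/2.\<close>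

lemma circle_realization_degree:
  assumes C: "wf_digraph C" and h: "homeomorphic_map circle (realization C) h"
  shows "\<And>v. v \<in> verts C \<Longrightarrow> \<exists>d\<in>darts C. dstart C d = v"
    and "\<And>d. d \<in> darts C \<Longrightarrow> \<exists>d'\<in>darts C. dstart C d' = dstart C d \<and> d' \<noteq> d"
proof -
  interpret wf_digraph C by fact
  have top: "topspace (realization C) = gpoints C"
    by (rule topspace_realization)
  have img: "h ` sphere 0 1 = gpoints C" and inj: "inj_on h (sphere 0 1)" and cont: "continuous_map circle (realization C) h"
    using h top by (auto simp: homeomorphic_eq_everything_map)
  fix v assume v: "v \<in> verts C"
  show "\<exists>d\<in>darts C. dstart C d = v"
  proof (rule ccontr)
    assume no: "\<not> ?thesis"
    define \<phi> where "\<phi> x = (if x = Vertex v then 0 else 1 :: real)" for x :: "('a, 'b) gpoint"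
    have "tail C e \<noteq> v" "head C e \<noteq> v" if "e \<in> arcs C" for e
    proof -
      have "(e, True) \<in> darts C" "(e, False) \<in> darts C" "dstart C (e, True) = tail C e" "dstart C (e, False) = head C e"
        using that by (auto simp: darts_def dstart_def)
      then show "tail C e \<noteq> v" "head C e \<noteq> v"
        using no by metis+
    qed
    then have "\<phi> (edge_map C e t) = 1" if "e \<in> arcs C" for e t
      using that by (simp add: \<phi>_def edge_map_def)
    then have "continuous_map (realization C) euclidean \<phi>"
      using C by (intro continuous_map_realization) (simp_all cong: continuous_on_cong add: o_def)
    then have "continuous_map circle euclidean (\<phi> \<circ> h)"
      using cont by (rule continuous_map_compose[rotated])
    then have "topological_space_class.connected ((\<phi> \<circ> h) ` sphere 0 1)"
      by (intro connected_continuous_image) (auto intro!: connected_sphere)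
    then have conn: "topological_space_class.connected (\<phi> ` gpoints C)"
      by (simp add: img[symmetric] image_comp)
    have "h 1 \<noteq> h (-1)" "h 1 \<in> gpoints C" "h (-1) \<in> gpoints C"
      using inj_onD[OF inj, of 1 "-1"] img by auto
    then have "1 \<in> \<phi> ` gpoints C"
      by (metis \<phi>_def image_eqI)
    moreover have "0 \<in> \<phi> ` gpoints C"
      using v by (intro image_eqI[of _ _ "Vertex v"]) (auto simp: \<phi>_def gpoints_def)
    ultimately have "1/2 \<in> \<phi> ` gpoints C"
      using conn by (auto intro: connectedD_interval[of _ 0 1])
    then show False
      by (auto simp: \<phi>_def split: if_splits)
  qed
next
  interpret wf_digraph C by fact
  have top: "topspace (realization C) = gpoints C"
    by (rule topspace_realization)
  fix d assume d: "d \<in> darts C"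
  show "\<exists>d'\<in>darts C. dstart C d' = dstart C d \<and> d' \<noteq> d"
  proof (rule ccontr)
    assume no: "\<not> ?thesis"
    define v where "v = dstart C d"
    have only: "d' = d" if "d' \<in> darts C" "dstart C d' = v" for d'
      using no that by (auto simp: v_def)
    have end_ne: "dend C d \<noteq> v"
      using only[of "rev_dart d"] d by auto
    \<comment> \<open>\<phi> is the parameter along the pendant edge counted from \<open>v\<close>,
      and 1 elsewhere; the midpoint is the only point of value 1/2.\<close>
    define \<phi> where "\<phi> x = (case x of Vertex w \<Rightarrow> if w = v then 0 else 1
      | Inner e t \<Rightarrow> if e = fst d then if snd d then t else 1 - t else (1::real))" for x
    have ends: "{tail C (fst d), head C (fst d)} = {v, dend C d}"
      by (auto simp: v_def dstart_def)
    have \<phi>1: "\<phi> (edge_map C (fst d) t) = (if snd d then t else 1 - t)" for t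
      using end_ne by (cases "snd d") (auto simp: \<phi>_def edge_map_def v_def dstart_def)
    have \<phi>2: "\<phi> (edge_map C e t) = 1" if "e \<in> arcs C" "e \<noteq> fst d" for e t
    proof -
      have "tail C e \<noteq> v" "head C e \<noteq> v"
        using only[of "(e, True)"] only[of "(e, False)"] that by (auto simp: darts_def dstart_def)
      then show ?thesis
        using that by (auto simp: \<phi>_def edge_map_def)
    qed
    have "continuous_on {0..1} (\<phi> \<circ> edge_map C e)" if "e \<in> arcs C" for e
    proof (cases "e = fst d")
      case True
      then show ?thesis
        by (cases "snd d") (auto simp: o_def \<phi>1 intro!: continuous_intros)
    qed (simp add: o_def \<phi>2 that)
    then have cont: "continuous_map (realization C) euclidean \<phi>"
      using C by (intro continuous_map_realization)
    define p :: "('a, 'b) gpoint" where "p = Inner (fst d) (1/2)"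
    have e: "fst d \<in> arcs C"
      using d by (auto simp: darts_def)
    then have "p \<in> gpoints C"
      using edge_map_in_gpoints[OF C, of "fst d" "1/2"] by (simp add: p_def edge_map_def)
    then have "connectedin (realization C) (gpoints C - {p})"
      using connectedin_circle_image[OF h] top by simp
    then have "connectedin euclidean (\<phi> ` (gpoints C - {p}))"
      by (rule connectedin_continuous_map_image[OF cont])
    then have conn: "topological_space_class.connected (\<phi> ` (gpoints C - {p}))"
      by simp
    have "0 \<in> \<phi> ` (gpoints C - {p})"
      using d by (intro image_eqI[of _ _ "Vertex v"]) (auto simp: \<phi>_def gpoints_def p_def v_def dstart_in_verts)
    moreover have "1 \<in> \<phi> ` (gpoints C - {p})"
      using d end_ne by (intro image_eqI[of _ _ "Vertex (dend C d)"]) (auto simp: \<phi>_def gpoints_def p_def dstart_in_verts)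
    ultimately have "1/2 \<in> \<phi> ` (gpoints C - {p})"
      using conn by (auto intro: connectedD_interval[of _ 0 1])
    then show False
      by (auto simp: \<phi>_def p_def split: gpoint.splits if_splits)
  qed
qed

text \<open>Take a longest walk with distinct edges and distinct starts. Its last dart can be
  continued by a dart other than its reversal, so by maximality the end of the walk is already one
  of its starts; from that place on the walk is a cycle.\<close>

lemma cyc_exists:
  assumes fin: "fin_digraph C" and d0: "d0 \<in> darts C"
    and deg: "\<And>d. d \<in> darts C \<Longrightarrow> \<exists>d'\<in>darts C. dstart C d' = dstart C d \<and> d' \<noteq> d"
  shows "\<exists>ds. cyc C ds"
proof -
  interpret fin_digraph C by fact
  define P where "P ds \<longleftrightarrow> ds \<noteq> [] \<and> set ds \<subseteq> darts C \<and> distinct (map fst ds) \<and>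
    distinct (map (dstart C) ds) \<and> dwalk C (dstart C (hd ds)) ds (dend C (last ds))" for ds
  have "length ds \<le> card (verts C)" if "P ds" for ds
  proof -
    have "set (map (dstart C) ds) \<subseteq> verts C"
      using that dstart_in_verts by (auto simp: P_def)
    then have "card (set (map (dstart C) ds)) \<le> card (verts C)"
      by (intro card_mono) auto
    then show ?thesis
      using that distinct_card[of "map (dstart C) ds"] by (simp add: P_def)
  qed
  moreover have "P [d0]"
    using d0 by (simp add: P_def)
  ultimately obtain ds where ds: "P ds" and max: "\<And>ds'. P ds' \<Longrightarrow> length ds' \<le> length ds"
    using ex_has_greatest_nat_lemma[of P "[d0]" length "card (verts C)"]
    by (metis (no_types, lifting) Suc_le_lessD add.commute le_antisym less_irrefl_nat not_less_eq_eq trans_le_add2)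
  define l where "l = last ds"
  define w where "w = dend C l"
  have l: "l \<in> set ds" "l \<in> darts C"
    using ds by (auto simp: P_def l_def)
  then obtain d' where d': "d' \<in> darts C" "dstart C d' = w" "d' \<noteq> rev_dart l"
    using deg[of "rev_dart l"] by (auto simp: w_def)
  have "w \<in> dstart C ` set ds"
  proof (rule ccontr)
    assume w: "w \<notin> dstart C ` set ds"
    have "fst d' \<notin> fst ` set ds"
    proof
      assume "fst d' \<in> fst ` set ds"
      then obtain x where x: "x \<in> set ds" "fst d' = fst x"
        by auto
      have "d' \<noteq> x"
        using w d' x by auto
      then have "d' = rev_dart x"
        using x by (simp add: fst_eq_dart)
      then have "dend C x = w" "x \<noteq> l"
        using d' by auto
      obtain i where i: "i < length ds" "x = ds ! i"
        using x by (auto simp: in_set_conv_nth)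
      have "Suc i < length ds"
      proof (rule ccontr)
        assume "\<not> Suc i < length ds"
        then have "i = length ds - 1"
          using i(1) by linarith
        then have "x = l"
          using i(2) ds by (simp add: l_def last_conv_nth P_def)
        then show False
          using \<open>x \<noteq> l\<close> by contradiction
      qed
      then have "dstart C (ds ! Suc i) = w" "ds ! Suc i \<in> set ds"
        using dwalk_nth[of C _ ds _ i] ds \<open>dend C x = w\<close> i by (auto simp: P_def)
      then show False
        using w by (metis imageI)
    qed
    then have "P (ds @ [d'])"
      using ds d' w by (auto simp: P_def dwalk_append w_def l_def)
    then show False
      using max[of "ds @ [d']"] by simp
  qed
  then obtain y where y: "y \<in> set ds" "dstart C y = w"
    by auto
  then obtain ys zs where split: "ds = ys @ y # zs"
    by (meson split_list)
  then have "cyc C (y # zs)"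
    using ds y(2) by (auto simp: P_def cyc_def dwalk_append w_def l_def)
  then show ?thesis
    by blast
qed

lemma continuous_map_realization_subgraph:
  assumes sub: "subgraph H G"
  shows "continuous_map (realization H) (realization G) (\<lambda>x. x)"
proof -
  have wf: "wf_digraph H" "wf_digraph G" and HG: "arcs H \<subseteq> arcs G" "verts H \<subseteq> verts G" "tail H = tail G" "head H = head G"
    using sub by (auto simp: subgraph_def compatible_def)
  have em: "edge_map H = edge_map G"
    using HG by (intro edge_map_cong) auto
  have top: "topspace (realization H) = gpoints H" "topspace (realization G) = gpoints G"
    using wf by (simp_all add: wf_digraph.topspace_realization)
  have "gpoints H \<subseteq> gpoints G"
    using HG by (auto simp: gpoints_def)
  moreover have "openin (realization H) {x \<in> gpoints H. x \<in> U}" if U: "openin (realization G) U" for U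
  proof -
    have "{t \<in> {0..1}. edge_map H e t \<in> {x \<in> gpoints H. x \<in> U}} = {t \<in> {0..1}. edge_map G e t \<in> U}" if "e \<in> arcs H" for e
      using edge_map_in_gpoints[OF wf(1) that] em by auto
    then show ?thesis
      using U HG by (auto simp: openin_realization gopen_def)
  qed
  ultimately show ?thesis
    by (auto simp: continuous_map top)
qed

text \<open>Since every dart can be continued, \<open>C\<close> contains a closed walk, whose
  subgraph \<open>H\<close> is itself a circle. If \<open>H\<close> missed a point of
  \<open>C\<close>, the circle would embed into a punctured circle and hence into the real line,
  which is impossible.\<close>

lemma is_cycle_of_cyc:
  assumes fin: "fin_digraph G" and cycle: "is_cycle_of C G"
  shows "\<exists>ds. cyc G ds \<and> C = cyc_graph G ds"
proof -
  interpret G: fin_digraph G by fact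
  have sub: "subgraph C G"
    using cycle by (simp add: is_cycle_of_def)
  have CG: "arcs C \<subseteq> arcs G" "verts C \<subseteq> verts G" "tail C = tail G" "head C = head G" and wfC: "wf_digraph C"
    using sub by (auto simp: subgraph_def compatible_def)
  interpret C: wf_digraph C by fact
  have finC: "fin_digraph C"
    using CG by unfold_locales (auto intro: finite_subset)
  have "circle homeomorphic_space realization C"
    using cycle unfolding is_cycle_of_def by (subst homeomorphic_space_sym) blast
  then obtain h where h: "homeomorphic_map circle (realization C) h"
    by (auto simp: homeomorphic_space)
  have img: "h ` sphere 0 1 = gpoints C"
    using h by (auto simp: homeomorphic_eq_everything_map C.topspace_realization)
  have "\<exists>d. d \<in> darts C"
  proof -
    have "h 1 \<in> gpoints C"
      using img by auto
    then show ?thesis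
      using circle_realization_degree(1)[OF wfC h] by (auto simp: gpoints_def darts_def)
  qed
  then obtain ds where ds: "cyc C ds"
    using cyc_exists[OF finC] circle_realization_degree(2)[OF wfC h] by metis
  define H where "H = cyc_graph C ds"
  have HC: "subgraph H C"
    unfolding H_def by (rule subgraph_cyc_graph[OF wfC ds])
  then interpret H: wf_digraph H
    by (simp add: subgraph_def)
  obtain g where g: "homeomorphic_map circle (realization H) g"
    using cyc_parametrization[OF wfC ds] unfolding H_def by metis
  obtain k where k: "homeomorphic_maps circle (realization C) h k"
    using h by (auto simp: homeomorphic_map_maps)
  have sub_pts: "gpoints H \<subseteq> gpoints C"
    using HC by (auto simp: subgraph_def gpoints_def)
  have "gpoints C \<subseteq> gpoints H"
  proof
    fix p assume p: "p \<in> gpoints C"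
    show "p \<in> gpoints H"
    proof (rule ccontr)
      assume p_notin: "p \<notin> gpoints H"
      have k_img: "k x \<in> sphere 0 1" "h (k x) = x" if "x \<in> gpoints C" for x
        using k that by (auto simp: homeomorphic_maps_def C.topspace_realization continuous_map_def Pi_iff)
      have g_img: "g z \<in> gpoints H" if "z \<in> sphere 0 1" for z
        using g that by (auto simp: homeomorphic_eq_everything_map H.topspace_realization)
      define m where "m z = k (g z)" for z
      have m: "m z \<in> sphere 0 1" "m z \<noteq> k p" if "z \<in> sphere 0 1" for z
      proof -
        have gz: "g z \<in> gpoints C" "g z \<noteq> p"
          using g_img[OF that] sub_pts p_notin by auto
        show "m z \<in> sphere 0 1"
          unfolding m_def by (rule k_img(1)[OF gz(1)])
        show "m z \<noteq> k p"
          unfolding m_def using k_img(2)[OF gz(1)] k_img(2)[OF p] gz(2) by metis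
      qed
      have "continuous_map circle circle (k \<circ> (\<lambda>x. x) \<circ> g)"
        using g k continuous_map_realization_subgraph[OF HC]
        by (intro continuous_map_compose) (auto simp: homeomorphic_eq_everything_map homeomorphic_maps_def)
      then have m_cont: "continuous_on (sphere 0 1) m"
        by (simp add: m_def o_def continuous_map_in_subtopology)
      have kp: "norm (k p) = 1" "k p \<noteq> 0"
        using k_img[OF p] by auto
      \<comment> \<open>The missing point is rotated to -1, on the cut of the principal argument, so
        \<open>Arg\<close> becomes continuous and injective on the image.\<close>
      have arg: "- (m z / k p) \<notin> \<real>\<^sub>\<le>\<^sub>0" if z: "z \<in> sphere 0 1" for z
      proof
        assume "- (m z / k p) \<in> \<real>\<^sub>\<le>\<^sub>0"
        then obtain r where r: "- (m z / k p) = complex_of_real r" "r \<le> 0"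
          unfolding nonpos_Reals_def by blast
        then have "\<bar>r\<bar> = norm (m z / k p)"
        proof -
          have "norm (- (m z / k p)) = \<bar>r\<bar>"
            unfolding r(1) by simp
          then show ?thesis
            by simp
        qed
        then have "r = -1"
          using r(2) m(1)[OF z] kp by (simp add: norm_divide)
        then show False
          using r(1) m(2)[OF z] kp by (simp add: field_simps)
      qed
      define u where "u z = Arg (- (m z / k p))" for z
      have "continuous_on (sphere 0 1) u"
        unfolding u_def using arg kp by (intro continuous_intros m_cont) auto
      moreover have "inj_on u (sphere 0 1)"
      proof (rule inj_onI)
        fix z w assume zw: "z \<in> sphere 0 1" "w \<in> sphere 0 1" "u z = u w"
        have n: "norm (- (m z / k p)) = 1" "norm (- (m w / k p)) = 1"
          using m(1) zw kp by (simp_all add: norm_divide)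
        have "- (m z / k p) = - (m w / k p)"
        proof -
          have "- (m z / k p) = rcis 1 (u z)" "- (m w / k p) = rcis 1 (u w)"
            using rcis_cmod_Arg[of "- (m z / k p)"] rcis_cmod_Arg[of "- (m w / k p)"] n
            unfolding u_def by simp_all
          then show ?thesis
            using zw(3) by simp
        qed
        then have "m z = m w"
          using kp by simp
        then have "g z = g w"
          using k_img(2)[of "g z"] k_img(2)[of "g w"] g_img zw sub_pts by (metis m_def subsetD)
        then show "z = w"
          using g zw by (auto simp: homeomorphic_eq_everything_map inj_on_def)
      qed
      ultimately show False
        using circle_not_inj_real by blast
    qed
  qed
  then have eq: "gpoints C = gpoints H"
    using sub_pts by blast
  have "verts C = verts H"
  proof -
    have "v \<in> verts C \<longleftrightarrow> Vertex v \<in> gpoints C" "v \<in> verts H \<longleftrightarrow> Vertex v \<in> gpoints H" for v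
      by (auto simp: gpoints_def)
    then show ?thesis
      using eq by auto
  qed
  moreover have "arcs C = arcs H"
  proof -
    obtain r :: real where "0 < r" "r < 1"
      using dense[of 0 1] zero_less_one by blast
    then have "e \<in> arcs C \<longleftrightarrow> Inner e r \<in> gpoints C" "e \<in> arcs H \<longleftrightarrow> Inner e r \<in> gpoints H" for e
      by (auto simp: gpoints_def)
    then show ?thesis
      using eq by auto
  qed
  moreover have dstart_eq: "dstart C = dstart G"
    using CG by (simp add: dstart_def fun_eq_iff)
  ultimately have "C = cyc_graph G ds"
    using CG by (intro pre_digraph.equality) (auto simp: H_def cyc_graph_def)
  moreover have "cyc G ds"
    using ds CG dstart_eq by (intro cyc_subset[OF ds]) (auto simp: darts_def)
  ultimately show ?thesis
    by blast
qed

text \<open>Following \<open>h\<close> by the inverse of the standard parametrization gives a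
  self-map of the circle; \<psi> is its lift to the line and \<open>m\<close> its degree.
  Injectivity of the self-map becomes injectivity of \<psi> modulo integers.\<close>

lemma cycle_reparametrization:
  assumes fin: "fin_digraph G" and cycle: "is_cycle_of C G" and h: "homeomorphic_map circle (realization C) h"
  obtains ds h0 \<psi> and m :: int where "cyc G ds" "homeomorphic_map circle (realization (cyc_graph G ds)) h0"
    "\<forall>i<length ds. \<forall>s\<in>{0..1}.
      h0 (cis (2 * pi * ((real i + s) / real (length ds)))) = dpoint G (ds ! i) s"
    "continuous_on UNIV \<psi>" "\<forall>t. h (cis (2 * pi * t)) = h0 (cis (2 * pi * \<psi> t))"
    "\<forall>t. \<psi> (t + 1) = \<psi> t + of_int m" "\<forall>t t'. \<psi> t - \<psi> t' \<in> \<int> \<longrightarrow> t - t' \<in> \<int>"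
proof -
  interpret fin_digraph G by fact
  obtain ds where ds: "cyc G ds" "C = cyc_graph G ds"
    using is_cycle_of_cyc[OF fin cycle] by blast
  obtain h0 where h0: "homeomorphic_map circle (realization C) h0"
    "\<And>i s. i < length ds \<Longrightarrow> s \<in> {0..1} \<Longrightarrow>
      h0 (cis (2 * pi * ((real i + s) / real (length ds)))) = dpoint G (ds ! i) s"
    using cyc_parametrization[OF wf_digraph ds(1)] ds(2) by metis
  obtain k where k: "homeomorphic_maps circle (realization C) h0 k"
    using h0(1) by (auto simp: homeomorphic_map_maps)
  define F where "F t = k (h (cis (2 * pi * t)))" for t
  have kh: "continuous_map circle circle (k \<circ> h)"
    using k h by (intro continuous_map_compose) (auto simp: homeomorphic_eq_everything_map homeomorphic_maps_def)
  then have kh': "continuous_on (sphere 0 1) (k \<circ> h)" "\<And>z. z \<in> sphere 0 1 \<Longrightarrow> (k \<circ> h) z \<in> sphere 0 1"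
    by (auto simp: continuous_map_in_subtopology)
  have h_top: "h z \<in> topspace (realization C)" if "z \<in> sphere 0 1" for z
    using h that by (auto simp: homeomorphic_eq_everything_map)
  have F_norm: "norm (F t) = 1" for t
    using kh'(2)[of "cis (2 * pi * t)"] by (simp add: F_def)
  have F_inj: "t - t' \<in> \<int>" if eq: "F t = F t'" for t t'
  proof -
    have "h (cis (2 * pi * t)) = h (cis (2 * pi * t'))"
      using eq k h_top unfolding F_def homeomorphic_maps_def by (metis mem_sphere_0 norm_cis)
    then have "cis (2 * pi * t) = cis (2 * pi * t')"
      using h by (auto simp: homeomorphic_eq_everything_map inj_on_def)
    then show ?thesis
      by (simp only: cis_2pi_eq_iff)
  qed
  have "continuous_on UNIV ((k \<circ> h) \<circ> (\<lambda>t. cis (2 * pi * t)))"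
    by (intro continuous_on_compose continuous_intros continuous_on_subset[OF kh'(1)]) auto
  then have "continuous_on UNIV F"
    by (simp add: F_def o_def)
  then obtain L where L: "continuous_on UNIV L" "\<And>t. F t = exp (L t)"
    using continuous_logarithm_on_contractible[of UNIV F] F_norm convex_imp_contractible[of "UNIV :: real set"]
    by (metis UNIV_I convex_UNIV norm_zero zero_neq_one)
  define \<psi> where "\<psi> t = Im (L t) / (2 * pi)" for t
  have F_cis: "F t = cis (2 * pi * \<psi> t)" for t
  proof -
    have "exp (Re (L t)) = 1"
      using F_norm[of t] L(2)[of t] by (simp add: norm_exp_eq_Re)
    then show ?thesis
      using L(2)[of t] by (simp add: exp_eq_polar \<psi>_def)
  qed
  have \<psi>_cont: "continuous_on UNIV \<psi>"
    unfolding \<psi>_def by (intro continuous_intros L) auto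
  have "(\<lambda>t. \<psi> (t + 1) - \<psi> t) constant_on UNIV"
  proof (rule continuous_discrete_range_constant)
    show "continuous_on UNIV (\<lambda>t. \<psi> (t + 1) - \<psi> t)"
      by (intro continuous_intros continuous_on_compose2[OF \<psi>_cont]) auto
    have int: "\<psi> (t + 1) - \<psi> t \<in> \<int>" for t
    proof -
      have "F (t + 1) = F t"
        using cis_2pi_eq_iff[of "t + 1" t] by (simp add: F_def)
      then show ?thesis
        unfolding F_cis by (simp only: cis_2pi_eq_iff)
    qed
    show "\<exists>e>0. \<forall>y. y \<in> UNIV \<and> \<psi> (y + 1) - \<psi> y \<noteq> \<psi> (x + 1) - \<psi> x \<longrightarrow>
        e \<le> norm ((\<psi> (y + 1) - \<psi> y) - (\<psi> (x + 1) - \<psi> x))" for x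
    proof (intro exI[of _ 1] conjI allI impI)
      fix y assume "y \<in> UNIV \<and> \<psi> (y + 1) - \<psi> y \<noteq> \<psi> (x + 1) - \<psi> x"
      moreover obtain i j :: int where "\<psi> (y + 1) - \<psi> y = i" "\<psi> (x + 1) - \<psi> x = j"
        using int by (metis Ints_cases)
      ultimately show "1 \<le> norm ((\<psi> (y + 1) - \<psi> y) - (\<psi> (x + 1) - \<psi> x))"
        by (simp flip: of_int_diff of_int_abs)
    qed auto
  qed auto
  then obtain c where c: "\<And>t. \<psi> (t + 1) - \<psi> t = c"
    by (auto simp: constant_on_def)
  have "c \<in> \<int>"
  proof -
    have "F (0 + 1) = F 0"
      using cis_2pi_eq_iff[of "0 + 1" 0] by (simp add: F_def)
    then show ?thesis
      unfolding F_cis using c[of 0] by (simp only: cis_2pi_eq_iff)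
  qed
  then obtain m :: int where m: "c = m"
    by (auto simp: Ints_def)
  show ?thesis
  proof (rule that[of ds h0 \<psi> m])
    show "homeomorphic_map circle (realization (cyc_graph G ds)) h0"
      using h0(1) ds(2) by simp
    show "\<forall>i<length ds. \<forall>s\<in>{0..1}. h0 (cis (2 * pi * ((real i + s) / real (length ds)))) = dpoint G (ds ! i) s"
      using h0(2) by simp
    show "\<forall>t. h (cis (2 * pi * t)) = h0 (cis (2 * pi * \<psi> t))"
    proof
      fix t
      have "h0 (F t) = h (cis (2 * pi * t))"
        using k h_top[of "cis (2 * pi * t)"] by (simp add: F_def homeomorphic_maps_def)
      then show "h (cis (2 * pi * t)) = h0 (cis (2 * pi * \<psi> t))"
        by (simp add: F_cis)
    qed
    show "\<forall>t. \<psi> (t + 1) = \<psi> t + of_int m"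
      using c m by (simp add: diff_eq_eq add.commute)
    show "\<forall>t t'. \<psi> t - \<psi> t' \<in> \<int> \<longrightarrow> t - t' \<in> \<int>"
    proof (intro allI impI)
      fix t t' assume "\<psi> t - \<psi> t' \<in> \<int>"
      then show "t - t' \<in> \<int>"
        by (intro F_inj) (simp only: F_cis cis_2pi_eq_iff)
    qed
    show "cyc G ds" "continuous_on UNIV \<psi>"
      by (rule ds(1), rule \<psi>_cont)
  qed
qed

section \<open>Turning of plane curves\<close>

definition angle_lift :: "(real \<Rightarrow> complex) \<Rightarrow> (real \<Rightarrow> real) \<Rightarrow> real \<Rightarrow> real \<Rightarrow> bool" where
  "angle_lift F \<theta> a b \<longleftrightarrow> continuous_on {a..b} \<theta> \<and> (\<forall>t\<in>{a..b}. sgn (F t) = cis (\<theta> t))"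

text \<open>The total change of a continuous angle. For continuous nonvanishing \<open>F\<close> a
  lift exists and the value does not depend on the chosen one.\<close>

definition turn :: "(real \<Rightarrow> complex) \<Rightarrow> real \<Rightarrow> real \<Rightarrow> real" where
  "turn F a b = (SOME x. \<exists>\<theta>. angle_lift F \<theta> a b \<and> x = \<theta> b - \<theta> a)"

definition nonvanishing :: "(real \<Rightarrow> complex) \<Rightarrow> real \<Rightarrow> real \<Rightarrow> bool" where
  "nonvanishing F a b \<longleftrightarrow> a \<le> b \<and> continuous_on {a..b} F \<and> (\<forall>t\<in>{a..b}. F t \<noteq> 0)"

lemma angle_lift_exists:
  assumes "nonvanishing F a b"
  shows "\<exists>\<theta>. angle_lift F \<theta> a b"
proof -
  obtain L where L: "continuous_on {a..b} L" "\<And>t. t \<in> {a..b} \<Longrightarrow> F t = exp (L t)"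
    using continuous_logarithm_on_contractible[of "{a..b}" F] assms convex_imp_contractible[of "{a..b}"]
    unfolding nonvanishing_def by (metis convex_real_interval(5))
  have "sgn (exp z) = cis (Im z)" for z :: complex
    by (simp add: exp_eq_polar sgn_mult sgn_of_real sgn_cis)
  then have "angle_lift F (\<lambda>t. Im (L t)) a b"
    using L unfolding angle_lift_def by (auto intro!: continuous_intros)
  then show ?thesis
    by blast
qed

text \<open>Two lifts differ by a continuous function with values in the integer multiples of
  2\<pi>, hence by a constant.\<close>

lemma angle_lift_unique:
  assumes "a \<le> b" "angle_lift F \<theta> a b" "angle_lift F \<theta>' a b"
  shows "\<theta> b - \<theta> a = \<theta>' b - \<theta>' a"
proof -
  define k where "k t = (\<theta> t - \<theta>' t) / (2 * pi)" for t
  have int: "k t \<in> \<int>" if "t \<in> {a..b}" for t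
  proof -
    have "cis (2 * pi * (\<theta> t / (2 * pi))) = cis (2 * pi * (\<theta>' t / (2 * pi)))"
      using assms that by (simp add: angle_lift_def)
    then show ?thesis
      by (simp only: cis_2pi_eq_iff k_def diff_divide_distrib)
  qed
  have "k constant_on {a..b}"
  proof (rule continuous_discrete_range_constant)
    show "continuous_on {a..b} k"
      using assms unfolding k_def angle_lift_def by (intro continuous_intros) auto
    show "\<exists>e>0. \<forall>y. y \<in> {a..b} \<and> k y \<noteq> k x \<longrightarrow> e \<le> norm (k y - k x)" if x: "x \<in> {a..b}" for x
    proof (intro exI[of _ 1] conjI allI impI)
      fix y assume y: "y \<in> {a..b} \<and> k y \<noteq> k x"
      obtain i :: int where i: "k y = i"
        using int[of y] y by (auto elim: Ints_cases)
      obtain j :: int where j: "k x = j"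
        using int[OF x] by (auto elim: Ints_cases)
      have "1 \<le> \<bar>i - j\<bar>"
        using y i j by auto
      then show "1 \<le> norm (k y - k x)"
        by (simp add: i j flip: of_int_diff of_int_abs)
    qed auto
  qed auto
  then have "k a = k b"
    using assms(1) by (auto simp: constant_on_def)
  then show ?thesis
    by (simp add: k_def field_simps)
qed

lemma turn_eq:
  assumes "a \<le> b" "angle_lift F \<theta> a b"
  shows "turn F a b = \<theta> b - \<theta> a"
  unfolding turn_def
proof (rule some_equality)
  show "x = \<theta> b - \<theta> a" if "\<exists>\<theta>. angle_lift F \<theta> a b \<and> x = \<theta> b - \<theta> a" for x
    using that angle_lift_unique assms by metis
qed (use assms in blast)

lemma turn_combine:
  assumes "nonvanishing F a c" "a \<le> b" "b \<le> c"
  shows "turn F a c = turn F a b + turn F b c"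
proof -
  obtain \<theta> where \<theta>: "angle_lift F \<theta> a c"
    using angle_lift_exists assms by blast
  then have "angle_lift F \<theta> a b" "angle_lift F \<theta> b c"
    using assms by (auto simp: angle_lift_def intro: continuous_on_subset)
  then show ?thesis
    using \<theta> assms by (simp add: turn_eq)
qed

lemma turn_cong: "(\<And>t. t \<in> {a..b} \<Longrightarrow> F t = H t) \<Longrightarrow> turn F a b = turn H a b"
  by (simp add: turn_def angle_lift_def)

lemma turn_affine:
  assumes "nonvanishing F (m * a + c) (m * b + c)" "0 < m" "a \<le> b"
  shows "turn (\<lambda>t. F (m * t + c)) a b = turn F (m * a + c) (m * b + c)"
proof -
  obtain \<theta> where \<theta>: "angle_lift F \<theta> (m * a + c) (m * b + c)"
    using angle_lift_exists assms by blast
  have "angle_lift (\<lambda>t. F (m * t + c)) (\<lambda>t. \<theta> (m * t + c)) a b"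
    unfolding angle_lift_def
  proof (intro conjI ballI)
    show "continuous_on {a..b} (\<lambda>t. \<theta> (m * t + c))"
    proof (rule continuous_on_compose2[of "{m * a + c..m * b + c}" \<theta> "{a..b}" "\<lambda>t. m * t + c"])
      show "continuous_on {m * a + c..m * b + c} \<theta>"
        using \<theta> by (simp add: angle_lift_def)
    qed (use assms(2) in \<open>auto intro!: continuous_intros\<close>)
    fix t assume "t \<in> {a..b}"
    then have "m * t + c \<in> {m * a + c..m * b + c}"
      using assms(2) by simp
    then show "sgn (F (m * t + c)) = cis (\<theta> (m * t + c))"
      using \<theta> unfolding angle_lift_def by blast
  qed
  then show ?thesis
    using \<theta> assms by (simp add: turn_eq)
qed

lemma turn_reverse:
  assumes "nonvanishing F a b"
  shows "turn (\<lambda>t. F (a + b - t)) a b = - turn F a b"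
proof -
  obtain \<theta> where \<theta>: "angle_lift F \<theta> a b"
    using angle_lift_exists assms by blast
  have "angle_lift (\<lambda>t. F (a + b - t)) (\<lambda>t. \<theta> (a + b - t)) a b"
    unfolding angle_lift_def
  proof (intro conjI ballI)
    show "continuous_on {a..b} (\<lambda>t. \<theta> (a + b - t))"
    proof (rule continuous_on_compose2[of "{a..b}" \<theta> "{a..b}" "\<lambda>t. a + b - t"])
      show "continuous_on {a..b} \<theta>"
        using \<theta> by (simp add: angle_lift_def)
    qed (auto intro!: continuous_intros)
    fix t assume "t \<in> {a..b}"
    then have "a + b - t \<in> {a..b}"
      by simp
    then show "sgn (F (a + b - t)) = cis (\<theta> (a + b - t))"
      using \<theta> unfolding angle_lift_def by blast
  qed
  then show ?thesis
    using \<theta> assms by (simp add: turn_eq nonvanishing_def)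
qed

lemma turn_uminus:
  assumes "nonvanishing F a b"
  shows "turn (\<lambda>t. - F t) a b = turn F a b"
proof -
  obtain \<theta> where \<theta>: "angle_lift F \<theta> a b"
    using angle_lift_exists assms by blast
  have "angle_lift (\<lambda>t. - F t) (\<lambda>t. \<theta> t + pi) a b"
    using \<theta> unfolding angle_lift_def by (auto simp: sgn_minus simp flip: cis_mult intro!: continuous_intros)
  then show ?thesis
    using \<theta> assms by (simp add: turn_eq nonvanishing_def)
qed

text \<open>Modulo 2\<pi> a turn is determined by the directions at the two ends; this is the source
  of the integers of an odd system.\<close>

lemma turn_mod_2pi:
  assumes "nonvanishing F a b" "sgn (F a) = cis \<alpha>" "sgn (F b) = cis \<beta>"
  shows "\<exists>k::int. turn F a b = \<beta> - \<alpha> + 2 * pi * k"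
proof -
  obtain \<theta> where \<theta>: "angle_lift F \<theta> a b"
    using angle_lift_exists assms by blast
  have ab: "a \<le> b"
    using assms by (simp add: nonvanishing_def)
  have "cis (2 * pi * (\<theta> a / (2 * pi))) = cis (2 * pi * (\<alpha> / (2 * pi)))"
      "cis (2 * pi * (\<theta> b / (2 * pi))) = cis (2 * pi * (\<beta> / (2 * pi)))"
    using assms \<theta> ab by (auto simp: angle_lift_def)
  then have "\<theta> a / (2 * pi) - \<alpha> / (2 * pi) \<in> \<int>" "\<theta> b / (2 * pi) - \<beta> / (2 * pi) \<in> \<int>"
    by (simp_all only: cis_2pi_eq_iff)
  then obtain i j :: int where "\<theta> a / (2 * pi) - \<alpha> / (2 * pi) = i" "\<theta> b / (2 * pi) - \<beta> / (2 * pi) = j"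
    by (metis Ints_cases)
  then have "\<theta> a = \<alpha> + 2 * pi * i" "\<theta> b = \<beta> + 2 * pi * j"
    by (simp_all add: field_simps)
  then show ?thesis
    using \<theta> ab by (intro exI[of _ "j - i"]) (simp add: turn_eq algebra_simps)
qed

text \<open>The normalized curve is the exponential of an imaginary path, whose winding number is
  the displacement of that path.\<close>

lemma winding_number_sgn:
  assumes "angle_lift F \<theta> 0 1"
  shows "winding_number (\<lambda>t. sgn (F t)) 0 = of_real ((\<theta> 1 - \<theta> 0) / (2 * pi))"
proof -
  define p where "p t = \<i> * complex_of_real (\<theta> t)" for t
  have "path p"
    using assms unfolding p_def path_def angle_lift_def by (intro continuous_intros) auto
  then have "winding_number (exp \<circ> p) 0 = (pathfinish p - pathstart p) / (2 * of_real pi * \<i>)"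
    by (rule winding_number_compose_exp)
  also have "\<dots> = of_real ((\<theta> 1 - \<theta> 0) / (2 * pi))"
    by (simp add: p_def pathfinish_def pathstart_def field_simps)
  also have "winding_number (exp \<circ> p) 0 = winding_number (\<lambda>t. sgn (F t)) 0"
    using assms by (intro winding_number_cong) (auto simp: p_def angle_lift_def cis_conv_exp)
  finally show ?thesis .
qed

lemma has_rotation_number_0_turn:
  assumes "has_rotation_number c 0" "continuous_on UNIV c"
  shows "\<forall>\<^sub>F \<epsilon> in at_right 0. (\<forall>t. c (t + \<epsilon>) \<noteq> c t) \<and> turn (\<lambda>t. c (t + \<epsilon>) - c t) 0 1 = 0"
  using assms(1) unfolding has_rotation_number_def
proof eventually_elim
  case (elim \<epsilon>)
  then have nv: "nonvanishing (\<lambda>t. c (t + \<epsilon>) - c t) 0 1"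
    unfolding nonvanishing_def
    by (auto intro!: continuous_intros continuous_on_compose2[OF assms(2)])
  then obtain \<theta> where \<theta>: "angle_lift (\<lambda>t. c (t + \<epsilon>) - c t) \<theta> 0 1"
    using angle_lift_exists by blast
  then have "complex_of_real ((\<theta> 1 - \<theta> 0) / (2 * pi)) = 0"
    using elim winding_number_sgn[OF \<theta>] by simp
  then show ?case
    using elim \<theta> by (simp add: turn_eq flip: of_real_diff)
qed

lemma has_rotation_number_0I:
  assumes "\<forall>\<^sub>F \<epsilon> in at_right 0. (\<forall>t. c (t + \<epsilon>) \<noteq> c t) \<and>
    (\<exists>\<theta>. angle_lift (\<lambda>t. c (t + \<epsilon>) - c t) \<theta> 0 1 \<and> \<theta> 1 = \<theta> 0)"
  shows "has_rotation_number c 0"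
  using assms unfolding has_rotation_number_def
  by eventually_elim (use winding_number_sgn in fastforce)

lemma filterlim_at_right_divide:
  assumes "0 < (r::real)"
  shows "filterlim (\<lambda>x. x / r) (at_right 0) (at_right 0)"
  unfolding filterlim_iff
proof (intro allI impI)
  fix P :: "real \<Rightarrow> bool" assume "eventually P (at_right 0)"
  then obtain b where b: "b > 0" "\<And>y. 0 < y \<Longrightarrow> y < b \<Longrightarrow> P y"
    unfolding eventually_at_right_field by auto
  show "\<forall>\<^sub>F x in at_right 0. P (x / r)"
    unfolding eventually_at_right_field
    using b assms by (intro exI[of _ "b * r"]) (auto simp: divide_less_eq)
qed

lemma turn_sum:
  assumes "nonvanishing F 0 (real n * r)" "0 \<le> r"
  shows "turn F 0 (real n * r) = (\<Sum>i<n. turn F (real i * r) (real (Suc i) * r))"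
  using assms(1)
proof (induction n)
  case 0
  then have "turn F 0 0 = turn F 0 0 + turn F 0 0"
    by (intro turn_combine) auto
  then show ?case
    by simp
next
  case (Suc n)
  have "real n * r \<le> real (Suc n) * r"
    using assms(2) by (intro mult_right_mono) auto
  then have "nonvanishing F 0 (real n * r)"
    using Suc.prems assms(2) unfolding nonvanishing_def by (auto intro: continuous_on_subset)
  then have "turn F 0 (real n * r) = (\<Sum>i<n. turn F (real i * r) (real (Suc i) * r))"
    by (rule Suc.IH)
  moreover have "turn F 0 (real (Suc n) * r) = turn F 0 (real n * r) + turn F (real n * r) (real (Suc n) * r)"
    using Suc.prems assms(2) \<open>real n * r \<le> real (Suc n) * r\<close> by (intro turn_combine) auto
  ultimately show ?case
    by simp
qed

text \<open>The period is cut at the corners and at the parameters where the secant begins to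
  straddle a corner: between the cuts, the two ends of the secant lie on the same piece or on
  consecutive ones. Rescaling by \<open>n\<close> turns the step \<epsilon>/n of the curve into the
  step \<epsilon> on a piece.\<close>

lemma turn_secant_pieces:
  fixes c :: "real \<Rightarrow> complex"
  assumes cont: "continuous_on UNIV c" and periodic: "\<And>t. c (t + 1) = c t"
    and n: "0 < n" and \<epsilon>: "0 < \<epsilon>" "\<epsilon> < 1" and nv: "\<And>t. c (t + \<epsilon> / real n) \<noteq> c t"
    and cs: "\<And>i s. i < n \<Longrightarrow> s \<in> {0..1} \<Longrightarrow> c ((real i + s) / real n) = g i s"
  shows "turn (\<lambda>t. c (t + \<epsilon> / real n) - c t) 0 1 =
    (\<Sum>i<n. turn (\<lambda>s. g i (s + \<epsilon>) - g i s) 0 (1 - \<epsilon>) +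
      turn (\<lambda>s. g (Suc i mod n) s - g i (1 - (\<epsilon> - s))) 0 \<epsilon>)"
proof -
  define F where "F t = c (t + \<epsilon> / n) - c t" for t
  have F_nv: "nonvanishing F a b" if "a \<le> b" for a b
    unfolding nonvanishing_def F_def using nv that
    by (auto intro!: continuous_intros continuous_on_compose2[OF cont])
  have cs': "c ((real i + 1 + s) / n) = g (Suc i mod n) s" if "i < n" "s \<in> {0..1}" for i s
  proof (cases "Suc i = n")
    case True
    have "real i + 1 = real n"
      using True by linarith
    then have "(real i + 1 + s) / n = s / n + 1"
      using n by (simp add: add_divide_distrib)
    then have "c ((real i + 1 + s) / n) = c (s / n + 1)"
      by (rule arg_cong)
    also have "\<dots> = g 0 s"
      unfolding periodic using cs[of 0 s] n that by simp
    finally show ?thesis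
      using True by simp
  next
    case False
    then show ?thesis
      using cs[of "Suc i" s] that by (simp add: add_ac)
  qed
  have piece: "turn F (real i * (1 / n)) (real (Suc i) * (1 / n)) =
      turn (\<lambda>s. g i (s + \<epsilon>) - g i s) 0 (1 - \<epsilon>) + turn (\<lambda>s. g (Suc i mod n) s - g i (1 - (\<epsilon> - s))) 0 \<epsilon>"
    if i: "i < n" for i
  proof -
    have "turn F (1 / n * 0 + i / n) (1 / n * (1 - \<epsilon>) + i / n) = turn (\<lambda>s. F (1 / n * s + i / n)) 0 (1 - \<epsilon>)"
      using n \<epsilon> by (intro turn_affine[symmetric] F_nv) (auto simp: field_simps)
    also have "\<dots> = turn (\<lambda>s. g i (s + \<epsilon>) - g i s) 0 (1 - \<epsilon>)"
    proof (rule turn_cong)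
      fix s assume s: "s \<in> {0..1 - \<epsilon>}"
      have "1 / n * s + i / n + \<epsilon> / n = (real i + (s + \<epsilon>)) / n" "1 / n * s + i / n = (real i + s) / n"
        by (simp_all add: add_divide_distrib)
      then show "F (1 / n * s + i / n) = g i (s + \<epsilon>) - g i s"
        using cs[OF i, of s] cs[OF i, of "s + \<epsilon>"] s \<epsilon> by (simp add: F_def)
    qed
    finally have 1: "turn F (1 / n * 0 + i / n) (1 / n * (1 - \<epsilon>) + i / n) = turn (\<lambda>s. g i (s + \<epsilon>) - g i s) 0 (1 - \<epsilon>)" .
    have "turn F (1 / n * 0 + (i + 1 - \<epsilon>) / n) (1 / n * \<epsilon> + (i + 1 - \<epsilon>) / n) = turn (\<lambda>s. F (1 / n * s + (i + 1 - \<epsilon>) / n)) 0 \<epsilon>"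
      using n \<epsilon> by (intro turn_affine[symmetric] F_nv) (auto simp: field_simps)
    also have "\<dots> = turn (\<lambda>s. g (Suc i mod n) s - g i (1 - (\<epsilon> - s))) 0 \<epsilon>"
    proof (rule turn_cong)
      fix s assume s: "s \<in> {0..\<epsilon>}"
      have "1 / n * s + (i + 1 - \<epsilon>) / n + \<epsilon> / n = (real i + 1 + s) / n"
          "1 / n * s + (i + 1 - \<epsilon>) / n = (real i + (1 - (\<epsilon> - s))) / n"
        by (simp_all add: add_divide_distrib diff_divide_distrib)
      then show "F (1 / n * s + (i + 1 - \<epsilon>) / n) = g (Suc i mod n) s - g i (1 - (\<epsilon> - s))"
        using cs[OF i, of "1 - (\<epsilon> - s)"] cs'[OF i, of s] s \<epsilon> by (simp add: F_def)
    qed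
    finally have 2: "turn F (1 / n * 0 + (i + 1 - \<epsilon>) / n) (1 / n * \<epsilon> + (i + 1 - \<epsilon>) / n) =
      turn (\<lambda>s. g (Suc i mod n) s - g i (1 - (\<epsilon> - s))) 0 \<epsilon>" .
    have "turn F (i / n) ((i + 1) / n) = turn F (i / n) ((i + 1 - \<epsilon>) / n) + turn F ((i + 1 - \<epsilon>) / n) ((i + 1) / n)"
      using \<epsilon> n by (intro turn_combine F_nv) (auto simp: divide_right_mono)
    also have "turn F (i / n) ((i + 1 - \<epsilon>) / n) = turn (\<lambda>s. g i (s + \<epsilon>) - g i s) 0 (1 - \<epsilon>)"
      using 1 by (simp add: add_divide_distrib diff_divide_distrib algebra_simps)
    also have "turn F ((i + 1 - \<epsilon>) / n) ((i + 1) / n) = turn (\<lambda>s. g (Suc i mod n) s - g i (1 - (\<epsilon> - s))) 0 \<epsilon>"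
      using 2 by (simp add: add_divide_distrib diff_divide_distrib algebra_simps)
    finally show ?thesis
      by (simp add: algebra_simps)
  qed
  have "turn F 0 1 = turn F 0 (real n * (1 / n))"
    using n by simp
  also have "\<dots> = (\<Sum>i<n. turn F (real i * (1 / n)) (real (Suc i) * (1 / n)))"
    using n by (intro turn_sum F_nv) auto
  also have "\<dots> = (\<Sum>i<n. turn (\<lambda>s. g i (s + \<epsilon>) - g i s) 0 (1 - \<epsilon>) +
      turn (\<lambda>s. g (Suc i mod n) s - g i (1 - (\<epsilon> - s))) 0 \<epsilon>)"
    by (intro sum.cong piece) auto
  finally show ?thesis
    by (simp add: F_def[abs_def])
qed

section \<open>From vanishing rotation numbers to odd systems\<close>

text \<open>\<delta> is a Lebesgue number for the cover of the interval by preimages of open sets on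
  which \<open>f\<close> is injective. Requiring \<open>p s \<noteq> p t\<close> admits curves that
  return to a point, such as loops.\<close>

lemma locally_injective_curve:
  fixes a b :: real
  assumes inj: "locally_injective X f" and p: "continuous_map (top_of_set {a..b}) X p"
  shows "\<exists>\<delta>>0. \<forall>s\<in>{a..b}. \<forall>t\<in>{a..b}. \<bar>s - t\<bar> < \<delta> \<and> p s \<noteq> p t \<longrightarrow> f (p s) \<noteq> f (p t)"
proof -
  have "\<exists>V. open V \<and> s \<in> V \<and> inj_on f (p ` ({a..b} \<inter> V))" if s: "s \<in> {a..b}" for s :: real
  proof -
    have "p s \<in> topspace X"
      using p s by (auto simp: continuous_map_def)
    then obtain U where U: "openin X U" "p s \<in> U" "inj_on f U"
      using inj by (auto simp: locally_injective_def)
    have "openin (top_of_set {a..b}) {t \<in> {a..b}. p t \<in> U}"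
      using p U(1) by (auto simp: continuous_map_def)
    then obtain V where V: "open V" "{t \<in> {a..b}. p t \<in> U} = {a..b} \<inter> V"
      by (auto simp: openin_open)
    have VU: "t \<in> V \<longleftrightarrow> p t \<in> U" if "t \<in> {a..b}" for t
      using V(2) that by blast
    then have "p ` ({a..b} \<inter> V) \<subseteq> U"
      by auto
    then have "inj_on f (p ` ({a..b} \<inter> V))"
      by (rule inj_on_subset[OF U(3)])
    then show ?thesis
      using V(1) VU[OF s] U(2) by blast
  qed
  then have "\<forall>s\<in>{a..b}. \<exists>V. open V \<and> s \<in> V \<and> inj_on f (p ` ({a..b} \<inter> V))"
    by blast
  then obtain V where V: "\<And>s. s \<in> {a..b} \<Longrightarrow> open (V s) \<and> s \<in> V s \<and> inj_on f (p ` ({a..b} \<inter> V s))"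
    by (auto simp del: atLeastAtMost_iff dest!: bchoice)
  have cover: "{a..b} \<subseteq> \<Union> (V ` {a..b})"
    using V by blast
  obtain \<delta> where \<delta>: "0 < \<delta>" "\<And>x. x \<in> {a..b} \<Longrightarrow> \<exists>G\<in>V ` {a..b}. ball x \<delta> \<subseteq> G"
    by (rule Heine_Borel_lemma[OF compact_Icc cover]) (use V in auto)
  show ?thesis
  proof (intro exI[of _ \<delta>] conjI ballI impI)
    fix s t assume st: "s \<in> {a..b}" "t \<in> {a..b}" "\<bar>s - t\<bar> < \<delta> \<and> p s \<noteq> p t"
    obtain x where x: "x \<in> {a..b}" "ball s \<delta> \<subseteq> V x"
      using \<delta>(2)[OF st(1)] by blast
    have "s \<in> V x" "t \<in> V x"
      using x st \<delta>(1) by (auto simp: dist_real_def subset_iff)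
    then show "f (p s) \<noteq> f (p t)"
      using V[OF x(1)] st by (auto simp: inj_on_def)
  qed (use \<delta> in auto)
qed

lemma continuous_map_dpoint:
  assumes "wf_digraph G" "d \<in> darts G"
  shows "continuous_map (top_of_set {0..1}) (realization G) (dpoint G d)"
proof -
  have "continuous_map (top_of_set {0..1}) (top_of_set {0..1}) (\<lambda>s::real. if snd d then s else 1 - s)"
    by (cases "snd d") (auto simp: continuous_map_in_subtopology intro!: continuous_intros)
  then have "continuous_map (top_of_set {0..1}) (realization G)
      (edge_map G (fst d) \<circ> (\<lambda>s. if snd d then s else 1 - s))"
    using assms by (intro continuous_map_compose[OF _ continuous_map_edge_map]) (auto simp: darts_def)
  then show ?thesis
    by (simp add: dpoint_def[abs_def] o_def)
qed

text \<open>The delicate case is a loop, whose two darts run over the same edge from both ends; the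
  bound \<epsilon> < 1 keeps the points apart.\<close>

lemma dpoint_neq:
  assumes "0 < \<epsilon>" "\<epsilon> < 1"
  shows "s \<in> {0..1 - \<epsilon>} \<Longrightarrow> dpoint G d (s + \<epsilon>) \<noteq> dpoint G d s"
    and "d \<noteq> d' \<Longrightarrow> s \<in> {0..\<epsilon>} \<Longrightarrow> dpoint G d' s \<noteq> dpoint G d (\<epsilon> - s)"
  using assms by (auto simp: dpoint_def edge_map_def prod_eq_iff)

text \<open>These are the two kinds of secants of a cycle, along an edge and around a corner. A
  Lebesgue number handles each edge, an injectivity neighbourhood of the vertex handles each corner,
  and there are finitely many of both.\<close>

lemma eventually_dpoint_injective:
  assumes fin: "fin_digraph G" and inj: "locally_injective (realization G) f"
  shows "\<forall>\<^sub>F \<epsilon> in at_right 0.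
    (\<forall>d\<in>darts G. \<forall>s\<in>{0..1 - \<epsilon>}. f (dpoint G d (s + \<epsilon>)) \<noteq> f (dpoint G d s)) \<and>
    (\<forall>d\<in>darts G. \<forall>d'\<in>darts G. d \<noteq> d' \<and> dstart G d = dstart G d' \<longrightarrow>
      (\<forall>s\<in>{0..\<epsilon>}. f (dpoint G d' s) \<noteq> f (dpoint G d (\<epsilon> - s))))"
proof -
  interpret fin_digraph G by fact
  have fin_d: "finite (darts G)"
    by (simp add: darts_def)
  have small: "\<forall>\<^sub>F \<epsilon> in at_right (0::real). 0 < \<epsilon> \<and> \<epsilon> < 1"
    using eventually_at_right_less[of "0::real"] eventually_at_right_real[of 0 1] by auto
  have 1: "\<forall>\<^sub>F \<epsilon> in at_right 0. \<forall>d\<in>darts G. \<forall>s\<in>{0..1 - \<epsilon>}. f (dpoint G d (s + \<epsilon>)) \<noteq> f (dpoint G d s)"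
  proof (rule eventually_ball_finite[OF fin_d], rule ballI)
    fix d assume d: "d \<in> darts G"
    obtain \<delta> where \<delta>: "\<delta> > 0" "\<And>s t. s \<in> {0..1} \<Longrightarrow> t \<in> {0..1} \<Longrightarrow> \<bar>s - t\<bar> < \<delta> \<Longrightarrow>
        dpoint G d s \<noteq> dpoint G d t \<Longrightarrow> f (dpoint G d s) \<noteq> f (dpoint G d t)"
      using locally_injective_curve[OF inj continuous_map_dpoint[OF wf_digraph d]] by metis
    have "\<forall>\<^sub>F \<epsilon> in at_right 0. \<epsilon> < \<delta>"
      using eventually_at_right_real[OF \<delta>(1)] by eventually_elim auto
    then show "\<forall>\<^sub>F \<epsilon> in at_right 0. \<forall>s\<in>{0..1 - \<epsilon>}. f (dpoint G d (s + \<epsilon>)) \<noteq> f (dpoint G d s)"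
      using small
    proof eventually_elim
      case (elim \<epsilon>)
      show ?case
      proof
        fix s assume s: "s \<in> {0..1 - \<epsilon>}"
        show "f (dpoint G d (s + \<epsilon>)) \<noteq> f (dpoint G d s)"
          using elim s by (intro \<delta>(2) dpoint_neq(1)) auto
      qed
    qed
  qed
  have 2: "\<forall>\<^sub>F \<epsilon> in at_right 0. \<forall>d\<in>darts G. \<forall>d'\<in>darts G. d \<noteq> d' \<and> dstart G d = dstart G d' \<longrightarrow>
      (\<forall>s\<in>{0..\<epsilon>}. f (dpoint G d' s) \<noteq> f (dpoint G d (\<epsilon> - s)))"
  proof (rule eventually_ball_finite[OF fin_d], rule ballI, rule eventually_ball_finite[OF fin_d], rule ballI)
    fix d d' assume d: "d \<in> darts G" "d' \<in> darts G"
    show "\<forall>\<^sub>F \<epsilon> in at_right 0. d \<noteq> d' \<and> dstart G d = dstart G d' \<longrightarrow>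
      (\<forall>s\<in>{0..\<epsilon>}. f (dpoint G d' s) \<noteq> f (dpoint G d (\<epsilon> - s)))"
    proof (cases "d \<noteq> d' \<and> dstart G d = dstart G d'")
      case True
      have "Vertex (dstart G d) \<in> topspace (realization G)"
        using d dstart_in_verts by (auto simp: topspace_realization gpoints_def)
      then obtain U where U: "openin (realization G) U" "Vertex (dstart G d) \<in> U" "inj_on f U"
        using inj by (auto simp: locally_injective_def)
      have near: "\<forall>\<^sub>F \<epsilon> in at_right 0. \<forall>s\<in>{0..\<epsilon>}. dpoint G x s \<in> U"
        if x: "x \<in> darts G" "dstart G x = dstart G d" for x
      proof -
        have "openin (top_of_set {0..1}) {t \<in> {0..1}. dpoint G x t \<in> U}"
          using continuous_map_dpoint[OF wf_digraph x(1)] U(1) by (auto simp: continuous_map_def)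
        then obtain V where V: "open V" "{t \<in> {0..1}. dpoint G x t \<in> U} = {0..1} \<inter> V"
          by (auto simp: openin_open)
        have "0 \<in> {t \<in> {0..1}. dpoint G x t \<in> U}"
          using U(2) x(2) by (simp add: dpoint_simps)
        then have "0 \<in> V"
          using V(2) by blast
        then obtain r where r: "r > 0" "ball 0 r \<subseteq> V"
          using V(1) open_contains_ball by blast
        have "\<forall>\<^sub>F \<epsilon> in at_right 0. \<epsilon> < min r 1"
          using eventually_at_right_real[of 0 "min r 1"] r by (auto elim: eventually_mono)
        then show ?thesis
        proof eventually_elim
          case (elim \<epsilon>)
          show ?case
          proof
            fix s assume "s \<in> {0..\<epsilon>}"
            then have "s \<in> {0..1} \<inter> V"
              using elim r(2) by (auto simp: dist_real_def subset_iff)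
            then show "dpoint G x s \<in> U"
              using V(2) by blast
          qed
        qed
      qed
      have dn: "\<forall>\<^sub>F \<epsilon> in at_right 0. \<forall>s\<in>{0..\<epsilon>}. dpoint G d s \<in> U"
        "\<forall>\<^sub>F \<epsilon> in at_right 0. \<forall>s\<in>{0..\<epsilon>}. dpoint G d' s \<in> U"
        using near d True by auto
      from small dn show ?thesis
      proof eventually_elim
        case (elim \<epsilon>)
        show ?case
        proof (intro impI ballI)
          fix s assume s: "s \<in> {0..\<epsilon>}"
          then have "dpoint G d' s \<noteq> dpoint G d (\<epsilon> - s)"
            using elim True by (intro dpoint_neq(2)) auto
          moreover have "dpoint G d' s \<in> U" "dpoint G d (\<epsilon> - s) \<in> U"
            using elim s by auto
          ultimately show "f (dpoint G d' s) \<noteq> f (dpoint G d (\<epsilon> - s))"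
            using U(3) by (auto simp: inj_on_def)
        qed
      qed
    qed auto
  qed
  from 1 2 show ?thesis
    by (rule eventually_conj)
qed

lemma cycle_curve_periodic: "cycle_curve f h (t + 1) = cycle_curve f h t"
  using cis_2pi_eq_iff[of "t + 1" t] by (simp add: cycle_curve_def)

lemma continuous_cycle_curve:
  assumes "subgraph C G" and f: "continuous_map (realization G) euclidean f"
    and h: "homeomorphic_map circle (realization C) h"
  shows "continuous_on UNIV (cycle_curve f h)"
proof -
  have "continuous_map circle (realization C) h"
    using h by (auto simp: homeomorphic_eq_everything_map)
  then have "continuous_map circle euclidean (f \<circ> ((\<lambda>x. x) \<circ> h))"
    using continuous_map_realization_subgraph[OF assms(1)] f by (intro continuous_map_compose)
  then have "continuous_on (sphere 0 1) (f \<circ> h)"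
    by (simp add: o_def)
  then have "continuous_on UNIV ((f \<circ> h) \<circ> (\<lambda>t. cis (2 * pi * t)))"
    by (intro continuous_on_compose continuous_intros) (auto elim: continuous_on_subset)
  then show ?thesis
    by (simp add: cycle_curve_def[abs_def] o_def)
qed

lemma sum_cyclic_shift: "(\<Sum>i<n. (f (Suc i mod n) :: 'a::comm_monoid_add)) = (\<Sum>i<n. f i)"
proof (cases n)
  case (Suc m)
  have "(\<Sum>i<n. f (Suc i mod n)) = (\<Sum>i<m. f (Suc i mod n)) + f 0"
    by (simp add: Suc)
  also have "(\<Sum>i<m. f (Suc i mod n)) = (\<Sum>i<m. f (Suc i))"
    by (rule sum.cong) (auto simp: Suc)
  also have "\<dots> + f 0 = (\<Sum>i<n. f i)"
    by (simp add: Suc sum.lessThan_Suc_shift add.commute del: sum.lessThan_Suc)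
  finally show ?thesis .
qed auto

text \<open>
  The direction of the secant of length \<open>\<epsilon>\<close> turns by an odd multiple of \<open>\<pi>\<close> along every edge and at
  every corner, up to the angles of the first secants of the darts, which cancel along a cycle.
\<close>

lemma odd_system_of_rotation_free:
  fixes G :: "('v, 'e) pre_digraph"
  assumes fin: "fin_digraph G" and f: "plane_immersion G f"
    and rot: "\<And>C h. is_cycle_of C G \<Longrightarrow> homeomorphic_map circle (realization C) h \<Longrightarrow>
      has_rotation_number (cycle_curve f h) 0"
  shows "\<exists>k c. odd_system G k c"
proof -
  interpret fin_digraph G by fact
  have f_cont: "continuous_map (realization G) euclidean f" and f_inj: "locally_injective (realization G) f"
    using f by (auto simp: plane_immersion_def)
  define g where "g d s = f (dpoint G d s)" for d s
  have g_cont: "continuous_on {0..1} (g d)" if "d \<in> darts G" for d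
  proof -
    have "continuous_map (top_of_set {0..1}) euclidean (f \<circ> dpoint G d)"
      using continuous_map_dpoint[OF wf_digraph that] f_cont by (rule continuous_map_compose)
    then show ?thesis
      by (simp add: g_def o_def)
  qed
  have g_rev: "g (rev_dart d) s = g d (1 - s)" for d s
    by (simp add: g_def dpoint_rev)
  have g_start: "g d 0 = f (Vertex (dstart G d))" for d
    by (simp add: g_def dpoint_simps)
  have cyc_curve: "\<exists>h. is_cycle_of (cyc_graph G ds) G \<and> homeomorphic_map circle (realization (cyc_graph G ds)) h \<and>
      (\<forall>i<length ds. \<forall>s\<in>{0..1}. cycle_curve f h ((real i + s) / real (length ds)) = g (ds ! i) s)"
    if ds: "cyc G ds" for ds
  proof -
    obtain h where h: "homeomorphic_map circle (realization (cyc_graph G ds)) h"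
      "\<And>i s. i < length ds \<Longrightarrow> s \<in> {0..1} \<Longrightarrow>
      h (cis (2 * pi * ((real i + s) / real (length ds)))) = dpoint G (ds ! i) s"
      using cyc_parametrization[OF wf_digraph ds] by metis
    moreover have "is_cycle_of (cyc_graph G ds) G"
      using subgraph_cyc_graph[OF wf_digraph ds] h(1) homeomorphic_space homeomorphic_space_sym
      unfolding is_cycle_of_def by blast
    ultimately show ?thesis
      by (intro exI[of _ h]) (auto simp: cycle_curve_def g_def)
  qed
  then obtain h where h: "\<And>ds. cyc G ds \<Longrightarrow> is_cycle_of (cyc_graph G ds) G"
    "\<And>ds. cyc G ds \<Longrightarrow> homeomorphic_map circle (realization (cyc_graph G ds)) (h ds)"
    "\<And>ds i s. cyc G ds \<Longrightarrow> i < length ds \<Longrightarrow> s \<in> {0..1} \<Longrightarrow>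
      cycle_curve f (h ds) ((real i + s) / real (length ds)) = g (ds ! i) s"
    by metis
  define c where "c ds = cycle_curve f (h ds)" for ds
  have c_periodic: "c ds (t + 1) = c ds t" for ds t
    unfolding c_def by (rule cycle_curve_periodic)
  have c_cont: "continuous_on UNIV (c ds)" if ds: "cyc G ds" for ds
    unfolding c_def by (rule continuous_cycle_curve[OF subgraph_cyc_graph[OF wf_digraph ds] f_cont h(2)[OF ds]])
  have c_rot: "\<forall>\<^sub>F \<epsilon> in at_right 0. (\<forall>t. c ds (t + \<epsilon>) \<noteq> c ds t) \<and> turn (\<lambda>t. c ds (t + \<epsilon>) - c ds t) 0 1 = 0"
    if "cyc G ds" for ds
    using has_rotation_number_0_turn[OF rot[OF h(1,2)[OF that]]] c_cont[OF that] by (simp add: c_def)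
  \<comment> \<open>There are finitely many cycles, so one \<epsilon> serves them all. The parameter
    of a cycle gives each of its \<open>n\<close> edges the length 1/n, so a step \<epsilon> on an
    edge is a step \<epsilon>/n on the cycle.\<close>
  have ev1: "\<forall>\<^sub>F \<epsilon> in at_right 0. \<forall>ds\<in>{ds. cyc G ds}. (\<forall>t. c ds (t + \<epsilon> / length ds) \<noteq> c ds t) \<and>
      turn (\<lambda>t. c ds (t + \<epsilon> / length ds) - c ds t) 0 1 = 0"
  proof (rule eventually_ball_finite)
    have "{ds. cyc G ds} \<subseteq> {ds. set ds \<subseteq> darts G \<and> distinct ds}"
      by (auto simp: cyc_def distinct_map)
    then show "finite {ds. cyc G ds}"
      by (rule finite_subset) (simp add: finite_subset_distinct darts_def)
    show "\<forall>ds\<in>{ds. cyc G ds}. \<forall>\<^sub>F \<epsilon> in at_right 0. (\<forall>t. c ds (t + \<epsilon> / length ds) \<noteq> c ds t) \<and>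
      turn (\<lambda>t. c ds (t + \<epsilon> / length ds) - c ds t) 0 1 = 0"
    proof
      fix ds assume "ds \<in> {ds. cyc G ds}"
      then have ds: "cyc G ds" "0 < length ds"
        by (auto simp: cyc_def)
      have "filterlim (\<lambda>\<epsilon>. \<epsilon> / real (length ds)) (at_right 0) (at_right 0)"
        using ds(2) by (intro filterlim_at_right_divide) simp
      from eventually_compose_filterlim[OF c_rot[OF ds(1)] this]
      show "\<forall>\<^sub>F \<epsilon> in at_right 0. (\<forall>t. c ds (t + \<epsilon> / length ds) \<noteq> c ds t) \<and>
        turn (\<lambda>t. c ds (t + \<epsilon> / length ds) - c ds t) 0 1 = 0" .
    qed
  qed
  have ev2: "\<forall>\<^sub>F \<epsilon> in at_right (0::real). 0 < \<epsilon> \<and> \<epsilon> < 1"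
    using eventually_at_right_less[of "0::real"] eventually_at_right_real[of 0 1] by auto
  have "\<forall>\<^sub>F \<epsilon> in at_right 0. (0 < \<epsilon> \<and> \<epsilon> < 1) \<and>
    ((\<forall>d\<in>darts G. \<forall>s\<in>{0..1 - \<epsilon>}. f (dpoint G d (s + \<epsilon>)) \<noteq> f (dpoint G d s)) \<and>
    (\<forall>d\<in>darts G. \<forall>d'\<in>darts G. d \<noteq> d' \<and> dstart G d = dstart G d' \<longrightarrow>
      (\<forall>s\<in>{0..\<epsilon>}. f (dpoint G d' s) \<noteq> f (dpoint G d (\<epsilon> - s))))) \<and>
    (\<forall>ds\<in>{ds. cyc G ds}. (\<forall>t. c ds (t + \<epsilon> / length ds) \<noteq> c ds t) \<and>
      turn (\<lambda>t. c ds (t + \<epsilon> / length ds) - c ds t) 0 1 = 0)"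
    by (rule eventually_conj[OF ev2 eventually_conj[OF eventually_dpoint_injective[OF fin f_inj] ev1]])
  from eventually_happens'[OF trivial_limit_at_right_real this] obtain \<epsilon> :: real where \<epsilon>: "0 < \<epsilon>" "\<epsilon> < 1"
    and E1: "\<forall>d\<in>darts G. \<forall>s\<in>{0..1 - \<epsilon>}. f (dpoint G d (s + \<epsilon>)) \<noteq> f (dpoint G d s)"
    and E2: "\<forall>d\<in>darts G. \<forall>d'\<in>darts G. d \<noteq> d' \<and> dstart G d = dstart G d' \<longrightarrow>
      (\<forall>s\<in>{0..\<epsilon>}. f (dpoint G d' s) \<noteq> f (dpoint G d (\<epsilon> - s)))"
    and E3: "\<forall>ds\<in>{ds. cyc G ds}. (\<forall>t. c ds (t + \<epsilon> / length ds) \<noteq> c ds t) \<and>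
      turn (\<lambda>t. c ds (t + \<epsilon> / length ds) - c ds t) 0 1 = 0"
    by (elim exE conjE) (rule that)
  have e1: "g d (s + \<epsilon>) \<noteq> g d s" if "d \<in> darts G" "s \<in> {0..1 - \<epsilon>}" for d s
    unfolding g_def using E1 that by blast
  have e2: "g d' s \<noteq> g d (\<epsilon> - s)"
    if "d \<in> darts G" "d' \<in> darts G" "d \<noteq> d'" "dstart G d = dstart G d'" "s \<in> {0..\<epsilon>}" for d d' s
    unfolding g_def using E2[rule_format, OF that(1,2) conjI[OF that(3,4)] that(5)] .
  have e3: "c ds (t + \<epsilon> / length ds) \<noteq> c ds t" "turn (\<lambda>t. c ds (t + \<epsilon> / length ds) - c ds t) 0 1 = 0"
    if "cyc G ds" for ds t
    using E3 that by auto
  \<comment> \<open>The direction of the first secant of a half-edge. The last secant along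
    \<open>d\<close> is the negative of the first one of \<open>rev_dart d\<close>, which accounts
    for the half turns below.\<close>
  define \<alpha> where "\<alpha> d = Arg (g d \<epsilon> - g d 0)" for d
  have \<alpha>: "sgn (g d \<epsilon> - g d 0) = cis (\<alpha> d)" if "d \<in> darts G" for d
    using e1[OF that, of 0] \<epsilon> by (simp add: \<alpha>_def cis_Arg)
  have \<alpha>': "sgn (g d 0 - g d \<epsilon>) = cis (\<alpha> d + pi)" if "d \<in> darts G" for d
    using \<alpha>[OF that] by (metis cis_mult cis_pi minus_diff_eq mult.right_neutral mult_minus_right sgn_minus)
  define A where "A d s = g d (s + \<epsilon>) - g d s" for d s
  define B where "B d d' s = g d' s - g d (\<epsilon> - s)" for d d' s
  have A_nv: "nonvanishing (A d) 0 (1 - \<epsilon>)" if d: "d \<in> darts G" for d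
    unfolding nonvanishing_def A_def using \<epsilon> e1[OF d]
    by (auto intro!: continuous_intros continuous_on_compose2[OF g_cont[OF d]])
  have B_nv: "nonvanishing (B d d') 0 \<epsilon>"
    if d: "d \<in> darts G" "d' \<in> darts G" "d \<noteq> d'" "dstart G d = dstart G d'" for d d'
    unfolding nonvanishing_def B_def using \<epsilon> e2[OF d]
    by (auto intro!: continuous_intros continuous_on_compose2[OF g_cont[OF d(1)]] continuous_on_compose2[OF g_cont[OF d(2)]])
  have "\<exists>k. d \<in> darts G \<longrightarrow> odd k \<and> turn (A d) 0 (1 - \<epsilon>) = \<alpha> (rev_dart d) - \<alpha> d + pi * of_int k" for d
  proof (cases "d \<in> darts G")
    case True
    have "A d (1 - \<epsilon>) = g (rev_dart d) 0 - g (rev_dart d) \<epsilon>"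
      by (simp add: A_def g_rev)
    then obtain k :: int where "turn (A d) 0 (1 - \<epsilon>) = (\<alpha> (rev_dart d) + pi) - \<alpha> d + 2 * pi * k"
      using turn_mod_2pi[OF A_nv[OF True], of "\<alpha> d" "\<alpha> (rev_dart d) + pi"] \<alpha>[OF True] \<alpha>'[of "rev_dart d"] True
      by (auto simp: A_def)
    then show ?thesis
      by (intro exI[of _ "2 * k + 1"]) (simp add: algebra_simps)
  qed auto
  then obtain k where k: "\<And>d. d \<in> darts G \<Longrightarrow> odd (k d) \<and>
      turn (A d) 0 (1 - \<epsilon>) = \<alpha> (rev_dart d) - \<alpha> d + pi * of_int (k d)"
    by metis
  have "\<exists>k. d \<in> darts G \<longrightarrow> d' \<in> darts G \<longrightarrow> d \<noteq> d' \<longrightarrow> dstart G d = dstart G d' \<longrightarrow>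
      odd k \<and> turn (B d d') 0 \<epsilon> = \<alpha> d' - \<alpha> d + pi * of_int k" for d d'
  proof (cases "d \<in> darts G \<and> d' \<in> darts G \<and> d \<noteq> d' \<and> dstart G d = dstart G d'")
    case True
    have "B d d' 0 = g d 0 - g d \<epsilon>" "B d d' \<epsilon> = g d' \<epsilon> - g d' 0"
      using True by (simp_all add: B_def g_start)
    then obtain k :: int where "turn (B d d') 0 \<epsilon> = \<alpha> d' - (\<alpha> d + pi) + 2 * pi * k"
      using turn_mod_2pi[OF B_nv[of d d'], of "\<alpha> d + pi" "\<alpha> d'"] \<alpha>[of d'] \<alpha>'[of d] True
      by auto
    then show ?thesis
      by (intro exI[of _ "2 * k - 1"]) (simp add: algebra_simps)
  qed auto
  then obtain l where l: "\<And>d d'. d \<in> darts G \<Longrightarrow> d' \<in> darts G \<Longrightarrow> d \<noteq> d' \<Longrightarrow> dstart G d = dstart G d' \<Longrightarrow>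
      odd (l d d') \<and> turn (B d d') 0 \<epsilon> = \<alpha> d' - \<alpha> d + pi * of_int (l d d')"
    by metis
  \<comment> \<open>Along the reversed edge the negated secants are read backwards: the negation
    leaves the turn unchanged, the reversal changes its sign.\<close>
  have "k (rev_dart d) = - k d" if d: "d \<in> darts G" for d
  proof -
    have "turn (A (rev_dart d)) 0 (1 - \<epsilon>) = turn (\<lambda>s. - A d (0 + (1 - \<epsilon>) - s)) 0 (1 - \<epsilon>)"
      by (rule turn_cong) (simp add: A_def g_rev algebra_simps)
    also have "\<dots> = turn (\<lambda>s. A d (0 + (1 - \<epsilon>) - s)) 0 (1 - \<epsilon>)"
      using A_nv[OF d] by (intro turn_uminus)
        (auto simp: nonvanishing_def intro!: continuous_intros continuous_on_compose2[of "{0..1 - \<epsilon>}" "A d"])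
    also have "\<dots> = - turn (A d) 0 (1 - \<epsilon>)"
      by (rule turn_reverse[OF A_nv[OF d]])
    finally have "pi * of_int (k (rev_dart d)) = pi * of_int (- k d)"
      using k[OF d] k[of "rev_dart d"] d by simp
    then show ?thesis
      by (simp flip: of_int_minus)
  qed
  moreover have "l d' d = - l d d'"
    if d: "d \<in> darts G" "d' \<in> darts G" "d \<noteq> d'" "dstart G d = dstart G d'" for d d'
  proof -
    have "turn (B d' d) 0 \<epsilon> = turn (\<lambda>s. - B d d' (0 + \<epsilon> - s)) 0 \<epsilon>"
      by (rule turn_cong) (simp add: B_def)
    also have "\<dots> = turn (\<lambda>s. B d d' (0 + \<epsilon> - s)) 0 \<epsilon>"
      using B_nv[OF d] by (intro turn_uminus)
        (auto simp: nonvanishing_def intro!: continuous_intros continuous_on_compose2[of "{0..\<epsilon>}" "B d d'"])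
    also have "\<dots> = - turn (B d d') 0 \<epsilon>"
      by (rule turn_reverse[OF B_nv[OF d]])
    finally have "pi * of_int (l d' d) = pi * of_int (- l d d')"
      using l[OF d] l[of d' d] d by simp
    then show ?thesis
      by (simp flip: of_int_minus)
  qed
  moreover have "csum k l ds = 0" if ds: "cyc G ds" for ds
  proof -
    define n where "n = length ds"
    have n: "0 < n" "ds \<noteq> []"
      using ds by (auto simp: n_def cyc_def)
    define nx where "nx i = ds ! (Suc i mod n)" for i
    have darts: "ds ! i \<in> darts G" "nx i \<in> darts G" if "i < n" for i
      using ds that n by (auto simp: cyc_def n_def nx_def)
    have corner: "rev_dart (ds ! i) \<noteq> nx i" "dstart G (rev_dart (ds ! i)) = dstart G (nx i)" if "i < n" for i
    proof -
      show "dstart G (rev_dart (ds ! i)) = dstart G (nx i)"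
        using cyc_nth[OF ds] that by (simp add: nx_def n_def)
      show "rev_dart (ds ! i) \<noteq> nx i"
      proof -
        have "ds ! i \<in> set ds" "nx i \<in> set ds"
          using that n by (auto simp: nx_def n_def)
        then show ?thesis
          using cyc_rev_notin[OF ds] by metis
      qed
    qed
    have piece: "turn (A (ds ! i)) 0 (1 - \<epsilon>) + turn (B (rev_dart (ds ! i)) (nx i)) 0 \<epsilon> =
        \<alpha> (nx i) - \<alpha> (ds ! i) + pi * of_int (k (ds ! i) + l (rev_dart (ds ! i)) (nx i))" if i: "i < n" for i
      using k[OF darts(1)[OF i]] l[of "rev_dart (ds ! i)" "nx i"] darts[OF i] corner[OF i]
      by (simp add: algebra_simps)
    have "0 = turn (\<lambda>t. c ds (t + \<epsilon> / n) - c ds t) 0 1"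
      using e3(2)[OF ds] by (simp add: n_def)
    also have "\<dots> = (\<Sum>i<n. turn (\<lambda>s. g (ds ! i) (s + \<epsilon>) - g (ds ! i) s) 0 (1 - \<epsilon>) +
        turn (\<lambda>s. g (ds ! (Suc i mod n)) s - g (ds ! i) (1 - (\<epsilon> - s))) 0 \<epsilon>)"
      using e3(1)[OF ds] h(3)[OF ds] n \<epsilon> c_periodic
      by (intro turn_secant_pieces c_cont[OF ds]) (auto simp: n_def c_def)
    also have "\<dots> = (\<Sum>i<n. turn (A (ds ! i)) 0 (1 - \<epsilon>) + turn (B (rev_dart (ds ! i)) (nx i)) 0 \<epsilon>)"
      by (simp add: A_def[abs_def] B_def[abs_def] g_rev nx_def)
    also have "\<dots> = (\<Sum>i<n. \<alpha> (nx i) - \<alpha> (ds ! i) + pi * of_int (k (ds ! i) + l (rev_dart (ds ! i)) (nx i)))"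
      by (intro sum.cong piece) auto
    also have "\<dots> = (\<Sum>i<n. \<alpha> (nx i)) - (\<Sum>i<n. \<alpha> (ds ! i)) +
        pi * of_int (\<Sum>i<n. k (ds ! i) + l (rev_dart (ds ! i)) (nx i))"
      by (simp add: sum.distrib sum_subtractf sum_distrib_left distrib_left)
    also have "(\<Sum>i<n. \<alpha> (nx i)) = (\<Sum>i<n. \<alpha> (ds ! i))"
      unfolding nx_def by (rule sum_cyclic_shift)
    also have "(\<Sum>i<n. k (ds ! i) + l (rev_dart (ds ! i)) (nx i)) = csum k l ds"
      unfolding nx_def n_def using n(2) by (rule csum_nth[symmetric])
    finally show ?thesis
      by simp
  qed
  ultimately have "odd_system G k l"
    using k l unfolding odd_system_def by blast
  then show ?thesis
    by blast
qed

section \<open>Rotation number zero\<close>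

lemma int_shift_periodic:
  fixes A :: "real \<Rightarrow> 'a"
  assumes "\<And>s. A (s + 1) = A s"
  shows "A (s + of_int m) = A s"
proof (induction m rule: int_induct[where k = 0])
  case (step1 i)
  then show ?case
    using assms[of "s + of_int i"] by (simp add: add.assoc)
next
  case (step2 i)
  then show ?case
    using assms[of "s + of_int (i - 1)"] by (simp add: add.assoc)
qed auto

text \<open>The strip of all pairs of a start and a step below \<delta> is contractible, so a single
  continuous angle function covers secants of all these lengths. Its increment over a period is a
  continuous integer multiple of 2\<pi>, hence constant on the strip, and it is zero for the step
  \<open>\<delta>1\<close>.\<close>

lemma secant_angle_periodic:
  fixes c :: "real \<Rightarrow> complex"
  assumes cont: "continuous_on UNIV c" and periodic: "\<And>t. c (t + 1) = c t"
    and \<delta>: "0 < \<delta>" and inj: "\<And>s d. 0 < d \<Longrightarrow> d < \<delta> \<Longrightarrow> c (s + d) \<noteq> c s"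
    and \<delta>1: "0 < \<delta>1" "\<delta>1 < \<delta>" and turn: "turn (\<lambda>t. c (t + \<delta>1) - c t) 0 1 = 0"
  shows "\<exists>A. continuous_on (UNIV \<times> {0<..<\<delta>}) A \<and>
    (\<forall>s. \<forall>d\<in>{0<..<\<delta>}. sgn (c (s + d) - c s) = cis (A (s, d))) \<and>
    (\<forall>s. \<forall>d\<in>{0<..<\<delta>}. A (s + 1, d) = A (s, d))"
proof -
  define D where "D = (UNIV :: real set) \<times> {0<..<\<delta>}"
  have D_convex: "convex D"
    unfolding D_def by (intro convex_Times) auto
  have cont_F: "continuous_on D (\<lambda>x. c (fst x + snd x) - c (fst x))"
    by (intro continuous_intros continuous_on_compose2[OF cont]) auto
  have nz: "c (fst x + snd x) - c (fst x) \<noteq> 0" if "x \<in> D" for x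
    using inj that by (auto simp: D_def)
  obtain L where L: "continuous_on D L" "\<And>x. x \<in> D \<Longrightarrow> c (fst x + snd x) - c (fst x) = exp (L x)"
    using continuous_logarithm_on_contractible[OF cont_F convex_imp_contractible[OF D_convex] nz] by metis
  define A where "A x = Im (L x)" for x
  have A_cont: "continuous_on D A"
    unfolding A_def by (intro continuous_intros L)
  have A_cis: "sgn (c (s + d) - c s) = cis (A (s, d))" if "d \<in> {0<..<\<delta>}" for s d
  proof -
    have "(s, d) \<in> D"
      using that by (simp add: D_def)
    then have "c (s + d) - c s = exp (L (s, d))"
      using L(2)[of "(s, d)"] by simp
    then show ?thesis
      by (simp add: exp_eq_polar sgn_mult sgn_of_real sgn_cis A_def)
  qed
  define k where "k x = (A (fst x + 1, snd x) - A x) / (2 * pi)" for x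
  have int: "k x \<in> \<int>" if x: "x \<in> D" for x
  proof -
    obtain s d where sd: "x = (s, d)" "d \<in> {0<..<\<delta>}"
      using x by (auto simp: D_def)
    have "s + 1 + d = (s + d) + 1"
      by simp
    then have "c (s + 1 + d) = c (s + d)"
      by (simp only: periodic)
    then have "cis (A (s + 1, d)) = cis (A (s, d))"
      using A_cis[OF sd(2), of s] A_cis[OF sd(2), of "s + 1"] periodic[of s] by simp
    then have "cis (2 * pi * (A (s + 1, d) / (2 * pi))) = cis (2 * pi * (A (s, d) / (2 * pi)))"
      by simp
    then show ?thesis
      unfolding k_def sd(1) fst_conv snd_conv diff_divide_distrib by (simp only: cis_2pi_eq_iff)
  qed
  have "k constant_on D"
  proof (rule continuous_discrete_range_constant)
    show "topological_space_class.connected D"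
      using D_convex by (rule convex_connected)
    show "continuous_on D k"
      unfolding k_def
      by (intro continuous_intros continuous_on_compose2[OF A_cont]) (auto simp: D_def)
    show "\<exists>e>0. \<forall>y. y \<in> D \<and> k y \<noteq> k x \<longrightarrow> e \<le> norm (k y - k x)" if x: "x \<in> D" for x
    proof (intro exI[of _ 1] conjI allI impI)
      fix y assume y: "y \<in> D \<and> k y \<noteq> k x"
      obtain i :: int where i: "k y = i"
        using int[of y] y by (auto elim: Ints_cases)
      obtain j :: int where j: "k x = j"
        using int[OF x] by (auto elim: Ints_cases)
      have "1 \<le> \<bar>i - j\<bar>"
        using y i j by auto
      then show "1 \<le> norm (k y - k x)"
        by (simp add: i j flip: of_int_diff of_int_abs)
    qed auto
  qed
  then obtain k0 where k0: "\<And>x. x \<in> D \<Longrightarrow> k x = k0"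
    by (auto simp: constant_on_def)
  have "angle_lift (\<lambda>t. c (t + \<delta>1) - c t) (\<lambda>t. A (t, \<delta>1)) 0 1"
    unfolding angle_lift_def
  proof (intro conjI ballI)
    show "continuous_on {0..1} (\<lambda>t. A (t, \<delta>1))"
      using \<delta>1 by (intro continuous_on_compose2[OF A_cont] continuous_intros) (auto simp: D_def)
    show "sgn (c (t + \<delta>1) - c t) = cis (A (t, \<delta>1))" for t
      using \<delta>1 by (intro A_cis) auto
  qed
  then have "A (1, \<delta>1) - A (0, \<delta>1) = 0"
    using turn turn_eq by fastforce
  then have "k (0, \<delta>1) = 0"
    by (simp add: k_def)
  then have "k x = 0" if "x \<in> D" for x
    using k0[OF that] k0[of "(0, \<delta>1)"] \<delta>1 by (simp add: D_def)
  then have "A (s + 1, d) = A (s, d)" if "d \<in> {0<..<\<delta>}" for s d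
    using that by (force simp: k_def D_def)
  then show ?thesis
    using A_cont A_cis unfolding D_def by blast
qed

lemma nonvanishing_sign:
  fixes f :: "real \<Rightarrow> real"
  assumes "continuous_on UNIV f" "\<And>t. f t \<noteq> 0"
  shows "(\<forall>t. 0 < f t) \<or> (\<forall>t. f t < 0)"
proof (rule ccontr)
  assume "\<not> ?thesis"
  then obtain s t where "\<not> 0 < f s" "\<not> f t < 0"
    by blast
  then have "f s < 0" "0 < f t"
    using assms(2)[of s] assms(2)[of t] by linarith+
  moreover have "topological_space_class.connected (range f)"
    using assms(1) by (intro connected_continuous_image) auto
  ultimately have "0 \<in> range f"
    using connectedD_interval[of "range f" "f s" "f t" 0] by auto
  then show False
    using assms(2) by auto
qed

text \<open>Secants of the reparametrized curve are secants of \<open>c\<close> with a variable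
  step. This step never vanishes, so its sign is constant: a positive step reads off the periodic
  angle function, a negative one that of the reversed secant plus a constant \<pi>.\<close>

lemma has_rotation_number_0_reparametrize:
  fixes c :: "real \<Rightarrow> complex" and \<psi> :: "real \<Rightarrow> real" and m :: int
  assumes cont: "continuous_on UNIV c" and periodic: "\<And>t. c (t + 1) = c t"
    and \<delta>: "0 < \<delta>" and inj: "\<And>s d. 0 < d \<Longrightarrow> d < \<delta> \<Longrightarrow> c (s + d) \<noteq> c s"
    and \<delta>1: "0 < \<delta>1" "\<delta>1 < \<delta>" and turn: "turn (\<lambda>t. c (t + \<delta>1) - c t) 0 1 = 0"
    and \<psi>: "continuous_on UNIV \<psi>" "\<And>t. \<psi> (t + 1) = \<psi> t + of_int m" "\<And>t t'. \<psi> t - \<psi> t' \<in> \<int> \<Longrightarrow> t - t' \<in> \<int>"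
  shows "has_rotation_number (\<lambda>t. c (\<psi> t)) 0"
proof (rule has_rotation_number_0I)
  obtain A where A_cont: "continuous_on (UNIV \<times> {0<..<\<delta>}) A"
    and A_cis: "\<And>s d. d \<in> {0<..<\<delta>} \<Longrightarrow> sgn (c (s + d) - c s) = cis (A (s, d))"
    and A_per: "\<And>s d. d \<in> {0<..<\<delta>} \<Longrightarrow> A (s + 1, d) = A (s, d)"
    using secant_angle_periodic[OF cont periodic \<delta> inj \<delta>1 turn] by metis
  have A_int: "A (s + of_int i, d) = A (s, d)" if "d \<in> {0<..<\<delta>}" for s d i
    using int_shift_periodic[of "\<lambda>s. A (s, d)" s i] A_per[OF that] by simp
  \<comment> \<open>The interval contains both ends of a step \<epsilon> < 1 that starts in
    \<open>{0..1}\<close>; integer shifts carry the estimate to the whole line.\<close>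
  have "uniformly_continuous_on {0..2} \<psi>"
    by (intro compact_uniformly_continuous continuous_on_subset[OF \<psi>(1)]) auto
  then obtain r where r: "r > 0" "\<And>s t. s \<in> {0..2} \<Longrightarrow> t \<in> {0..2} \<Longrightarrow> dist t s < r \<Longrightarrow> dist (\<psi> t) (\<psi> s) < \<delta>"
    using \<delta> unfolding uniformly_continuous_on_def by metis
  have \<psi>_int: "\<psi> (t + of_int i) = \<psi> t + of_int i * of_int m" for t i
  proof -
    have "\<psi> (t + 1) - of_int m * (t + 1) = \<psi> t - of_int m * t" for t
      using \<psi>(2)[of t] by (simp add: algebra_simps)
    from int_shift_periodic[of "\<lambda>t. \<psi> t - of_int m * t" t i, OF this] show ?thesis
      by (simp add: algebra_simps)
  qed
  have "\<forall>\<^sub>F \<epsilon> in at_right 0. 0 < \<epsilon> \<and> \<epsilon> < min r 1"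
    using eventually_at_right_less[of "0::real"] eventually_at_right_real[of 0 "min r 1"] r(1) by auto
  then show "\<forall>\<^sub>F \<epsilon> in at_right 0. (\<forall>t. c (\<psi> (t + \<epsilon>)) \<noteq> c (\<psi> t)) \<and>
      (\<exists>\<theta>. angle_lift (\<lambda>t. c (\<psi> (t + \<epsilon>)) - c (\<psi> t)) \<theta> 0 1 \<and> \<theta> 1 = \<theta> 0)"
  proof eventually_elim
    case (elim \<epsilon>)
    define D where "D t = \<psi> (t + \<epsilon>) - \<psi> t" for t
    have D_cont: "continuous_on UNIV D"
      unfolding D_def by (intro continuous_intros continuous_on_compose2[OF \<psi>(1)]) auto
    have D_nz: "D t \<noteq> 0" for t
    proof
      assume "D t = 0"
      then have "\<epsilon> \<in> \<int>"
        using \<psi>(3)[of "t + \<epsilon>" t] by (simp add: D_def)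
      then obtain i :: int where "\<epsilon> = i"
        by (auto elim: Ints_cases)
      then show False
        using elim by auto
    qed
    have D_small: "\<bar>D t\<bar> < \<delta>" for t
    proof -
      have "t = frac t + of_int \<lfloor>t\<rfloor>" "t + \<epsilon> = (frac t + \<epsilon>) + of_int \<lfloor>t\<rfloor>"
        by (simp_all add: frac_def)
      then have "D t = \<psi> (frac t + \<epsilon>) - \<psi> (frac t)"
        unfolding D_def by (metis \<psi>_int add_diff_cancel_right)
      moreover have "dist (\<psi> (frac t + \<epsilon>)) (\<psi> (frac t)) < \<delta>"
        using elim frac_ge_0[of t] frac_lt_1[of t] by (intro r(2)) (auto simp: dist_real_def)
      ultimately show ?thesis
        by (simp add: dist_real_def)
    qed
    have D_per: "D (t + 1) = D t" for t
      using \<psi>(2)[of t] \<psi>(2)[of "t + \<epsilon>"] by (simp add: D_def add_ac)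
    have \<psi>1: "\<psi> 1 = \<psi> 0 + of_int m" "\<psi> (1 + \<epsilon>) = \<psi> \<epsilon> + of_int m" "D 1 = D 0"
      using \<psi>(2)[of 0] \<psi>(2)[of \<epsilon>] D_per[of 0] by (simp_all add: add.commute)
    from nonvanishing_sign[OF D_cont D_nz] show ?case
    proof
      assume pos: "\<forall>t. 0 < D t"
      then have D_in: "D t \<in> {0<..<\<delta>}" for t
        using D_small[of t] by auto
      have eq: "c (\<psi> (t + \<epsilon>)) = c (\<psi> t + D t)" for t
        by (simp add: D_def)
      have "angle_lift (\<lambda>t. c (\<psi> (t + \<epsilon>)) - c (\<psi> t)) (\<lambda>t. A (\<psi> t, D t)) 0 1"
        unfolding angle_lift_def eq
      proof (intro conjI ballI A_cis[OF D_in])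
        show "continuous_on {0..1} (\<lambda>t. A (\<psi> t, D t))"
          using D_in by (intro continuous_on_compose2[OF A_cont] continuous_intros
              continuous_on_subset[OF \<psi>(1)] continuous_on_subset[OF D_cont]) auto
      qed
      moreover have "A (\<psi> 1, D 1) = A (\<psi> 0, D 0)"
        using A_int[OF D_in[of 0]] by (simp add: \<psi>1)
      moreover have "c (\<psi> (t + \<epsilon>)) \<noteq> c (\<psi> t)" for t
        unfolding eq using D_in[of t] by (intro inj) auto
      ultimately show ?thesis
        by (intro conjI exI[of _ "\<lambda>t. A (\<psi> t, D t)"]) auto
    next
      assume neg: "\<forall>t. D t < 0"
      then have D_in: "- D t \<in> {0<..<\<delta>}" for t
        using D_small[of t] by auto
      have eq: "c (\<psi> t) = c (\<psi> (t + \<epsilon>) + - D t)" for t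
        by (simp add: D_def)
      have "angle_lift (\<lambda>t. c (\<psi> (t + \<epsilon>)) - c (\<psi> t)) (\<lambda>t. A (\<psi> (t + \<epsilon>), - D t) + pi) 0 1"
        unfolding angle_lift_def
      proof (intro conjI ballI)
        show "continuous_on {0..1} (\<lambda>t. A (\<psi> (t + \<epsilon>), - D t) + pi)"
          using D_in by (intro continuous_on_compose2[OF A_cont] continuous_intros
              continuous_on_compose2[OF \<psi>(1)] continuous_on_subset[OF D_cont]) auto
        fix t
        have "sgn (c (\<psi> (t + \<epsilon>)) - c (\<psi> t)) = - sgn (c (\<psi> t) - c (\<psi> (t + \<epsilon>)))"
          by (simp flip: sgn_minus)
        also have "\<dots> = - cis (A (\<psi> (t + \<epsilon>), - D t))"
          using A_cis[OF D_in[of t], of "\<psi> (t + \<epsilon>)"] eq[of t] by simp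
        finally show "sgn (c (\<psi> (t + \<epsilon>)) - c (\<psi> t)) = cis (A (\<psi> (t + \<epsilon>), - D t) + pi)"
          by (simp flip: cis_mult)
      qed
      moreover have "A (\<psi> (1 + \<epsilon>), - D 1) = A (\<psi> (0 + \<epsilon>), - D 0)"
        using A_int[OF D_in[of 0]] by (simp add: \<psi>1)
      moreover have "c (\<psi> (t + \<epsilon>)) \<noteq> c (\<psi> t)" for t
        using inj[of "- D t" "\<psi> (t + \<epsilon>)"] D_in[of t] eq[of t] by auto
      ultimately show ?thesis
        by (intro conjI exI[of _ "\<lambda>t. A (\<psi> (t + \<epsilon>), - D t) + pi"]) auto
    qed
  qed
qed

text \<open>Twice the signed area of the triangle, positive if the points are in counterclockwise
  order.\<close>

definition orient :: "complex \<Rightarrow> complex \<Rightarrow> complex \<Rightarrow> real" where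
  "orient a b c = Im (cnj (b - a) * (c - a))"

text \<open>For \<open>z\<close> off the real axis, the angle in (0, \<pi>) of the line spanned by
  \<open>z\<close>; it is the same for \<open>z\<close> and \<open>- z\<close>.\<close>

definition upper_arg :: "complex \<Rightarrow> real" where
  "upper_arg z = Arg (of_real (sgn (Im z)) * z)"

lemma upper_arg_bounds:
  assumes "Im z \<noteq> 0"
  shows "0 < upper_arg z" "upper_arg z < pi"
proof -
  have "0 < Im (of_real (sgn (Im z)) * z)"
    using assms by (simp add: sgn_if)
  then show "0 < upper_arg z" "upper_arg z < pi"
    unfolding upper_arg_def using Arg_lt_pi by blast+
qed

lemma upper_arg_polar:
  assumes "Im z \<noteq> 0"
  shows "z = of_real (sgn (Im z) * norm z) * cis (upper_arg z)"
proof -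
  define u where "u = of_real (sgn (Im z)) * z"
  have "u = of_real (norm u) * cis (Arg u)"
    using rcis_cmod_Arg[of u] by (simp add: rcis_def)
  moreover have "norm u = norm z"
    using assms by (simp add: u_def norm_mult sgn_if)
  moreover have "z = of_real (sgn (Im z)) * u"
    using assms by (simp add: u_def sgn_if)
  ultimately have "z = of_real (sgn (Im z)) * (of_real (norm z) * cis (Arg u))"
    by simp
  then show ?thesis
    unfolding upper_arg_def u_def[symmetric] by (simp add: mult.assoc)
qed

text \<open>Since \<open>- v\<close> and \<open>w\<close> lie in the same open half-plane, the angle
  from \<open>- v\<close> to \<open>w\<close> is the difference of the line angles. The exterior
  angle differs from it by a half turn in the direction of \<tau>.\<close>

lemma Arg_corner:
  assumes up: "Im v * Im w < 0" and \<tau>: "\<tau> = sgn (Im (cnj v * w))" "\<tau> \<noteq> 0"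
  shows "Arg (w / v) = upper_arg w - upper_arg v + pi * \<tau>" "Im (w / v) \<noteq> 0"
proof -
  define a where "a = upper_arg v"
  define b where "b = upper_arg w"
  have Im: "Im v \<noteq> 0" "Im w \<noteq> 0" "sgn (Im w) = - sgn (Im v)"
    using up by (auto simp: sgn_if mult_less_0_iff)
  have ab: "0 < a" "a < pi" "0 < b" "b < pi"
    using upper_arg_bounds Im by (auto simp: a_def b_def)
  define \<sigma> where "\<sigma> = sgn (Im v)"
  have v: "v = of_real (\<sigma> * norm v) * cis a" and w: "w = of_real (- \<sigma> * norm w) * cis b"
    using upper_arg_polar[OF Im(1)] upper_arg_polar[OF Im(2)] Im(3) by (simp_all add: a_def b_def \<sigma>_def)
  have pos: "0 < norm v" "0 < norm w"
    using Im by auto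
  have s2: "\<sigma> * \<sigma> = 1" "\<sigma> \<noteq> 0"
    using Im by (simp_all add: \<sigma>_def sgn_if)
  have cv: "cnj v = of_real (\<sigma> * norm v) * cis (- a)"
    using arg_cong[OF v, of cnj] by (simp add: cis_cnj)
  have "cnj v * w = of_real (- (\<sigma> * \<sigma>) * norm v * norm w) * (cis (- a) * cis b)"
    using arg_cong2[OF cv w, of "(*)"] by (simp add: mult_ac)
  then have "cnj v * w = of_real (- (\<sigma> * \<sigma>) * norm v * norm w) * cis (b - a)"
    by (simp add: cis_mult)
  then have vw: "cnj v * w = of_real (- norm v * norm w) * cis (b - a)"
    by (simp add: s2)
  have "sgn (sin (b - a)) = sgn (b - a)"
    using ab sin_gt_zero[of "b - a"] sin_lt_zero[of "b - a + 2 * pi"] sin_gt_zero[of "a - b"]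
    by (cases "b - a" "0::real" rule: linorder_cases) (auto simp: sgn_if sin_minus[of "b - a", symmetric] not_less)
  then have \<tau>': "\<tau> = sgn (a - b)"
    using pos by (simp add: \<tau>(1) vw sgn_mult) (simp add: sgn_if)
  have "w / v = of_real (norm w / norm v) * - cis (b - a)"
    using arg_cong2[OF w v, of "(/)"] s2(2) pos by (simp add: mult_ac flip: cis_divide)
  moreover have "cis (- pi) = - 1"
    by (simp add: complex_eq_iff)
  then have "- cis (b - a) = cis (b - a + pi * \<tau>)"
    using \<tau>(2) \<tau>' by (auto simp: sgn_if simp flip: cis_mult cis_divide split: if_splits)
  ultimately have wv: "w / v = of_real (norm w / norm v) * cis (b - a + pi * \<tau>)"
    by simp
  have rng: "- pi < b - a + pi * \<tau>" "b - a + pi * \<tau> < pi" "b - a + pi * \<tau> \<noteq> 0"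
    using ab \<tau>(2) \<tau>' by (auto simp: sgn_if split: if_splits)
  show "Arg (w / v) = upper_arg w - upper_arg v + pi * \<tau>"
    unfolding a_def[symmetric] b_def[symmetric]
  proof (rule cis_Arg_unique)
    show "sgn (w / v) = cis (b - a + pi * \<tau>)"
      using pos by (simp add: wv sgn_mult sgn_of_real sgn_cis)
  qed (use rng in auto)
  have "sin (b - a + pi * \<tau>) \<noteq> 0"
    using rng by (subst sin_zero_pi_iff) auto
  then show "Im (w / v) \<noteq> 0"
    using pos by (simp add: wv)
qed

text \<open>Divided by \<open>v\<close>, the secant around the corner runs on the straight segment
  from \<epsilon> to \<epsilon> times \<open>w / v\<close>. This segment avoids the nonpositive
  reals, so the principal argument gives a lift.\<close>

lemma turn_corner:
  assumes up: "Im v * Im w < 0" and \<tau>: "\<tau> = sgn (Im (cnj v * w))" "\<tau> \<noteq> 0" and \<epsilon>: "0 < \<epsilon>"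
  shows "turn (\<lambda>s. of_real s * w + of_real (\<epsilon> - s) * v) 0 \<epsilon> = upper_arg w - upper_arg v + pi * \<tau>"
proof -
  define q where "q = w / v"
  have v: "v \<noteq> 0"
    using up by auto
  have q: "Im q \<noteq> 0" "Arg q = upper_arg w - upper_arg v + pi * \<tau>"
    using Arg_corner[OF up \<tau>] by (simp_all add: q_def)
  define f where "f s = of_real s * q + of_real (\<epsilon> - s)" for s :: real
  have f_slit: "f s \<notin> \<real>\<^sub>\<le>\<^sub>0" if "s \<in> {0..\<epsilon>}" for s
  proof (cases "s = 0")
    case True
    then show ?thesis
      using \<epsilon> by (simp add: f_def)
  next
    case False
    then have "Im (f s) \<noteq> 0"
      using q by (simp add: f_def)
    then show ?thesis
      by (simp add: complex_nonpos_Reals_iff)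
  qed
  have "angle_lift (\<lambda>s. of_real s * w + of_real (\<epsilon> - s) * v) (\<lambda>s. Arg v + Arg (f s)) 0 \<epsilon>"
    unfolding angle_lift_def
  proof (intro conjI ballI)
    show "continuous_on {0..\<epsilon>} (\<lambda>s. Arg v + Arg (f s))"
      using f_slit unfolding f_def by (intro continuous_intros) auto
    fix s assume s: "s \<in> {0..\<epsilon>}"
    have "of_real s * w + of_real (\<epsilon> - s) * v = v * f s"
      using v by (simp add: f_def q_def algebra_simps)
    moreover have "f s \<noteq> 0"
      using f_slit[OF s] by auto
    ultimately show "sgn (of_real s * w + of_real (\<epsilon> - s) * v) = cis (Arg v + Arg (f s))"
      using v by (simp add: sgn_mult cis_Arg flip: cis_mult)
  qed
  then have "turn (\<lambda>s. of_real s * w + of_real (\<epsilon> - s) * v) 0 \<epsilon> = Arg (f \<epsilon>) - Arg (f 0)"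
    using \<epsilon> by (simp add: turn_eq)
  also have "f \<epsilon> = of_real \<epsilon> * q" "f 0 = of_real \<epsilon>"
    by (simp_all add: f_def)
  then have "Arg (f \<epsilon>) - Arg (f 0) = Arg q"
    using \<epsilon> by (simp add: Arg_times_of_real)
  finally show ?thesis
    by (simp add: q)
qed

text \<open>Along an edge the secants have constant direction. At the corners the line angles
  telescope around the polygon, so the whole turning is \<pi> times the sum of the signs.\<close>

lemma turn_closed_polygon:
  fixes c :: "real \<Rightarrow> complex" and P Q :: "nat \<Rightarrow> complex"
  assumes cont: "continuous_on UNIV c" and periodic: "\<And>t. c (t + 1) = c t"
    and n: "0 < n" and \<epsilon>: "0 < \<epsilon>" "\<epsilon> < 1" and nv: "\<And>t. c (t + \<epsilon> / real n) \<noteq> c t"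
    and cs: "\<And>i s. i < n \<Longrightarrow> s \<in> {0..1} \<Longrightarrow> c ((real i + s) / real n) = of_real (1 - s) * P i + of_real s * P (Suc i mod n)"
    and alt: "\<And>i. i < n \<Longrightarrow> Im (P (Suc i mod n) - P i) * Im (P (Suc (Suc i mod n) mod n) - P (Suc i mod n)) < 0"
    and \<tau>: "\<And>i. i < n \<Longrightarrow> \<tau> i = sgn (orient (P i) (P (Suc i mod n)) (P (Suc (Suc i mod n) mod n)))"
      "\<And>i. i < n \<Longrightarrow> \<tau> i \<noteq> 0" and sum: "(\<Sum>i<n. \<tau> i) = 0"
  shows "turn (\<lambda>t. c (t + \<epsilon> / real n) - c t) 0 1 = 0"
proof -
  define V where "V i = P (Suc i mod n) - P i" for i
  define g where "g i s = of_real (1 - s) * P i + of_real s * P (Suc i mod n)" for i and s :: real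
  have piece: "turn (\<lambda>s. g i (s + \<epsilon>) - g i s) 0 (1 - \<epsilon>) +
      turn (\<lambda>s. g (Suc i mod n) s - g i (1 - (\<epsilon> - s))) 0 \<epsilon> =
      upper_arg (V (Suc i mod n)) - upper_arg (V i) + pi * \<tau> i" if i: "i < n" for i
  proof -
    have V: "Im (V i) * Im (V (Suc i mod n)) < 0"
      using alt[OF i] by (simp add: V_def)
    then have Vi: "V i \<noteq> 0"
      by auto
    have "angle_lift (\<lambda>s. g i (s + \<epsilon>) - g i s) (\<lambda>_. Arg (V i)) 0 (1 - \<epsilon>)"
      unfolding angle_lift_def
    proof (intro conjI ballI)
      fix s
      have "g i (s + \<epsilon>) - g i s = of_real \<epsilon> * V i"
        by (simp add: g_def V_def algebra_simps)
      then show "sgn (g i (s + \<epsilon>) - g i s) = cis (Arg (V i))"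
        using \<epsilon> Vi by (simp add: sgn_mult sgn_of_real cis_Arg)
    qed auto
    then have 1: "turn (\<lambda>s. g i (s + \<epsilon>) - g i s) 0 (1 - \<epsilon>) = 0"
      using \<epsilon> by (simp add: turn_eq)
    have "(\<lambda>s. g (Suc i mod n) s - g i (1 - (\<epsilon> - s))) =
        (\<lambda>s. of_real s * V (Suc i mod n) + of_real (\<epsilon> - s) * V i)"
      by (simp add: g_def V_def fun_eq_iff algebra_simps)
    moreover have "orient (P i) (P (Suc i mod n)) (P (Suc (Suc i mod n) mod n)) = Im (cnj (V i) * V (Suc i mod n))"
      by (simp add: orient_def V_def algebra_simps)
    then have "turn (\<lambda>s. of_real s * V (Suc i mod n) + of_real (\<epsilon> - s) * V i) 0 \<epsilon> =
        upper_arg (V (Suc i mod n)) - upper_arg (V i) + pi * \<tau> i"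
      using \<tau>[OF i] V \<epsilon> by (intro turn_corner) auto
    ultimately show ?thesis
      using 1 by simp
  qed
  have "turn (\<lambda>t. c (t + \<epsilon> / real n) - c t) 0 1 = (\<Sum>i<n. turn (\<lambda>s. g i (s + \<epsilon>) - g i s) 0 (1 - \<epsilon>) +
      turn (\<lambda>s. g (Suc i mod n) s - g i (1 - (\<epsilon> - s))) 0 \<epsilon>)"
    using cs by (intro turn_secant_pieces cont periodic n \<epsilon> nv) (auto simp: g_def)
  also have "\<dots> = (\<Sum>i<n. upper_arg (V (Suc i mod n)) - upper_arg (V i) + pi * \<tau> i)"
    by (intro sum.cong piece) auto
  also have "\<dots> = (\<Sum>i<n. upper_arg (V (Suc i mod n))) - (\<Sum>i<n. upper_arg (V i)) + pi * (\<Sum>i<n. \<tau> i)"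
    by (simp add: sum.distrib sum_subtractf sum_distrib_left)
  also have "\<dots> = 0"
    using sum_cyclic_shift[of "\<lambda>i. upper_arg (V i)" n] sum by simp
  finally show ?thesis .
qed

section \<open>Points in general position\<close>

lemma orient_coords:
  "orient a b c = (Re b - Re a) * (Im c - Im a) - (Im b - Im a) * (Re c - Re a)"
  by (simp add: orient_def algebra_simps)

lemma orient_simps [simp]: "orient a b a = 0" "orient a b b = 0" "orient a a c = 0"
  by (simp_all add: orient_coords)

lemma orient_cyclic: "orient b c a = orient a b c"
  by (simp add: orient_coords algebra_simps)

lemma orient_swap: "orient b a c = - orient a b c" "orient a c b = - orient a b c"
  by (simp_all add: orient_coords algebra_simps)

lemma orient_zeroD:
  assumes "a \<noteq> b" "orient a b z = 0"
  shows "\<exists>t. z = a + of_real t * (b - a)"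
proof -
  have nz: "(Re b - Re a)\<^sup>2 + (Im b - Im a)\<^sup>2 \<noteq> 0"
    using assms(1) by (auto simp: complex_eq_iff sum_power2_eq_zero_iff)
  \<comment> \<open>The coefficient of the orthogonal projection of \<open>z - a\<close> to the
    direction \<open>b - a\<close>.\<close>
  define t where "t = ((Re z - Re a) * (Re b - Re a) + (Im z - Im a) * (Im b - Im a)) /
    ((Re b - Re a)\<^sup>2 + (Im b - Im a)\<^sup>2)"
  have "(Re z - Re a) * ((Re b - Re a)\<^sup>2 + (Im b - Im a)\<^sup>2) =
      ((Re z - Re a) * (Re b - Re a) + (Im z - Im a) * (Im b - Im a)) * (Re b - Re a)"
    "(Im z - Im a) * ((Re b - Re a)\<^sup>2 + (Im b - Im a)\<^sup>2) =
      ((Re z - Re a) * (Re b - Re a) + (Im z - Im a) * (Im b - Im a)) * (Im b - Im a)"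
    using assms(2) unfolding orient_coords by algebra+
  then have "Re z - Re a = t * (Re b - Re a)" "Im z - Im a = t * (Im b - Im a)"
    using nz by (simp_all add: t_def field_simps)
  then show ?thesis
    by (intro exI[of _ t]) (simp add: complex_eq_iff)
qed

lemma orient_affine: "orient a b (a + of_real t * (c - a)) = t * orient a b c"
  by (simp add: orient_coords algebra_simps)

lemma two_common_points:
  assumes "a \<noteq> b" "c \<noteq> d" "z \<noteq> z'"
    and "orient a b z = 0" "orient a b z' = 0" "orient c d z = 0" "orient c d z' = 0"
  shows "orient a b c = 0" "orient a b d = 0"
proof -
  obtain t t' where t: "z = a + of_real t * (b - a)" "z' = a + of_real t' * (b - a)"
    using assms orient_zeroD by metis
  obtain s s' where s: "z = c + of_real s * (d - c)" "z' = c + of_real s' * (d - c)"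
    using assms orient_zeroD by metis
  have "s \<noteq> s'"
    using s assms(3) by auto
  have eq: "of_real (t' - t) * (b - a) = of_real (s' - s) * (d - c)"
  proof -
    have "z' - z = of_real (t' - t) * (b - a)"
      unfolding t by (simp add: algebra_simps)
    moreover have "z' - z = of_real (s' - s) * (d - c)"
      unfolding s by (simp add: algebra_simps)
    ultimately show ?thesis
      by simp
  qed
  define r where "r = (t' - t) / (s' - s)"
  have dc: "d - c = of_real r * (b - a)"
    using eq \<open>s \<noteq> s'\<close> by (simp add: r_def field_simps)
  have "c = z - of_real s * (d - c)"
    using s(1) by simp
  then have c: "c = a + of_real (t - s * r) * (b - a)"
    unfolding dc t(1) by (simp add: algebra_simps)
  have "d = c + (d - c)"
    by simp
  then have d: "d = a + of_real (t - s * r + r) * (b - a)"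
    unfolding dc by (subst (asm) c) (simp add: algebra_simps)
  show "orient a b c = 0" "orient a b d = 0"
    using orient_affine[of a b "t - s * r" b] orient_affine[of a b "t - s * r + r" b] c d by simp_all
qed

lemma negligible_line:
  assumes "a \<noteq> b"
  shows "negligible {z. orient a b z = 0}"
proof -
  define v where "v = \<i> * (b - a)"
  have "v \<noteq> 0"
    using assms by (simp add: v_def)
  moreover have "{z. orient a b z = 0} = {z. v \<bullet> z = v \<bullet> a}"
    by (auto simp: orient_coords v_def inner_complex_def algebra_simps)
  ultimately show ?thesis
    using negligible_hyperplane[of v "v \<bullet> a"] by simp
qed

text \<open>Concurrency is excluded for lines through six different points only: lines that share a
  defining point do meet there, and they are controlled by the condition on three points.\<close>

definition general_position :: "'i set \<Rightarrow> ('i \<Rightarrow> complex) \<Rightarrow> bool" where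
  "general_position I p \<longleftrightarrow> inj_on p I \<and>
     (\<forall>i\<in>I. \<forall>j\<in>I. \<forall>k\<in>I. distinct [i, j, k] \<longrightarrow> orient (p i) (p j) (p k) \<noteq> 0) \<and>
     (\<forall>a\<in>I. \<forall>b\<in>I. \<forall>c\<in>I. \<forall>d\<in>I. \<forall>e\<in>I. \<forall>f\<in>I. distinct [a, b, c, d, e, f] \<longrightarrow>
        \<not> (\<exists>z. orient (p a) (p b) z = 0 \<and> orient (p c) (p d) z = 0 \<and> orient (p e) (p f) z = 0))"

lemma general_positionD:
  assumes "general_position I p"
  shows "inj_on p I"
    and "i \<in> I \<Longrightarrow> j \<in> I \<Longrightarrow> k \<in> I \<Longrightarrow> distinct [i, j, k] \<Longrightarrow> orient (p i) (p j) (p k) \<noteq> 0"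
    and "a \<in> I \<Longrightarrow> b \<in> I \<Longrightarrow> c \<in> I \<Longrightarrow> d \<in> I \<Longrightarrow> e \<in> I \<Longrightarrow> f \<in> I \<Longrightarrow> distinct [a, b, c, d, e, f] \<Longrightarrow>
      orient (p a) (p b) z = 0 \<Longrightarrow> orient (p c) (p d) z = 0 \<Longrightarrow> orient (p e) (p f) z = 0 \<Longrightarrow> False"
proof -
  show "inj_on p I"
    using assms by (simp add: general_position_def)
  show "orient (p i) (p j) (p k) \<noteq> 0" if "i \<in> I" "j \<in> I" "k \<in> I" "distinct [i, j, k]"
    using assms that unfolding general_position_def by blast
  show False if "a \<in> I" "b \<in> I" "c \<in> I" "d \<in> I" "e \<in> I" "f \<in> I" "distinct [a, b, c, d, e, f]"
      "orient (p a) (p b) z = 0" "orient (p c) (p d) z = 0" "orient (p e) (p f) z = 0"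
    using assms that unfolding general_position_def by blast
qed

lemma finite_line_intersection:
  assumes gp: "general_position I p" and I: "a \<in> I" "b \<in> I" "c \<in> I" "d \<in> I" "distinct [a, b, c, d]"
  shows "finite {z. orient (p a) (p b) z = 0 \<and> orient (p c) (p d) z = 0}"
proof -
  have ne: "p a \<noteq> p b" "p c \<noteq> p d"
    using general_positionD(1)[OF gp] I by (auto simp: inj_on_def)
  have "orient (p a) (p b) (p c) \<noteq> 0"
    using general_positionD(2)[OF gp, of a b c] I by simp
  then have unique: "z = z'" if "orient (p a) (p b) z = 0" "orient (p c) (p d) z = 0"
      "orient (p a) (p b) z' = 0" "orient (p c) (p d) z' = 0" for z z'
    using two_common_points(1)[OF ne, of z z'] that by blast
  show ?thesis
  proof (cases "\<exists>z. orient (p a) (p b) z = 0 \<and> orient (p c) (p d) z = 0")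
    case True
    then obtain z where "orient (p a) (p b) z = 0 \<and> orient (p c) (p d) z = 0" ..
    then have "{z. orient (p a) (p b) z = 0 \<and> orient (p c) (p d) z = 0} \<subseteq> {z}"
      using unique by blast
    then show ?thesis
      by (rule finite_subset) simp
  next
    case False
    then have "{z. orient (p a) (p b) z = 0 \<and> orient (p c) (p d) z = 0} = {}"
      by blast
    then show ?thesis
      by (simp only: finite.emptyI)
  qed
qed

text \<open>A new point is bad only if it is an old point, lies on a line through two old points, or
  lies on a line through an old point and a crossing of two old lines. These are finitely many
  points and lines, and such a null set cannot fill a disc.\<close>

lemma general_position_extend:
  assumes fin: "finite I" and gp: "general_position I p" and x: "x \<notin> I" and \<delta>: "0 < \<delta>"
  shows "\<exists>w. dist w c < \<delta> \<and> general_position (insert x I) (p(x := w))"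
proof -
  define J where "J = {(a, b, c, d). a \<in> I \<and> b \<in> I \<and> c \<in> I \<and> d \<in> I \<and> distinct [a, b, c, d]}"
  define Z where "Z = (\<Union>(a, b, c, d)\<in>J. {z. orient (p a) (p b) z = 0 \<and> orient (p c) (p d) z = 0})"
  have "finite J"
    by (rule finite_subset[of _ "I \<times> I \<times> I \<times> I"]) (simp_all add: J_def fin subset_iff)
  then have fin_Z: "finite Z"
    unfolding Z_def using finite_line_intersection[OF gp] by (intro finite_UN_I) (auto simp: J_def)
  define L where "L = {(u, v). u \<in> p ` I \<and> v \<in> p ` I \<union> Z \<and> u \<noteq> v}"
  have fin_L: "finite L"
    by (rule finite_subset[of _ "p ` I \<times> (p ` I \<union> Z)"]) (use fin fin_Z in \<open>auto simp: L_def\<close>)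
  define Bad where "Bad = p ` I \<union> (\<Union>(u, v)\<in>L. {z. orient u v z = 0})"
  have "negligible (\<Union>((\<lambda>(u, v). {z. orient u v z = 0}) ` L))"
    using fin_L by (intro negligible_Union) (auto simp: L_def intro!: negligible_line)
  then have "negligible Bad"
    unfolding Bad_def using fin by (intro negligible_Un) (auto intro: negligible_finite)
  moreover have "\<not> negligible (ball c \<delta>)"
    using \<delta> by (intro open_not_negligible) auto
  ultimately have "\<not> ball c \<delta> \<subseteq> Bad"
    using negligible_subset by blast
  then obtain w where "w \<in> ball c \<delta>" and w_Bad: "w \<notin> Bad"
    by blast
  then have w: "dist w c < \<delta>" "w \<notin> Bad"
    by (simp_all add: dist_commute)
  define p' where "p' = p(x := w)"
  have p': "p' x = w" "\<And>i. i \<in> I \<Longrightarrow> p' i = p i"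
    using x by (auto simp: p'_def)
  have w_pt: "w \<noteq> p i" if "i \<in> I" for i
    using w(2) that by (auto simp: Bad_def)
  have w_line: "orient (p i) v w \<noteq> 0" if "i \<in> I" "v \<in> p ` I \<union> Z" "p i \<noteq> v" for i v
    using w(2) that unfolding Bad_def L_def by blast
  have three: "orient w (p i) (p j) \<noteq> 0" if "i \<in> I" "j \<in> I" "i \<noteq> j" for i j
    using w_line[of i "p j"] that general_positionD(1)[OF gp] by (auto simp: inj_on_def orient_cyclic)
  \<comment> \<open>If the line through \<open>w\<close> and \<open>p i\<close> passed through a
    crossing \<open>z\<close> of two old lines, then \<open>w\<close> would lie on the line through
    \<open>p i\<close> and \<open>z\<close>, which was avoided.\<close>
  have six: False if I: "i \<in> I" "a \<in> I" "b \<in> I" "c \<in> I" "d \<in> I" "distinct [i, a, b, c, d]"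
    and z: "orient w (p i) z = 0" "orient (p a) (p b) z = 0" "orient (p c) (p d) z = 0" for i a b c d z
  proof -
    have "(a, b, c, d) \<in> J"
      using I by (auto simp: J_def)
    then have "z \<in> Z"
      using z(2,3) unfolding Z_def by blast
    moreover have "p i \<noteq> z"
      using general_positionD(2)[OF gp, of a b i] I z(2) by auto
    ultimately have "orient (p i) z w \<noteq> 0"
      using w_line I(1) by blast
    then show False
      using z(1) by (simp add: orient_cyclic)
  qed
  have "general_position (insert x I) p'"
    unfolding general_position_def
  proof (intro conjI ballI impI)
    show "inj_on p' (insert x I)"
    proof -
      have "inj_on p' I"
        using general_positionD(1)[OF gp] p'(2) by (simp add: inj_on_def)
      moreover have "p' x \<notin> p' ` I"
      proof
        assume "p' x \<in> p' ` I"
        then obtain i where "i \<in> I" "p' x = p' i"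
          by auto
        then show False
          using w_pt p' by simp
      qed
      ultimately show ?thesis
        by (auto simp: inj_on_insert)
    qed
  next
    fix i j k assume ijk: "i \<in> insert x I" "j \<in> insert x I" "k \<in> insert x I" "distinct [i, j, k]"
    then consider "i = x" "j \<in> I" "k \<in> I" | "j = x" "i \<in> I" "k \<in> I" | "k = x" "i \<in> I" "j \<in> I"
      | "i \<in> I" "j \<in> I" "k \<in> I"
      by auto
    then show "orient (p' i) (p' j) (p' k) \<noteq> 0"
    proof cases
      case 1
      then show ?thesis
        using three[of j k] ijk p' by simp
    next
      case 2
      then show ?thesis
        using three[of k i] ijk p' orient_cyclic[of w "p k" "p i"] by auto
    next
      case 3
      then show ?thesis
        using three[of i j] ijk p' orient_cyclic[of "p i" "p j" w] by auto
    next
      case 4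
      then show ?thesis
        using general_positionD(2)[OF gp] ijk p' by simp
    qed
  next
    fix a b c d e f
    assume I: "a \<in> insert x I" "b \<in> insert x I" "c \<in> insert x I" "d \<in> insert x I" "e \<in> insert x I" "f \<in> insert x I"
      and dist: "distinct [a, b, c, d, e, f]"
    show "\<not> (\<exists>z. orient (p' a) (p' b) z = 0 \<and> orient (p' c) (p' d) z = 0 \<and> orient (p' e) (p' f) z = 0)"
    proof
      assume "\<exists>z. orient (p' a) (p' b) z = 0 \<and> orient (p' c) (p' d) z = 0 \<and> orient (p' e) (p' f) z = 0"
      then obtain z where z: "orient (p' a) (p' b) z = 0" "orient (p' c) (p' d) z = 0" "orient (p' e) (p' f) z = 0"
        by blast
      then have z': "orient (p' b) (p' a) z = 0" "orient (p' d) (p' c) z = 0" "orient (p' f) (p' e) z = 0"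
        by (simp_all add: orient_swap(1)[of "p' a" "p' b"] orient_swap(1)[of "p' c" "p' d"] orient_swap(1)[of "p' e" "p' f"])
      show False
      proof (cases "x \<in> {a, b, c, d, e, f}")
        case True
        then consider "x = a" | "x = b" | "x = c" | "x = d" | "x = e" | "x = f"
          by blast
        then show False
        proof cases
          case 1
          then have "b \<in> I" "c \<in> I" "d \<in> I" "e \<in> I" "f \<in> I"
            using I dist by auto
          then show False
            using six[of b c d e f z] dist z 1 p' by auto
        next
          case 2
          then have "a \<in> I" "c \<in> I" "d \<in> I" "e \<in> I" "f \<in> I"
            using I dist by auto
          then show False
            using six[of a c d e f z] dist z z' 2 p' by auto
        next
          case 3
          then have "a \<in> I" "b \<in> I" "d \<in> I" "e \<in> I" "f \<in> I"
            using I dist by auto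
          then show False
            using six[of d a b e f z] dist z z' 3 p' by auto
        next
          case 4
          then have "a \<in> I" "b \<in> I" "c \<in> I" "e \<in> I" "f \<in> I"
            using I dist by auto
          then show False
            using six[of c a b e f z] dist z z' 4 p' by auto
        next
          case 5
          then have "a \<in> I" "b \<in> I" "c \<in> I" "d \<in> I" "f \<in> I"
            using I dist by auto
          then show False
            using six[of f a b c d z] dist z z' 5 p' by auto
        next
          case 6
          then have "a \<in> I" "b \<in> I" "c \<in> I" "d \<in> I" "e \<in> I"
            using I dist by auto
          then show False
            using six[of e a b c d z] dist z z' 6 p' by auto
        qed
      next
        case False
        then have "a \<in> I" "b \<in> I" "c \<in> I" "d \<in> I" "e \<in> I" "f \<in> I"
          using I by auto
        then show False
          using general_positionD(3)[OF gp _ _ _ _ _ _ dist, of z] z p' by simp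
      qed
    qed
  qed
  then show ?thesis
    using w(1) by (auto simp: p'_def)
qed

lemma general_position_exists:
  assumes "finite I" "0 < \<delta>"
  shows "\<exists>p. (\<forall>i\<in>I. dist (p i) (q i) < \<delta>) \<and> general_position I p"
  using assms(1)
proof (induction I rule: finite_induct)
  case empty
  then show ?case
    by (simp add: general_position_def)
next
  case (insert x I)
  then obtain p where p: "\<forall>i\<in>I. dist (p i) (q i) < \<delta>" "general_position I p"
    by blast
  obtain w where w: "dist w (q x) < \<delta>" "general_position (insert x I) (p(x := w))"
    using general_position_extend[OF insert.hyps(1) p(2) insert.hyps(2) assms(2)] by blast
  have "\<forall>i\<in>insert x I. dist ((p(x := w)) i) (q i) < \<delta>"
    using p(1) w(1) insert.hyps(2) by auto
  then show ?case
    using w(2) by blast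
qed

section \<open>Stability of orientation signs under perturbation\<close>

lemma orient_stable:
  assumes "orient a b c \<noteq> 0"
  shows "\<exists>\<delta>>0. \<forall>a' b' c'. dist a' a < \<delta> \<and> dist b' b < \<delta> \<and> dist c' c < \<delta> \<longrightarrow>
    sgn (orient a' b' c') = sgn (orient a b c)"
proof -
  define h where "h u = orient (fst u) (fst (snd u)) (snd (snd u))" for u :: "complex \<times> complex \<times> complex"
  have "continuous_on UNIV h"
    unfolding h_def orient_def by (intro continuous_intros)
  then have "isCont h (a, b, c)"
    by (simp add: continuous_on_eq_continuous_at)
  moreover have "0 < \<bar>h (a, b, c)\<bar>"
    using assms by (simp add: h_def)
  ultimately obtain d where d: "d > 0" "\<And>u. dist u (a, b, c) < d \<Longrightarrow> dist (h u) (h (a, b, c)) < \<bar>h (a, b, c)\<bar>"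
    unfolding continuous_at by (metis (no_types, lifting) LIM_def dist_self)
  show ?thesis
  proof (intro exI[of _ "d / 3"] conjI allI impI)
    fix a' b' c' assume near: "dist a' a < d / 3 \<and> dist b' b < d / 3 \<and> dist c' c < d / 3"
    have "dist (a', b', c') (a, b, c) \<le> dist a' a + (dist b' b + dist c' c)"
      unfolding dist_norm diff_Pair
      by (rule order_trans[OF norm_Pair_le]) (intro add_left_mono norm_Pair_le)
    then have "dist (h (a', b', c')) (h (a, b, c)) < \<bar>h (a, b, c)\<bar>"
      using near by (intro d(2)) linarith
    then show "sgn (orient a' b' c') = sgn (orient a b c)"
      by (auto simp: h_def dist_real_def sgn_if abs_if split: if_splits)
  qed (use d in auto)
qed

lemma orient_stable_finite:
  assumes fin: "finite I"
  shows "\<exists>\<delta>>0. \<forall>p. (\<forall>i\<in>I. dist (p i) (q i) < \<delta>) \<longrightarrow>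
    (\<forall>i\<in>I. \<forall>j\<in>I. \<forall>k\<in>I. orient (q i) (q j) (q k) \<noteq> 0 \<longrightarrow>
      sgn (orient (p i) (p j) (p k)) = sgn (orient (q i) (q j) (q k)))"
proof -
  define S where "S = {(i, j, k). i \<in> I \<and> j \<in> I \<and> k \<in> I \<and> orient (q i) (q j) (q k) \<noteq> 0}"
  have fin_S: "finite S"
    by (rule finite_subset[of _ "I \<times> I \<times> I"]) (use fin in \<open>auto simp: S_def\<close>)
  have "\<exists>\<delta>. \<delta> > 0 \<and> (orient a b c \<noteq> 0 \<longrightarrow> (\<forall>a' b' c'. dist a' a < \<delta> \<and> dist b' b < \<delta> \<and> dist c' c < \<delta> \<longrightarrow>
    sgn (orient a' b' c') = sgn (orient a b c)))" for a b c
    using orient_stable[of a b c] zero_less_one by (cases "orient a b c = 0") blast+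
  then obtain \<Delta> where \<Delta>: "\<And>a b c. \<Delta> a b c > (0::real)"
    "\<And>a b c a' b' c'. orient a b c \<noteq> 0 \<Longrightarrow> dist a' a < \<Delta> a b c \<Longrightarrow> dist b' b < \<Delta> a b c \<Longrightarrow>
      dist c' c < \<Delta> a b c \<Longrightarrow> sgn (orient a' b' c') = sgn (orient a b c)"
    by metis
  define D where "D = insert 1 ((\<lambda>(i, j, k). \<Delta> (q i) (q j) (q k)) ` S)"
  have fin_D: "finite D"
    using fin_S by (simp add: D_def)
  show ?thesis
  proof (intro exI[of _ "Min D"] conjI allI impI ballI)
    show "0 < Min D"
      using fin_D \<Delta>(1) by (subst Min_gr_iff) (auto simp: D_def)
    fix p i j k assume p: "\<forall>i\<in>I. dist (p i) (q i) < Min D" and ijk: "i \<in> I" "j \<in> I" "k \<in> I"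
      and nz: "orient (q i) (q j) (q k) \<noteq> 0"
    have "(i, j, k) \<in> S"
      using ijk nz by (simp add: S_def)
    then have "Min D \<le> \<Delta> (q i) (q j) (q k)"
      using fin_D unfolding D_def by (intro Min_le) force+
    then show "sgn (orient (p i) (p j) (p k)) = sgn (orient (q i) (q j) (q k))"
      using p ijk by (intro \<Delta>(2) nz) (auto intro: less_le_trans)
  qed
qed

section \<open>Polygonal drawings\<close>

text \<open>Every edge is drawn with four segments; \<open>Bend d\<close> is the bend next to the start of the dart \<open>d\<close>.\<close>

datatype ('v, 'e) node = Node 'v | Middle 'e | Bend "'e dart"

definition nodes :: "('v, 'e) pre_digraph \<Rightarrow> ('v, 'e) node set" where
  "nodes G = Node ` verts G \<union> Middle ` arcs G \<union> Bend ` darts G"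

text \<open>The indices 0 to 4 run through the five nodes along the dart; larger indices also give
  the end node.\<close>

definition dnode :: "('v, 'e) pre_digraph \<Rightarrow> 'e dart \<Rightarrow> nat \<Rightarrow> ('v, 'e) node" where
  "dnode G d q = (if q = 0 then Node (dstart G d) else if q = 1 then Bend d
     else if q = 2 then Middle (fst d) else if q = 3 then Bend (rev_dart d) else Node (dend G d))"

lemma less_4_cases: "q < 4 \<Longrightarrow> q = 0 \<or> q = 1 \<or> q = 2 \<or> q = (3::nat)"
  by auto

lemma dnode_rev: "q \<le> 4 \<Longrightarrow> dnode G (rev_dart d) q = dnode G d (4 - q)"
  by (auto simp: dnode_def)

lemma dnode_in_nodes:
  assumes "wf_digraph G" "d \<in> darts G"
  shows "dnode G d q \<in> nodes G"
  using assms wf_digraph.dstart_in_verts[OF assms(1)]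
  by (auto simp: dnode_def nodes_def darts_def mem_Times_iff)

lemma dnode_Suc_neq: "q < 4 \<Longrightarrow> dnode G d q \<noteq> dnode G d (Suc q)"
  by (auto simp: dnode_def dest: less_4_cases)

text \<open>Every segment ends at a bend, and a bend belongs to one half of one edge. So segments of
  parallel edges, or of the two halves of a loop, never have the same pair of end nodes.\<close>

lemma segment_determined:
  assumes "q < 4" "q' < 4" "{dnode G (e, True) q, dnode G (e, True) (Suc q)} = {dnode G (e', True) q', dnode G (e', True) (Suc q')}"
  shows "e = e' \<and> q = q'"
  using less_4_cases[OF assms(1)] less_4_cases[OF assms(2)] assms(3)
  by (elim disjE) (auto simp: dnode_def doubleton_eq_iff)

definition draw :: "('v, 'e) pre_digraph \<Rightarrow> (('v, 'e) node \<Rightarrow> complex) \<Rightarrow> ('v, 'e) gpoint \<Rightarrow> complex" where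
  "draw G p x = (case x of Vertex v \<Rightarrow> p (Node v) | Inner e t \<Rightarrow>
     (let q = nat \<lfloor>4 * t\<rfloor> in of_real (1 - (4 * t - q)) * p (dnode G (e, True) q) +
       of_real (4 * t - q) * p (dnode G (e, True) (Suc q))))"

lemma draw_edge_map:
  assumes "q < 4" "r \<in> {0..1}"
  shows "draw G p (edge_map G e ((real q + r) / 4)) =
    of_real (1 - r) * p (dnode G (e, True) q) + of_real r * p (dnode G (e, True) (Suc q))"
proof -
  define t where "t = (real q + r) / 4"
  show ?thesis
  proof (cases "t = 0 \<or> t = 1")
    case True
    then have "q = 0 \<and> r = 0 \<or> q = 3 \<and> r = 1"
      using assms less_4_cases[OF assms(1)] by (auto simp: t_def)
    then show ?thesis
      by (auto simp: draw_def edge_map_def dnode_def dstart_def)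
  next
    case False
    then have em: "edge_map G e t = Inner e t"
      by (simp add: edge_map_def)
    show ?thesis
    proof (cases "r = 1")
      case True
      \<comment> \<open>At the end of a segment the floor already names the next one, whose far node
        then gets the coefficient 0.\<close>
      then have t4: "4 * t = real (Suc q)"
        by (simp add: t_def)
      then have "nat \<lfloor>4 * t\<rfloor> = Suc q"
        by (simp only: floor_of_nat nat_int)
      then show ?thesis
      proof -
        have "draw G p (Inner e t) = of_real (1 - (4 * t - real (Suc q))) * p (dnode G (e, True) (Suc q)) +
            of_real (4 * t - real (Suc q)) * p (dnode G (e, True) (Suc (Suc q)))"
          using \<open>nat \<lfloor>4 * t\<rfloor> = Suc q\<close> by (simp only: draw_def gpoint.case Let_def)
        also have "\<dots> = p (dnode G (e, True) (Suc q))"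
          unfolding t4 by simp
        finally show ?thesis
          unfolding t_def[symmetric] em using True by simp
      qed
    next
      case False
      have t4: "4 * t = real q + r"
        unfolding t_def by simp
      then have "\<lfloor>4 * t\<rfloor> = int q"
        using assms \<open>r \<noteq> 1\<close> by (intro floor_unique) auto
      then have "nat \<lfloor>4 * t\<rfloor> = q" "4 * t - real q = r"
        using t4 by simp_all
      then show ?thesis
        unfolding t_def[symmetric] em by (simp only: draw_def gpoint.case Let_def)
    qed
  qed
qed

lemma draw_dpoint:
  assumes "q < 4" "r \<in> {0..1}"
  shows "draw G p (dpoint G d ((real q + r) / 4)) =
    of_real (1 - r) * p (dnode G d q) + of_real r * p (dnode G d (Suc q))"
proof (cases "snd d")
  case True
  then have "d = (fst d, True)"
    by (simp add: prod_eq_iff)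
  then show ?thesis
    using draw_edge_map[OF assms, of G p "fst d"] True by (simp add: dpoint_def)
next
  case False
  then have d: "(fst d, True) = rev_dart d"
    by (simp add: prod_eq_iff)
  have "dpoint G d ((real q + r) / 4) = edge_map G (fst d) ((real (3 - q) + (1 - r)) / 4)"
    using False assms by (simp add: dpoint_def of_nat_diff field_simps)
  then have "draw G p (dpoint G d ((real q + r) / 4)) = of_real r * p (dnode G (rev_dart d) (3 - q)) + of_real (1 - r) * p (dnode G (rev_dart d) (Suc (3 - q)))"
    using assms draw_edge_map[of "3 - q" "1 - r" G p "fst d"] by (simp add: d)
  moreover have "dnode G (rev_dart d) (3 - q) = dnode G d (Suc q)" "dnode G (rev_dart d) (Suc (3 - q)) = dnode G d q"
    using assms(1) by (auto simp: dnode_rev Suc_diff_le numeral_eq_Suc)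
  ultimately show ?thesis
    by simp
qed

definition node_point :: "('v, 'e) node \<Rightarrow> ('v, 'e) gpoint" where
  "node_point i = (case i of Node v \<Rightarrow> Vertex v | Middle e \<Rightarrow> Inner e (1/2)
     | Bend d \<Rightarrow> Inner (fst d) (if snd d then 1/4 else 3/4))"

lemma draw_node_point: "draw G p (node_point i) = p i"
proof (cases i)
  case (Node v)
  then show ?thesis
    by (simp add: node_point_def draw_def)
next
  case (Middle e)
  then show ?thesis
    using draw_edge_map[of 2 0 G p e] by (simp add: node_point_def edge_map_def dnode_def)
next
  case (Bend d)
  then show ?thesis
    using draw_edge_map[of 1 0 G p "fst d"] draw_edge_map[of 3 0 G p "fst d"]
    by (cases d; cases "snd d") (auto simp: node_point_def edge_map_def dnode_def)
qed

lemma Inner_cases: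
  assumes "t \<in> {0<..<1}"
  shows "(\<exists>q\<in>{1, 2, 3}. Inner e t = node_point (dnode G (e, True) q)) \<or>
    (\<exists>q<4. \<exists>r\<in>{0<..<1}. t = (real q + r) / 4)"
proof -
  define q where "q = nat \<lfloor>4 * t\<rfloor>"
  define r where "r = 4 * t - real q"
  have q: "real q = of_int \<lfloor>4 * t\<rfloor>"
    using assms by (simp add: q_def)
  have r: "0 \<le> r" "r < 1"
    unfolding r_def q by linarith+
  have "real q < 4"
    using assms r by (auto simp: r_def)
  then have q4: "q < 4"
    by simp
  have t: "t = (real q + r) / 4"
    by (simp add: r_def)
  show ?thesis
  proof (cases "r = 0")
    case True
    then have "q \<noteq> 0"
      using assms t by auto
    then have "q \<in> {1, 2, 3}"
      using q4 by auto
    moreover from this have "Inner e t = node_point (dnode G (e, True) q)"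
      using t True by (auto simp: node_point_def dnode_def)
    ultimately show ?thesis
      by blast
  next
    case False
    then show ?thesis
      using r q4 t by auto
  qed
qed

lemma gpoints_cases:
  assumes "wf_digraph G" "x \<in> gpoints G"
  shows "(\<exists>i\<in>nodes G. x = node_point i) \<or>
    (\<exists>e\<in>arcs G. \<exists>q<4. \<exists>r\<in>{0<..<1}. x = Inner e ((real q + r) / 4))"
proof -
  consider v where "x = Vertex v" "v \<in> verts G" | e t where "x = Inner e t" "e \<in> arcs G" "t \<in> {0<..<1}"
    using assms(2) by (auto simp: gpoints_def)
  then show ?thesis
  proof cases
    case (1 v)
    then have "x = node_point (Node v)" "Node v \<in> nodes G"
      by (auto simp: node_point_def nodes_def)
    then show ?thesis
      by blast
  next
    case (2 e t)
    then have "(e, True) \<in> darts G"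
      by (simp add: darts_def)
    then show ?thesis
      using Inner_cases[OF 2(3), of e G] dnode_in_nodes[OF assms(1)] 2 by blast
  qed
qed

lemma draw_open_segment:
  assumes "q < 4" "r \<in> {0<..<1}"
  shows "draw G p (Inner e ((real q + r) / 4)) =
    of_real (1 - r) * p (dnode G (e, True) q) + of_real r * p (dnode G (e, True) (Suc q))"
proof -
  have "edge_map G e ((real q + r) / 4) = Inner e ((real q + r) / 4)"
  proof -
    have "real q \<le> 3"
      using assms(1) by simp
    then show ?thesis
      using assms(2) by (auto simp: edge_map_def)
  qed
  then show ?thesis
    using draw_edge_map[of q r G p e] assms by simp
qed

lemma orient_convex: "orient a b (of_real (1 - r) * a + of_real r * b) = 0"
  by (simp add: orient_coords algebra_simps)

text \<open>A meeting point other than \<open>c\<close> would put \<open>u'\<close> on the line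
  through \<open>c\<close> and \<open>u\<close>.\<close>

lemma open_segments_share:
  assumes "orient c u u' \<noteq> 0" "0 < r" "0 < (r'::real)"
  shows "of_real (1 - r) * c + of_real r * u \<noteq> of_real (1 - r') * c + of_real r' * u'"
proof
  assume eq: "of_real (1 - r) * c + of_real r * u = of_real (1 - r') * c + of_real r' * u'"
  have "orient c u (of_real (1 - r') * c + of_real r' * u') = r' * orient c u u'"
    by (simp add: orient_coords algebra_simps)
  moreover have "orient c u (of_real (1 - r) * c + of_real r * u) = 0"
    by (rule orient_convex)
  ultimately show False
    using assms eq by simp
qed

text \<open>In general position no node lies inside a segment, and two segments with a common end
  node meet only there, because no three nodes are collinear. What remains are crossings of segments
  with four different end nodes; local injectivity and genericity both rest on this.\<close>

lemma draw_coincide: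
  assumes wf: "wf_digraph G" and gp: "general_position (nodes G) p"
    and x: "x \<in> gpoints G" and y: "y \<in> gpoints G" and xy: "x \<noteq> y" "draw G p x = draw G p y"
  obtains e q r e' q' r' where "e \<in> arcs G" "q < 4" "r \<in> {0<..<1}" "e' \<in> arcs G" "q' < 4" "r' \<in> {0<..<1}"
    "x = Inner e ((real q + r) / 4)" "y = Inner e' ((real q' + r') / 4)"
    "{dnode G (e, True) q, dnode G (e, True) (Suc q)} \<inter> {dnode G (e', True) q', dnode G (e', True) (Suc q')} = {}"
proof -
  note inj = general_positionD(1)[OF gp] and three = general_positionD(2)[OF gp]
  have in_nodes: "dnode G (e, True) q \<in> nodes G" if "e \<in> arcs G" for e q
    using that by (intro dnode_in_nodes[OF wf]) (simp add: darts_def)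
  have node_seg: "p i \<noteq> draw G p (Inner e ((real q + r) / 4))"
    if i: "i \<in> nodes G" and e: "e \<in> arcs G" and q: "q < 4" and r: "r \<in> {0<..<1}" for i e q r
  proof
    define a where "a = dnode G (e, True) q"
    define b where "b = dnode G (e, True) (Suc q)"
    assume "p i = draw G p (Inner e ((real q + r) / 4))"
    then have eq: "p i = of_real (1 - r) * p a + of_real r * p b"
      using draw_open_segment[OF q r] by (simp add: a_def b_def)
    have ab: "a \<in> nodes G" "b \<in> nodes G" "a \<noteq> b"
      using in_nodes[OF e] dnode_Suc_neq[OF q, of G "(e, True)"] by (simp_all add: a_def b_def)
    then have pab: "p a \<noteq> p b"
      using inj by (auto simp: inj_on_def)
    have "orient (p a) (p b) (p i) = 0"
      unfolding eq by (rule orient_convex)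
    then have "i = a \<or> i = b"
      using three[OF ab(1,2) i] ab(3) by auto
    then show False
    proof
      assume "i = a"
      then have "of_real r * (p b - p a) = 0"
        using eq by (auto simp: algebra_simps)
      then show False
        using r pab by auto
    next
      assume "i = b"
      then have "of_real (1 - r) * (p b - p a) = 0"
        using eq by (auto simp: algebra_simps)
      then show False
        using r pab by auto
    qed
  qed
  from gpoints_cases[OF wf x] gpoints_cases[OF wf y] consider
      (nn) i j where "i \<in> nodes G" "j \<in> nodes G" "x = node_point i" "y = node_point j"
    | (ns) i e q r where "i \<in> nodes G" "e \<in> arcs G" "q < 4" "r \<in> {0<..<1}"
        "x = node_point i \<and> y = Inner e ((real q + r) / 4) \<or> y = node_point i \<and> x = Inner e ((real q + r) / 4)"
    | (ss) e q r e' q' r' where "e \<in> arcs G" "q < 4" "r \<in> {0<..<1}" "x = Inner e ((real q + r) / 4)"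
        "e' \<in> arcs G" "q' < 4" "r' \<in> {0<..<1}" "y = Inner e' ((real q' + r') / 4)"
    by blast
  then show ?thesis
  proof cases
    case nn
    then show ?thesis
      using xy inj by (auto simp: draw_node_point inj_on_def)
  next
    case ns
    then show ?thesis
      using node_seg[OF ns(1-4)] xy by (auto simp: draw_node_point)
  next
    case ss
    define a where "a = dnode G (e, True) q"
    define b where "b = dnode G (e, True) (Suc q)"
    define a' where "a' = dnode G (e', True) q'"
    define b' where "b' = dnode G (e', True) (Suc q')"
    have nd: "a \<in> nodes G" "b \<in> nodes G" "a' \<in> nodes G" "b' \<in> nodes G" "a \<noteq> b" "a' \<noteq> b'"
      using in_nodes[OF ss(1)] in_nodes[OF ss(5)] dnode_Suc_neq[OF ss(2), of G "(e, True)"]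
        dnode_Suc_neq[OF ss(6), of G "(e', True)"] by (simp_all add: a_def b_def a'_def b'_def)
    have eq: "of_real (1 - r) * p a + of_real r * p b = of_real (1 - r') * p a' + of_real r' * p b'"
      using xy(2) draw_open_segment[OF ss(2,3), of G p e] draw_open_segment[OF ss(6,7), of G p e']
      unfolding a_def b_def a'_def b'_def ss(4,8) by simp
    have eq2: "of_real (1 - (1 - r)) * p b + of_real (1 - r) * p a = of_real (1 - r) * p a + of_real r * p b"
      "of_real (1 - (1 - r')) * p b' + of_real (1 - r') * p a' = of_real (1 - r') * p a' + of_real r' * p b'"
      by simp_all
    have r: "0 < r" "0 < 1 - r" "0 < r'" "0 < 1 - r'"
      using ss by auto
    have "{a, b} \<noteq> {a', b'}"
    proof
      assume same: "{a, b} = {a', b'}"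
      have "e = e' \<and> q = q'"
        by (rule segment_determined[OF ss(2,6) same[unfolded a_def b_def a'_def b'_def]])
      then have "e = e'" "q = q'"
        by simp_all
      then have "a = a'" "b = b'"
        by (simp_all add: a_def b_def a'_def b'_def)
      then have "of_real (r' - r) * (p b - p a) = 0"
        using eq by (simp add: algebra_simps)
      moreover have "p a \<noteq> p b"
        using inj nd by (auto simp: inj_on_def)
      ultimately have "r = r'"
        by simp
      then show False
        using xy(1) ss \<open>e = e'\<close> \<open>q = q'\<close> by simp
    qed
    then have ne: "\<not> (a = a' \<and> b = b')" "\<not> (a = b' \<and> b = a')"
      by auto
    have "a \<noteq> a'"
    proof
      assume h: "a = a'"
      then have "orient (p a) (p b) (p b') \<noteq> 0"
        using nd ne by (intro three) auto
      then show False
        using open_segments_share[of "p a" "p b" "p b'" r r'] r eq h by simp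
    qed
    moreover have "a \<noteq> b'"
    proof
      assume h: "a = b'"
      then have "orient (p a) (p b) (p a') \<noteq> 0"
        using nd ne by (intro three) auto
      then show False
        using open_segments_share[of "p a" "p b" "p a'" r "1 - r'"] r eq eq2 h by simp
    qed
    moreover have "b \<noteq> a'"
    proof
      assume h: "b = a'"
      then have "orient (p b) (p a) (p b') \<noteq> 0"
        using nd ne by (intro three) auto
      then show False
        using open_segments_share[of "p b" "p a" "p b'" "1 - r" r'] r eq eq2 h by simp
    qed
    moreover have "b \<noteq> b'"
    proof
      assume h: "b = b'"
      then have "orient (p b) (p a) (p a') \<noteq> 0"
        using nd ne by (intro three) auto
      then show False
        using open_segments_share[of "p b" "p a" "p a'" "1 - r" "1 - r'"] r eq eq2 h by simp
    qed
    ultimately have "{a, b} \<inter> {a', b'} = {}"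
      by auto
    then show ?thesis
      using ss(1-3,5-7,4,8) unfolding a_def b_def a'_def b'_def by (rule that[rotated 8])
  qed
qed

section \<open>The drawing is a plane generic immersion\<close>

lemma span_complex_basis:
  assumes "Im (cnj u * v) \<noteq> 0"
  shows "span {u, v} = (UNIV :: complex set)"
proof -
  have "w \<in> span {u, v}" for w
  proof -
    define D where "D = Re u * Im v - Im u * Re v"
    have D: "D \<noteq> 0"
      using assms by (simp add: D_def)
    \<comment> \<open>Cramer's rule with the determinant \<open>D\<close> of \<open>u\<close> and
      \<open>v\<close>.\<close>
    have "w = ((Re w * Im v - Im w * Re v) / D) *\<^sub>R u + ((Re u * Im w - Im u * Re w) / D) *\<^sub>R v"
      using D by (simp add: complex_eq_iff field_simps) (simp add: D_def algebra_simps)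
    moreover have "((Re w * Im v - Im w * Re v) / D) *\<^sub>R u + ((Re u * Im w - Im u * Re w) / D) *\<^sub>R v \<in> span {u, v}"
      by (intro span_add span_scale span_base) auto
    ultimately show ?thesis
      by simp
  qed
  then show ?thesis
    by blast
qed

lemma draw_has_vector_derivative:
  assumes "q < 4" "r \<in> {0<..<1}"
  shows "((draw G p \<circ> edge_map G e) has_vector_derivative
    4 * (p (dnode G (e, True) (Suc q)) - p (dnode G (e, True) q))) (at ((real q + r) / 4))"
proof -
  define a where "a = p (dnode G (e, True) q)"
  define b where "b = p (dnode G (e, True) (Suc q))"
  define l where "l t = of_real (1 - (4 * t - real q)) * a + of_real (4 * t - real q) * b" for t
  have "(l has_vector_derivative 4 * (b - a)) (at ((real q + r) / 4))"
    unfolding l_def has_vector_derivative_def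
    by (auto intro!: derivative_eq_intros simp: fun_eq_iff scaleR_conv_of_real algebra_simps)
  moreover have "l t = (draw G p \<circ> edge_map G e) t" if "t \<in> {real q / 4<..<(real q + 1) / 4}" for t
    using draw_edge_map[OF assms(1), of "4 * t - real q" G p e] that by (simp add: l_def a_def b_def)
  ultimately have "((draw G p \<circ> edge_map G e) has_vector_derivative 4 * (b - a)) (at ((real q + r) / 4))"
    using assms by (elim has_vector_derivative_transform_within_open[where S = "{real q / 4<..<(real q + 1) / 4}"]) auto
  then show ?thesis
    by (simp add: a_def b_def)
qed

lemma smooth_curve_on_affine:
  assumes "\<And>t. t \<in> S \<Longrightarrow> g t = a + of_real t * b"
  shows "smooth_curve_on g S"
proof -
  define D where "D k t = (if k = 0 then a + of_real t * b else if k = 1 then b else (0::complex))" for k :: nat and t :: real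
  have "(D k has_vector_derivative D (Suc k) t) (at t within S)" for k t
  proof (cases "k = 0")
    case True
    have "((\<lambda>t. a + of_real t * b) has_vector_derivative b) (at t within S)"
      unfolding has_vector_derivative_def
      by (auto intro!: derivative_eq_intros simp: fun_eq_iff scaleR_conv_of_real)
    then show ?thesis
      using True by (simp add: D_def[abs_def])
  next
    case False
    then have "D k = (\<lambda>_. if k = 1 then b else 0)" "D (Suc k) t = 0"
      by (auto simp: D_def fun_eq_iff)
    then show ?thesis
      by simp
  qed
  then show ?thesis
    using assms unfolding smooth_curve_on_def by (intro exI[of _ D]) (simp add: D_def)
qed

lemma quarters_division: "(\<lambda>q. {real q / 4..(real q + 1) / 4}) ` {..<4} division_of {0..1::real}"
proof (rule division_ofI)
  show "\<Union> ((\<lambda>q. {real q / 4..(real q + 1) / 4}) ` {..<4}) = {0..1::real}"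
  proof
    show "\<Union> ((\<lambda>q. {real q / 4..(real q + 1) / 4}) ` {..<4}) \<subseteq> {0..1::real}"
    proof
      fix t :: real assume "t \<in> \<Union> ((\<lambda>q. {real q / 4..(real q + 1) / 4}) ` {..<4})"
      then obtain q where "q < 4" "real q / 4 \<le> t" "t \<le> (real q + 1) / 4"
        by auto
      moreover from this have "real q \<le> 3"
        by simp
      ultimately show "t \<in> {0..1}"
        by simp
    qed
    show "{0..1::real} \<subseteq> \<Union> ((\<lambda>q. {real q / 4..(real q + 1) / 4}) ` {..<4})"
    proof
      fix t :: real assume t: "t \<in> {0..1}"
      have "\<exists>q<4. t \<in> {real q / 4..(real q + 1) / 4}"
      proof -
        consider "t \<le> 1/4" | "1/4 \<le> t" "t \<le> 1/2" | "1/2 \<le> t" "t \<le> 3/4" | "3/4 \<le> t"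
          by linarith
        then show ?thesis
        proof cases
          case 1
          then show ?thesis
            using t by (intro exI[of _ 0]) auto
        next
          case 2
          then show ?thesis
            using t by (intro exI[of _ 1]) auto
        next
          case 3
          then show ?thesis
            using t by (intro exI[of _ 2]) auto
        next
          case 4
          then show ?thesis
            using t by (intro exI[of _ 3]) auto
        qed
      qed
      then show "t \<in> \<Union> ((\<lambda>q. {real q / 4..(real q + 1) / 4}) ` {..<4})"
        by blast
    qed
  qed
  then show "K \<subseteq> {0..1}" if "K \<in> (\<lambda>q. {real q / 4..(real q + 1) / 4}) ` {..<4}" for K
    using that by blast
  show "\<exists>a b. K = cbox a b" if "K \<in> (\<lambda>q. {real q / 4..(real q + 1) / 4}) ` {..<4}" for K
    using that by auto
  show "K \<noteq> {}" if "K \<in> (\<lambda>q. {real q / 4..(real q + 1) / 4}) ` {..<4}" for K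
    using that by auto
  show "interior K1 \<inter> interior K2 = {}"
    if K: "K1 \<in> (\<lambda>q. {real q / 4..(real q + 1) / 4}) ` {..<4}"
      "K2 \<in> (\<lambda>q. {real q / 4..(real q + 1) / 4}) ` {..<4}" "K1 \<noteq> K2" for K1 K2
  proof -
    obtain i j where ij: "K1 = {real i / 4..(real i + 1) / 4}" "K2 = {real j / 4..(real j + 1) / 4}"
      using K by auto
    then have "i < j \<or> j < i"
      using K(3) by (metis nat_neq_iff)
    then have "real i + 1 \<le> real j \<or> real j + 1 \<le> real i"
      by linarith
    then show ?thesis
      by (auto simp: ij)
  qed
qed auto

lemma piecewise_smooth_draw: "piecewise_smooth (draw G p \<circ> edge_map G e)"
  unfolding piecewise_smooth_def
proof (intro exI conjI ballI)
  show "(\<lambda>q. {real q / 4..(real q + 1) / 4}) ` {..<4} division_of {0..1::real}"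
    by (rule quarters_division)
  fix K assume "K \<in> (\<lambda>q. {real q / 4..(real q + 1) / 4}) ` {..<(4::nat)}"
  then obtain q where q: "q < 4" "K = {real q / 4..(real q + 1) / 4}"
    by auto
  define a where "a = p (dnode G (e, True) q)"
  define b where "b = p (dnode G (e, True) (Suc q))"
  show "smooth_curve_on (draw G p \<circ> edge_map G e) K"
  proof (rule smooth_curve_on_affine)
    fix t assume "t \<in> K"
    then have "(draw G p \<circ> edge_map G e) t = of_real (1 - (4 * t - real q)) * a + of_real (4 * t - real q) * b"
      using draw_edge_map[OF q(1), of "4 * t - real q" G p e] by (simp add: q(2) a_def b_def)
    then show "(draw G p \<circ> edge_map G e) t = (of_real (1 + real q) * a - of_real (real q) * b) + of_real t * (4 * (b - a))"
      by (simp add: algebra_simps)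
  qed
qed

lemma continuous_on_draw: "continuous_on {0..1} (draw G p \<circ> edge_map G e)"
proof -
  obtain \<P> where \<P>: "\<P> division_of {0..1}" "\<forall>K\<in>\<P>. smooth_curve_on (draw G p \<circ> edge_map G e) K"
    using piecewise_smooth_draw[of G p e] by (auto simp: piecewise_smooth_def)
  have "continuous_on K (draw G p \<circ> edge_map G e)" if K: "K \<in> \<P>" for K
  proof -
    obtain D where D: "\<forall>t\<in>K. D 0 t = (draw G p \<circ> edge_map G e) t"
      "\<forall>k. \<forall>t\<in>K. (D k has_vector_derivative D (Suc k) t) (at t within K)"
      using \<P>(2) K unfolding smooth_curve_on_def by blast
    have "continuous_on K (D 0)"
      using D(2) has_vector_derivative_continuous by (fastforce simp: continuous_on_eq_continuous_within)
    then show ?thesis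
      using D(1) by (simp cong: continuous_on_cong)
  qed
  moreover have "finite \<P>" "\<And>K. K \<in> \<P> \<Longrightarrow> closed K"
    using \<P>(1) by (auto simp: division_of_def)
  ultimately have "continuous_on (\<Union>\<P>) (draw G p \<circ> edge_map G e)"
    using continuous_on_closed_Union[of \<P> "\<lambda>K. K" "draw G p \<circ> edge_map G e"] by simp
  then show ?thesis
    using \<P>(1) by (simp add: division_of_def)
qed

text \<open>Coinciding points lie on segments without a common node, so a neighbourhood that meets
  only open segments ending at one fixed node is mapped injectively. For a vertex these are the
  first quarters of its half-edges, for an inner point the two segments around a suitable bend or
  middle.\<close>

lemma locally_injective_draw:
  assumes wf: "wf_digraph G" and gp: "general_position (nodes G) p"
  shows "locally_injective (realization G) (draw G p)"
  unfolding locally_injective_def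
proof
  interpret wf_digraph G by fact
  have seg_lt: "(real q + r) / 4 < 1" if "q < 4" "r \<in> {0<..<1}" for q r
  proof -
    have "real q \<le> 3"
      using that(1) by simp
    then show ?thesis
      using that(2) by simp
  qed
  fix x assume "x \<in> topspace (realization G)"
  then have x: "x \<in> gpoints G"
    by (simp add: topspace_realization)
  have inj: "inj_on (draw G p) U"
    if U: "U \<subseteq> gpoints G" and i: "\<And>e q r. e \<in> arcs G \<Longrightarrow> q < 4 \<Longrightarrow> r \<in> {0<..<1} \<Longrightarrow>
      Inner e ((real q + r) / 4) \<in> U \<Longrightarrow> i \<in> {dnode G (e, True) q, dnode G (e, True) (Suc q)}" for U i
  proof (rule inj_onI, rule ccontr)
    fix y z assume yz: "y \<in> U" "z \<in> U" "draw G p y = draw G p z" "y \<noteq> z"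
    obtain e q r e' q' r' where *: "e \<in> arcs G" "q < 4" "r \<in> {0<..<1}" "e' \<in> arcs G" "q' < 4" "r' \<in> {0<..<1}"
      "y = Inner e ((real q + r) / 4)" "z = Inner e' ((real q' + r') / 4)"
      "{dnode G (e, True) q, dnode G (e, True) (Suc q)} \<inter> {dnode G (e', True) q', dnode G (e', True) (Suc q')} = {}"
      by (rule draw_coincide[OF wf gp subsetD[OF U yz(1)] subsetD[OF U yz(2)] yz(4,3)])
    then show False
      using i[of e q r] i[of e' q' r'] yz by blast
  qed
  consider (v) v where "x = Vertex v" "v \<in> verts G" | (e) e t where "x = Inner e t" "e \<in> arcs G" "t \<in> {0<..<1}"
    using x by (auto simp: gpoints_def)
  then show "\<exists>U. openin (realization G) U \<and> x \<in> U \<and> inj_on (draw G p) U"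
  proof cases
    case v
    define U where "U = {Vertex v} \<union> {Inner e t | e t. e \<in> arcs G \<and> t \<in> {0<..<1} \<and>
      (tail G e = v \<and> t < 1/4 \<or> head G e = v \<and> 3/4 < t)}"
    have sub: "U \<subseteq> gpoints G"
      using v by (auto simp: U_def gpoints_def)
    have "openin (realization G) U"
      unfolding openin_realization gopen_def
    proof (intro conjI ballI sub)
      fix e assume e: "e \<in> arcs G"
      have "{t \<in> {0..1}. edge_map G e t \<in> U} = {0..1} \<inter> ({t. tail G e = v \<and> t < 1/4} \<union> {t. head G e = v \<and> 3/4 < t})"
        using e by (auto simp: U_def edge_map_def)
      moreover have "open ({t. tail G e = v \<and> t < 1/4} \<union> {t. head G e = v \<and> 3/4 < (t::real)})"
        by (intro open_Un open_Collect_conj open_Collect_less open_Collect_const continuous_intros)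
      ultimately show "openin (top_of_set {0..1}) {t \<in> {0..1}. edge_map G e t \<in> U}"
        by (simp only: openin_open_Int)
    qed
    moreover have "inj_on (draw G p) U"
    proof (rule inj[OF sub])
      fix e q r assume *: "e \<in> arcs G" "q < 4" "r \<in> {0<..<1}" "Inner e ((real q + r) / 4) \<in> U"
      then have "tail G e = v \<and> real q + r < 1 \<or> head G e = v \<and> 3 < real q + r"
        by (auto simp: U_def)
      then have "tail G e = v \<and> q = 0 \<or> head G e = v \<and> q = 3"
        using * less_4_cases[OF *(2)] by auto
      then show "Node v \<in> {dnode G (e, True) q, dnode G (e, True) (Suc q)}"
        by (auto simp: dnode_def dstart_def)
    qed
    ultimately show ?thesis
      using v by (auto simp: U_def)
  next
    case e
    \<comment> \<open>Every interior parameter lies on the two open segments around some inner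
      breakpoint k/4, the breakpoint included.\<close>
    have "\<exists>k\<in>{1, 2, 3::nat}. (real k - 1) / 4 < t \<and> t < (real k + 1) / 4"
    proof -
      consider "t < 1/2" | "1/4 < t" "t < 3/4" | "1/2 < t"
        by linarith
      then show ?thesis
        using e(3) by cases auto
    qed
    then obtain k :: nat where k: "k \<in> {1, 2, 3}" "(real k - 1) / 4 < t" "t < (real k + 1) / 4"
      by blast
    define U :: "('a, 'b) gpoint set" where "U = Inner e ` {(real k - 1) / 4<..<(real k + 1) / 4}"
    have sub: "U \<subseteq> gpoints G"
      using e(2) k(1) by (auto simp: U_def gpoints_def)
    have "openin (realization G) U"
      unfolding openin_realization gopen_def
    proof (intro conjI ballI sub)
      fix e' assume "e' \<in> arcs G"
      have "{t \<in> {0..1}. edge_map G e' t \<in> U} = {0..1} \<inter> (if e' = e then {(real k - 1) / 4<..<(real k + 1) / 4} else {})"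
        using k(1) by (auto simp: U_def edge_map_def)
      moreover have "open (if e' = e then {(real k - 1) / 4<..<(real k + 1) / 4} else {})"
        by simp
      ultimately show "openin (top_of_set {0..1}) {t \<in> {0..1}. edge_map G e' t \<in> U}"
        by (simp only: openin_open_Int)
    qed
    moreover have "inj_on (draw G p) U"
    proof (rule inj[OF sub])
      fix e' q r assume *: "e' \<in> arcs G" "q < 4" "r \<in> {0<..<1}" "Inner e' ((real q + r) / 4) \<in> U"
      then have "e' = e" "real k - 1 < real q + r" "real q + r < real k + 1"
        by (auto simp: U_def)
      then have "q = k \<or> Suc q = k"
        using *(3) by auto
      then show "dnode G (e, True) k \<in> {dnode G (e', True) q, dnode G (e', True) (Suc q)}"
        using \<open>e' = e\<close> by auto
    qed
    moreover have "x \<in> U"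
      using e(1) k by (auto simp: U_def)
    ultimately show ?thesis
      by blast
  qed
qed

text \<open>A multiple point lies on the lines of two segments with four different end nodes, which
  leaves finitely many. A third preimage would give three concurrent lines through six nodes, and a
  tangency would make three nodes collinear.\<close>

lemma plane_generic_immersion_draw:
  assumes fin: "fin_digraph G" and gp: "general_position (nodes G) p"
  shows "plane_generic_immersion G (draw G p)"
proof -
  interpret fin_digraph G by fact
  note three = general_positionD(2)[OF gp]
  have in_nodes: "dnode G (e, True) q \<in> nodes G" if "e \<in> arcs G" for e q
    using that by (intro dnode_in_nodes[OF wf_digraph]) (simp add: darts_def)
  define J where "J = {(e, q, e', q'). e \<in> arcs G \<and> q < (4::nat) \<and> e' \<in> arcs G \<and> q' < (4::nat) \<and>
    {dnode G (e, True) q, dnode G (e, True) (Suc q)} \<inter> {dnode G (e', True) q', dnode G (e', True) (Suc q')} = {}}"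
  define X where "X = (\<lambda>(e, q, e', q'). {z. orient (p (dnode G (e, True) q)) (p (dnode G (e, True) (Suc q))) z = 0 \<and>
    orient (p (dnode G (e', True) q')) (p (dnode G (e', True) (Suc q'))) z = 0})"
  have "finite J"
    by (rule finite_subset[of _ "arcs G \<times> {..<4} \<times> arcs G \<times> {..<4}"]) (auto simp: J_def)
  moreover have "finite (X u)" if u: "u \<in> J" for u
  proof -
    obtain e q e' q' where u_eq: "u = (e, q, e', q')"
      by (cases u) auto
    have "finite {z. orient (p (dnode G (e, True) q)) (p (dnode G (e, True) (Suc q))) z = 0 \<and>
        orient (p (dnode G (e', True) q')) (p (dnode G (e', True) (Suc q'))) z = 0}"
      using u dnode_Suc_neq[of q G "(e, True)"] dnode_Suc_neq[of q' G "(e', True)"]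
      by (intro finite_line_intersection[OF gp] in_nodes) (auto simp: J_def u_eq)
    then show ?thesis
      by (simp add: X_def u_eq)
  qed
  moreover have mp: "multiple_points G (draw G p) \<subseteq> (\<Union>u\<in>J. X u)"
  proof
    fix z assume "z \<in> multiple_points G (draw G p)"
    then obtain x y where xy: "x \<in> gpoints G" "y \<in> gpoints G" "x \<noteq> y" "draw G p x = z" "draw G p y = z"
      by (auto simp: multiple_points_def)
    obtain e q r e' q' r' where *: "e \<in> arcs G" "q < 4" "r \<in> {0<..<1}" "e' \<in> arcs G" "q' < 4" "r' \<in> {0<..<1}"
      "x = Inner e ((real q + r) / 4)" "y = Inner e' ((real q' + r') / 4)"
      "{dnode G (e, True) q, dnode G (e, True) (Suc q)} \<inter> {dnode G (e', True) q', dnode G (e', True) (Suc q')} = {}"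
      by (rule draw_coincide[OF wf_digraph gp xy(1-3) trans[OF xy(4) xy(5)[symmetric]]])
    then have "(e, q, e', q') \<in> J"
      by (simp add: J_def)
    moreover have "z \<in> X (e, q, e', q')"
    proof -
      have z: "z = of_real (1 - r) * p (dnode G (e, True) q) + of_real r * p (dnode G (e, True) (Suc q))"
          "z = of_real (1 - r') * p (dnode G (e', True) q') + of_real r' * p (dnode G (e', True) (Suc q'))"
        using xy(4,5) draw_open_segment[OF *(2,3), of G p e] draw_open_segment[OF *(5,6), of G p e']
        by (simp_all only: *(7,8))
      have "orient (p (dnode G (e, True) q)) (p (dnode G (e, True) (Suc q))) z = 0"
        by (subst z(1), rule orient_convex)
      moreover have "orient (p (dnode G (e', True) q')) (p (dnode G (e', True) (Suc q'))) z = 0"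
        by (subst z(2), rule orient_convex)
      ultimately show ?thesis
        by (simp add: X_def)
    qed
    ultimately show "z \<in> (\<Union>u\<in>J. X u)"
      by blast
  qed
  ultimately have "finite (multiple_points G (draw G p))"
    by (meson finite_UN_I finite_subset)
  moreover have "transversal_double_point G (draw G p) z" if "z \<in> multiple_points G (draw G p)" for z
  proof -
    obtain x y where xy: "x \<in> gpoints G" "y \<in> gpoints G" "x \<noteq> y" "draw G p x = z" "draw G p y = z"
      using \<open>z \<in> multiple_points G (draw G p)\<close> by (auto simp: multiple_points_def)
    obtain e q r e' q' r' where *: "e \<in> arcs G" "q < 4" "r \<in> {0<..<1}" "e' \<in> arcs G" "q' < 4" "r' \<in> {0<..<1}"
      "x = Inner e ((real q + r) / 4)" "y = Inner e' ((real q' + r') / 4)"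
      and disj: "{dnode G (e, True) q, dnode G (e, True) (Suc q)} \<inter> {dnode G (e', True) q', dnode G (e', True) (Suc q')} = {}"
      by (rule draw_coincide[OF wf_digraph gp xy(1-3) trans[OF xy(4) xy(5)[symmetric]]])
    define a where "a = dnode G (e, True) q"
    define b where "b = dnode G (e, True) (Suc q)"
    define a' where "a' = dnode G (e', True) q'"
    define b' where "b' = dnode G (e', True) (Suc q')"
    have nd: "a \<in> nodes G" "b \<in> nodes G" "a' \<in> nodes G" "b' \<in> nodes G" "distinct [a, b, a', b']"
      using in_nodes * dnode_Suc_neq[OF *(2), of G "(e, True)"] dnode_Suc_neq[OF *(5), of G "(e', True)"] disj
      by (auto simp: a_def b_def a'_def b'_def)
    have z: "z = of_real (1 - r) * p a + of_real r * p b" "z = of_real (1 - r') * p a' + of_real r' * p b'"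
      using xy(4,5) draw_open_segment[OF *(2,3), of G p e] draw_open_segment[OF *(5,6), of G p e']
      by (simp_all add: a_def b_def a'_def b'_def *(7,8))
    have z0: "orient (p a) (p b) z = 0" "orient (p a') (p b') z = 0"
      by (subst z(1), rule orient_convex) (subst z(2), rule orient_convex)
    have only: "w = x \<or> w = y" if w: "w \<in> gpoints G" "draw G p w = z" for w
    proof (rule ccontr)
      assume "\<not> (w = x \<or> w = y)"
      then have ne: "w \<noteq> x" "w \<noteq> y"
        by auto
      obtain e1 q1 r1 where w1: "e1 \<in> arcs G" "q1 < 4" "r1 \<in> {0<..<1}" "w = Inner e1 ((real q1 + r1) / 4)"
        "{dnode G (e1, True) q1, dnode G (e1, True) (Suc q1)} \<inter> {a, b} = {}"
        "{dnode G (e1, True) q1, dnode G (e1, True) (Suc q1)} \<inter> {a', b'} = {}"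
      proof -
        obtain e1 q1 r1 e2 q2 r2 where 1: "e1 \<in> arcs G" "q1 < 4" "r1 \<in> {0<..<1}" "e2 \<in> arcs G" "q2 < 4" "r2 \<in> {0<..<1}"
          "w = Inner e1 ((real q1 + r1) / 4)" "x = Inner e2 ((real q2 + r2) / 4)"
          "{dnode G (e1, True) q1, dnode G (e1, True) (Suc q1)} \<inter> {dnode G (e2, True) q2, dnode G (e2, True) (Suc q2)} = {}"
          by (rule draw_coincide[OF wf_digraph gp w(1) xy(1) ne(1) trans[OF w(2) xy(4)[symmetric]]])
        obtain e3 q3 r3 e4 q4 r4 where 2: "e3 \<in> arcs G" "q3 < 4" "r3 \<in> {0<..<1}" "e4 \<in> arcs G" "q4 < 4" "r4 \<in> {0<..<1}"
          "w = Inner e3 ((real q3 + r3) / 4)" "y = Inner e4 ((real q4 + r4) / 4)"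
          "{dnode G (e3, True) q3, dnode G (e3, True) (Suc q3)} \<inter> {dnode G (e4, True) q4, dnode G (e4, True) (Suc q4)} = {}"
          by (rule draw_coincide[OF wf_digraph gp w(1) xy(2) ne(2) trans[OF w(2) xy(5)[symmetric]]])
        have unique: "q = q'" if "(real q + r) / 4 = (real q' + r') / 4" "r \<in> {0<..<1}" "r' \<in> {0<..<1}" for q q' :: nat and r r' :: real
          using that by auto
        have "e2 = e" "q2 = q" "e4 = e'" "q4 = q'" "e3 = e1" "q3 = q1"
          using 1 2 * unique by auto
        then show thesis
          using 1 2 by (intro that[of e1 q1 r1]) (auto simp: a_def b_def a'_def b'_def)
      qed
      have "orient (p (dnode G (e1, True) q1)) (p (dnode G (e1, True) (Suc q1))) z = 0"
      proof -
        have "z = of_real (1 - r1) * p (dnode G (e1, True) q1) + of_real r1 * p (dnode G (e1, True) (Suc q1))"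
          using w(2) draw_open_segment[OF w1(2,3), of G p e1] by (simp only: w1(4))
        then show ?thesis
          by (simp only: orient_convex)
      qed
      moreover have "distinct [a, b, a', b', dnode G (e1, True) q1, dnode G (e1, True) (Suc q1)]"
        using nd(5) w1(5,6) dnode_Suc_neq[OF w1(2), of G "(e1, True)"] by auto
      ultimately show False
        using general_positionD(3)[OF gp nd(1-4) in_nodes[OF w1(1)] in_nodes[OF w1(1)]] z0 by blast
    qed
    have s01: "(real q + r) / 4 \<in> {0<..<1}" if "q < 4" "r \<in> {0<..<1}" for q r
    proof -
      have "real q \<le> 3"
        using that(1) by simp
      then show ?thesis
        using that(2) by auto
    qed
    have not_parallel: "Im (cnj (4 * (p b - p a)) * (4 * (p b' - p a'))) \<noteq> 0"
    proof
      assume "Im (cnj (4 * (p b - p a)) * (4 * (p b' - p a'))) = 0"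
      then have par: "(Re (p b) - Re (p a)) * (Im (p b') - Im (p a')) = (Im (p b) - Im (p a)) * (Re (p b') - Re (p a'))"
        by (simp add: algebra_simps)
      have "orient (p a) (p b) (of_real (1 - r') * p a' + of_real r' * p b') =
          orient (p a) (p b) (p a') + r' * ((Re (p b) - Re (p a)) * (Im (p b') - Im (p a')) -
            (Im (p b) - Im (p a)) * (Re (p b') - Re (p a')))"
        by (simp add: orient_coords algebra_simps)
      then have "orient (p a) (p b) (p a') = 0"
        using z0(1) z(2) par by simp
      then show False
        using three[of a b a'] nd by simp
    qed
    show ?thesis
      unfolding transversal_double_point_def
    proof (intro bexI exI conjI)
      show "(e, (real q + r) / 4) \<noteq> (e', (real q' + r') / 4)"
        using xy(3) * by auto
      show "{x \<in> gpoints G. draw G p x = z} = {Inner e ((real q + r) / 4), Inner e' ((real q' + r') / 4)}"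
        using only xy * by auto
      show "((draw G p \<circ> edge_map G e) has_vector_derivative 4 * (p b - p a)) (at ((real q + r) / 4))"
        using draw_has_vector_derivative[OF *(2,3)] by (simp add: a_def b_def)
      show "((draw G p \<circ> edge_map G e') has_vector_derivative 4 * (p b' - p a')) (at ((real q' + r') / 4))"
        using draw_has_vector_derivative[OF *(5,6)] by (simp add: a'_def b'_def)
      show "span {4 * (p b - p a), 4 * (p b' - p a')} = UNIV"
        using not_parallel by (rule span_complex_basis)
    qed (use * s01 in auto)
  qed
  moreover have "continuous_map (realization G) euclidean (draw G p)"
    by (rule continuous_map_realization[OF wf_digraph continuous_on_draw])
  ultimately show ?thesis
    unfolding plane_generic_immersion_def plane_immersion_def
    by (intro conjI ballI locally_injective_draw[OF wf_digraph gp] piecewise_smooth_draw)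
qed

section \<open>Drawings with vanishing rotation numbers\<close>

text \<open>
  All vertices are drawn near \<open>0\<close> and all middles near \<open>-1\<close>, below the row of bends. The turns at the
  two bends of an edge then have opposite signs, and the turn at a vertex or middle point is governed by
  the order of the labels of the two adjacent bends.
\<close>

definition target :: "('e dart \<Rightarrow> real) \<Rightarrow> ('v, 'e) node \<Rightarrow> complex" where
  "target y i = (case i of Node v \<Rightarrow> 0 | Middle e \<Rightarrow> -1 | Bend d \<Rightarrow> Complex (y d) 1)"

text \<open>These are the corners met along a dart: at the first bend, the middle, the second bend
  and the end vertex. In the target positions many nodes coincide, but these orientations are
  nonzero for distinct labels, so the perturbed nodes inherit their signs.\<close>

lemma orient_target:
  "orient (target y (Node v)) (target y (Bend d)) (target y (Middle e)) = 1"
  "orient (target y (Bend d)) (target y (Middle e)) (target y (Bend d')) = y d' - y d"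
  "orient (target y (Middle e)) (target y (Bend d)) (target y (Node v)) = -1"
  "orient (target y (Bend d)) (target y (Node v)) (target y (Bend d')) = y d' - y d"
  by (simp_all add: orient_coords target_def)

text \<open>Before \<open>f\<close> is applied the curve is injective modulo 1. A Lebesgue number on
  \<open>{0..2}\<close>, which contains a period and a further step below 1, gives one \<delta> for
  all starts.\<close>

lemma cycle_curve_locally_injective:
  assumes sub: "subgraph C G" and inj: "locally_injective (realization G) f"
    and h: "homeomorphic_map circle (realization C) h"
  shows "\<exists>\<delta>>0. \<forall>s d. 0 < d \<and> d < \<delta> \<longrightarrow> cycle_curve f h (s + d) \<noteq> cycle_curve f h s"
proof -
  define p where "p t = h (cis (2 * pi * t))" for t
  have h_cont: "continuous_map circle (realization C) h"
    using h by (auto simp: homeomorphic_eq_everything_map)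
  have "continuous_map (top_of_set {0..2}) circle (\<lambda>t. cis (2 * pi * t))"
    by (auto simp: continuous_map_in_subtopology intro!: continuous_intros)
  then have "continuous_map (top_of_set {0..2}) (realization G) ((\<lambda>x. x) \<circ> (h \<circ> (\<lambda>t. cis (2 * pi * t))))"
    using h_cont continuous_map_realization_subgraph[OF sub] by (intro continuous_map_compose)
  then have p_cont: "continuous_map (top_of_set {0..2}) (realization G) p"
    by (simp add: p_def[abs_def] o_def)
  obtain \<delta> where \<delta>: "\<delta> > 0"
    "\<And>s t. s \<in> {0..2} \<Longrightarrow> t \<in> {0..2} \<Longrightarrow> \<bar>s - t\<bar> < \<delta> \<Longrightarrow> p s \<noteq> p t \<Longrightarrow> f (p s) \<noteq> f (p t)"
    using locally_injective_curve[OF inj p_cont] by metis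
  have curve: "cycle_curve f h t = f (p t)" for t
    by (simp add: cycle_curve_def p_def)
  show ?thesis
  proof (intro exI[of _ "min \<delta> 1"] conjI allI impI)
    fix s d :: real assume d: "0 < d \<and> d < min \<delta> 1"
    have "p (frac s + d) \<noteq> p (frac s)"
    proof
      assume "p (frac s + d) = p (frac s)"
      then have "cis (2 * pi * (frac s + d)) = cis (2 * pi * frac s)"
        using h by (auto simp: p_def homeomorphic_eq_everything_map inj_on_def)
      then have "frac s + d - frac s \<in> \<int>"
        by (simp only: cis_2pi_eq_iff)
      then obtain i :: int where "d = i"
        by (auto elim: Ints_cases)
      then have "0 < i" "i < 1"
        using d by simp_all
      then show False
        by simp
    qed
    then have "f (p (frac s + d)) \<noteq> f (p (frac s))"
      using d frac_ge_0[of s] frac_lt_1[of s] by (intro \<delta>(2)) auto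
    moreover have "s = frac s + of_int \<lfloor>s\<rfloor>" "s + d = (frac s + d) + of_int \<lfloor>s\<rfloor>"
      by (simp_all add: frac_def)
    then have "cycle_curve f h s = cycle_curve f h (frac s)" "cycle_curve f h (s + d) = cycle_curve f h (frac s + d)"
      using int_shift_periodic[of "cycle_curve f h", OF cycle_curve_periodic] by metis+
    ultimately show "cycle_curve f h (s + d) \<noteq> cycle_curve f h s"
      by (simp add: curve)
  qed (use \<delta> in auto)
qed

lemma sum_blocks_4: "(\<Sum>j<4 * n. f j) = (\<Sum>i<n. f (4 * i) + f (4 * i + 1) + f (4 * i + 2) + f (4 * i + 3))"
  for f :: "nat \<Rightarrow> 'a::comm_monoid_add"
proof (induction n)
  case (Suc n)
  have "4 * Suc n = Suc (Suc (Suc (Suc (4 * n))))"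
    by simp
  then show ?case
    using Suc by (simp add: add.assoc numeral_eq_Suc)
qed simp

text \<open>A cycle of \<open>n\<close> edges is drawn as a closed polygon with \<open>4 * n\<close>
  corners. Those of even index are vertices or middles at height about 0, those of odd index are
  bends at height about 1, so the sides alternately go up and down. For each dart the turns at the
  bends cancel, and the other two are its terms in \<open>ysum\<close>.\<close>

lemma turn_draw_cycle:
  fixes G :: "('v, 'e) pre_digraph"
  assumes fin: "fin_digraph G" and y: "balanced G y" and ds: "cyc G ds"
    and near: "\<And>i. i \<in> nodes G \<Longrightarrow> dist (p i) (target y i) < 1/4"
    and stable: "\<And>i j k. i \<in> nodes G \<Longrightarrow> j \<in> nodes G \<Longrightarrow> k \<in> nodes G \<Longrightarrow>
      orient (target y i) (target y j) (target y k) \<noteq> 0 \<Longrightarrow>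
      sgn (orient (p i) (p j) (p k)) = sgn (orient (target y i) (target y j) (target y k))"
    and cont: "continuous_on UNIV c" and periodic: "\<And>t. c (t + 1) = c t"
    and \<epsilon>: "0 < \<epsilon>" "\<epsilon> < 1" and nv: "\<And>t. c (t + \<epsilon> / real (4 * length ds)) \<noteq> c t"
    and c: "\<And>i s. i < length ds \<Longrightarrow> s \<in> {0..1} \<Longrightarrow>
      c ((real i + s) / real (length ds)) = draw G p (dpoint G (ds ! i) s)"
  shows "turn (\<lambda>t. c (t + \<epsilon> / real (4 * length ds)) - c t) 0 1 = 0"
proof -
  interpret fin_digraph G by fact
  define n where "n = length ds"
  define N where "N = 4 * n"
  have n: "0 < n" "0 < N" "ds \<noteq> []"
    using ds by (auto simp: n_def N_def cyc_def)
  define nx where "nx i = ds ! (Suc i mod n)" for i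
  have darts: "ds ! i \<in> darts G" if "i < n" for i
    using ds that by (auto simp: cyc_def n_def)
  have corner: "rev_dart (ds ! i) \<noteq> nx i" "dend G (ds ! i) = dstart G (nx i)" "nx i \<in> darts G" if "i < n" for i
  proof -
    have in_ds: "ds ! i \<in> set ds" "nx i \<in> set ds"
      using that n by (auto simp: nx_def n_def)
    show "rev_dart (ds ! i) \<noteq> nx i"
      using cyc_rev_notin[OF ds in_ds(1)] in_ds(2) by auto
    have "set ds \<subseteq> darts G"
      using ds by (simp add: cyc_def)
    then show "nx i \<in> darts G"
      using in_ds(2) by blast
    show "dend G (ds ! i) = dstart G (nx i)"
      using cyc_nth[OF ds] that by (simp add: nx_def n_def)
  qed
  define V where "V j = dnode G (ds ! (j div 4)) (j mod 4)" for j
  have V_nodes: "V j \<in> nodes G" if "j < N" for j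
    unfolding V_def using that by (intro dnode_in_nodes wf_digraph darts) (simp add: N_def)
  have V_next: "V (Suc j mod N) = dnode G (ds ! (j div 4)) (Suc (j mod 4))" if j: "j < N" for j
  proof (cases "j mod 4 = 3")
    case True
    then have "Suc j = 4 * Suc (j div 4)"
      using div_mult_mod_eq[of j 4] by simp
    then have "Suc j mod N = 4 * (Suc (j div 4) mod n)"
      unfolding N_def by (metis mult_mod_right)
    then have "V (Suc j mod N) = Node (dstart G (nx (j div 4)))"
      by (simp add: V_def dnode_def nx_def)
    then show ?thesis
      using corner(2)[of "j div 4"] j True by (simp add: dnode_def N_def)
  next
    case False
    then have m: "Suc j mod 4 = Suc (j mod 4)" "Suc j div 4 = j div 4"
      by (simp_all add: mod_Suc div_Suc)
    have "Suc j \<noteq> N"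
    proof
      assume "Suc j = N"
      then have "Suc j mod 4 = 0"
        by (simp add: N_def)
      then show False
        using m by simp
    qed
    then have "Suc j mod N = Suc j"
      using j by simp
    then show ?thesis
      by (simp add: V_def m)
  qed
  define P where "P j = p (V j)" for j
  define \<tau> where "\<tau> j = sgn (orient (P j) (P (Suc j mod N)) (P (Suc (Suc j mod N) mod N)))" for j
  have lt: "Suc j mod N < N" for j
    using n by simp
  \<comment> \<open>A distance below 1/4 from the target heights 0 and 1 keeps the heights of even
    and odd corners apart.\<close>
  have Im_P: "Im (P j) < 1/4 \<and> -1/4 < Im (P j)" if "even j" "j < N" for j
  proof -
    have "j mod 4 = 0 \<or> j mod 4 = 2"
      using that(1) by presburger
    then have "Im (target y (V j)) = 0"
      by (auto simp: V_def dnode_def target_def)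
    moreover have "\<bar>Im (P j - target y (V j))\<bar> < 1/4"
      using near[OF V_nodes[OF that(2)]] abs_Im_le_cmod[of "P j - target y (V j)"] by (simp add: P_def dist_norm)
    ultimately show ?thesis
      by auto
  qed
  have Im_P': "3/4 < Im (P j)" if "odd j" "j < N" for j
  proof -
    have "j mod 4 = 1 \<or> j mod 4 = 3"
      using that(1) by presburger
    then have "Im (target y (V j)) = 1"
      by (auto simp: V_def dnode_def target_def)
    moreover have "\<bar>Im (P j - target y (V j))\<bar> < 1/4"
      using near[OF V_nodes[OF that(2)]] abs_Im_le_cmod[of "P j - target y (V j)"] by (simp add: P_def dist_norm)
    ultimately have "\<bar>Im (P j) - 1\<bar> < 1/4"
      by simp
    then show ?thesis
      by linarith
  qed
  have par: "even (Suc j mod N) \<longleftrightarrow> odd j" for j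
    by (simp add: N_def dvd_mod_iff)
  have "turn (\<lambda>t. c (t + \<epsilon> / real N) - c t) 0 1 = 0"
  proof (rule turn_closed_polygon[where P = P and \<tau> = \<tau>, OF cont periodic n(2) \<epsilon>])
    show "c (t + \<epsilon> / real N) \<noteq> c t" for t
      using nv by (simp add: N_def n_def)
    fix j assume j: "j < N"
    have i: "j div 4 < n"
      using j by (simp add: N_def)
    show "Im (P (Suc j mod N) - P j) * Im (P (Suc (Suc j mod N) mod N) - P (Suc j mod N)) < 0"
    proof (cases "even j")
      case True
      then have "0 < Im (P (Suc j mod N) - P j)" "Im (P (Suc (Suc j mod N) mod N) - P (Suc j mod N)) < 0"
        using Im_P[of j] Im_P'[of "Suc j mod N"] Im_P[of "Suc (Suc j mod N) mod N"] par[of j] par[of "Suc j mod N"] j lt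
        by auto
      then show ?thesis
        by (rule mult_pos_neg)
    next
      case False
      then have "Im (P (Suc j mod N) - P j) < 0" "0 < Im (P (Suc (Suc j mod N) mod N) - P (Suc j mod N))"
        using Im_P'[of j] Im_P[of "Suc j mod N"] Im_P'[of "Suc (Suc j mod N) mod N"] par[of j] par[of "Suc j mod N"] j lt
        by auto
      then show ?thesis
        by (rule mult_neg_pos)
    qed
    show "c ((real j + s) / real N) = of_real (1 - s) * P j + of_real s * P (Suc j mod N)" if s: "s \<in> {0..1}" for s
    proof -
      have q: "j mod 4 < 4"
        by simp
      then have "j mod 4 \<le> 3"
        by linarith
      then have "real (j mod 4) \<le> real 3"
        by (rule of_nat_mono)
      then have "(real (j mod 4) + s) / 4 \<in> {0..1}"
        using s by simp
      moreover have "(real j + s) / real N = (real (j div 4) + (real (j mod 4) + s) / 4) / real n"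
      proof -
        have "real j = 4 * real (j div 4) + real (j mod 4)"
          by (metis mult_div_mod_eq of_nat_add of_nat_mult of_nat_numeral)
        then show ?thesis
          using n by (simp add: N_def field_simps)
      qed
      ultimately have "c ((real j + s) / real N) = draw G p (dpoint G (ds ! (j div 4)) ((real (j mod 4) + s) / 4))"
        using c[of "j div 4" "(real (j mod 4) + s) / 4"] i by (simp add: n_def)
      then show ?thesis
        using draw_dpoint[OF q s] by (simp add: P_def V_next[OF j]) (simp add: V_def)
    qed
    show "\<tau> j = sgn (orient (P j) (P (Suc j mod N)) (P (Suc (Suc j mod N) mod N)))"
      by (simp add: \<tau>_def)
  next
    have y_inj: "inj_on y (darts G)"
      using y by (simp add: balanced_def)
    have \<tau>_eq: "\<tau> j = sgn (orient (target y (V j)) (target y (V (Suc j mod N))) (target y (V (Suc (Suc j mod N) mod N))))"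
      if "j < N" "orient (target y (V j)) (target y (V (Suc j mod N))) (target y (V (Suc (Suc j mod N) mod N))) \<noteq> 0" for j
      unfolding \<tau>_def P_def using that lt by (intro stable V_nodes) auto
    have block: "\<tau> (4 * i) = 1 \<and> \<tau> (4 * i + 1) = sgn (y (rev_dart (ds ! i)) - y (ds ! i)) \<and> \<tau> (4 * i + 2) = -1 \<and>
        \<tau> (4 * i + 3) = sgn (y (nx i) - y (rev_dart (ds ! i))) \<and>
        sgn (y (rev_dart (ds ! i)) - y (ds ! i)) \<noteq> 0 \<and> sgn (y (nx i) - y (rev_dart (ds ! i))) \<noteq> 0"
      if i: "i < n" for i
    proof -
      define d where "d = ds ! i"
      have d: "d \<in> darts G"
        using darts[OF i] by (simp add: d_def)
      have lts: "4 * i < N" "4 * i + 1 < N" "4 * i + 2 < N" "4 * i + 3 < N"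
        using i by (auto simp: N_def)
      have div_mod: "(4 * i + q) div 4 = i" "(4 * i + q) mod 4 = q" if "q < 4" for q
        using that by auto
      have V: "V (4 * i) = Node (dstart G d)" "V (4 * i + 1) = Bend d" "V (4 * i + 2) = Middle (fst d)"
          "V (4 * i + 3) = Bend (rev_dart d)"
        using div_mod[of 0] div_mod[of 1] div_mod[of 2] div_mod[of 3]
        by (simp_all add: V_def dnode_def d_def del: div_mult_self4 mod_mult_self4)
      have nxt: "Suc (4 * i) mod N = 4 * i + 1" "Suc (4 * i + 1) mod N = 4 * i + 2" "Suc (4 * i + 2) mod N = 4 * i + 3"
        using lts by simp_all
      have V4: "V (Suc (4 * i + 3) mod N) = Node (dend G d)"
        using V_next[OF lts(4)] div_mod[of 3] by (simp add: dnode_def d_def)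
      have V5: "V (Suc (Suc (4 * i + 3) mod N) mod N) = Bend (nx i)"
      proof -
        have "Suc (4 * i + 3) = 4 * Suc i"
          by simp
        then have k: "Suc (4 * i + 3) mod N = 4 * (Suc i mod n)"
          unfolding N_def by (metis mult_mod_right)
        have "4 * (Suc i mod n) < N"
          using n by (simp add: N_def)
        then show ?thesis
          unfolding k using V_next[of "4 * (Suc i mod n)"] by (simp add: dnode_def nx_def)
      qed
      have ne1: "y (rev_dart d) - y d \<noteq> 0"
        using inj_onD[OF y_inj, of "rev_dart d" d] d by auto
      have ne2: "y (nx i) - y (rev_dart d) \<noteq> 0"
        using inj_onD[OF y_inj, of "nx i" "rev_dart d"] d corner[OF i] by (auto simp: d_def)
      have "\<tau> (4 * i) = 1"
        using \<tau>_eq[OF lts(1)] by (simp only: nxt V orient_target)  simp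
      moreover have "\<tau> (4 * i + 1) = sgn (y (rev_dart d) - y d)"
        using \<tau>_eq[OF lts(2)] ne1 by (simp only: nxt V orient_target) simp
      moreover have "\<tau> (4 * i + 2) = -1"
        using \<tau>_eq[OF lts(3)] by (simp only: nxt V V4 orient_target) simp
      moreover have "\<tau> (4 * i + 3) = sgn (y (nx i) - y (rev_dart d))"
        using \<tau>_eq[OF lts(4)] ne2 by (simp only: V V4 V5 orient_target) simp
      ultimately show ?thesis
        using ne1 ne2 by (simp add: d_def sgn_zero_iff)
    qed
    show "\<tau> j \<noteq> 0" if "j < N" for j
    proof -
      have i: "j div 4 < n"
        using that by (simp add: N_def)
      have "j = 4 * (j div 4) + j mod 4"
        by simp
      moreover have "j mod 4 = 0 \<or> j mod 4 = 1 \<or> j mod 4 = 2 \<or> j mod 4 = 3"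
        by presburger
      ultimately have "j \<in> {4 * (j div 4), 4 * (j div 4) + 1, 4 * (j div 4) + 2, 4 * (j div 4) + 3}"
        by (metis add.right_neutral insertCI)
      then show ?thesis
        using block[OF i] by (elim insertE emptyE) (metis one_neq_zero neg_equal_0_iff_equal)+
    qed
    have "(\<Sum>j<N. \<tau> j) = (\<Sum>i<n. \<tau> (4 * i) + \<tau> (4 * i + 1) + \<tau> (4 * i + 2) + \<tau> (4 * i + 3))"
      unfolding N_def by (rule sum_blocks_4)
    also have "\<dots> = (\<Sum>i<n. sgn (y (rev_dart (ds ! i)) - y (ds ! i)) + sgn (y (nx i) - y (rev_dart (ds ! i))))"
    proof (rule sum.cong)
      fix i assume "i \<in> {..<n}"
      then show "\<tau> (4 * i) + \<tau> (4 * i + 1) + \<tau> (4 * i + 2) + \<tau> (4 * i + 3) =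
          sgn (y (rev_dart (ds ! i)) - y (ds ! i)) + sgn (y (nx i) - y (rev_dart (ds ! i)))"
        using block[of i] by simp
    qed simp
    also have "\<dots> = ysum y ds"
      unfolding ysum_def nx_def n_def using n(3) by (simp add: csum_nth)
    finally show "(\<Sum>j<N. \<tau> j) = 0"
      using y ds by (simp add: balanced_def)
  qed
  then show ?thesis
    by (simp add: N_def n_def)
qed

lemma finite_nodes: "fin_digraph G \<Longrightarrow> finite (nodes G)"
  by (simp add: nodes_def darts_def fin_digraph.finite_arcs fin_digraph.finite_verts)

text \<open>The perturbation is small for two reasons: \<open>\<delta>0\<close> preserves the
  nonzero orientation signs of the target positions, and 1/4 keeps the two heights apart. An
  arbitrary parametrization is reduced to the standard one, for which the turn of the secants of a
  single small length decides.\<close>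

lemma rotation_free_drawing:
  assumes fin: "fin_digraph G" and y: "balanced G y"
  shows "\<exists>f. plane_generic_immersion G f \<and>
    (\<forall>C h. is_cycle_of C G \<and> homeomorphic_map circle (realization C) h \<longrightarrow>
      has_rotation_number (cycle_curve f h) 0)"
proof -
  interpret fin_digraph G by fact
  obtain \<delta>0 where \<delta>0: "0 < \<delta>0" "\<And>p i j k. (\<And>i. i \<in> nodes G \<Longrightarrow> dist (p i) (target y i) < \<delta>0) \<Longrightarrow>
      i \<in> nodes G \<Longrightarrow> j \<in> nodes G \<Longrightarrow> k \<in> nodes G \<Longrightarrow> orient (target y i) (target y j) (target y k) \<noteq> 0 \<Longrightarrow>
      sgn (orient (p i) (p j) (p k)) = sgn (orient (target y i) (target y j) (target y k))"
    using orient_stable_finite[OF finite_nodes[OF fin], of "target y"] by blast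
  obtain p where p: "\<And>i. i \<in> nodes G \<Longrightarrow> dist (p i) (target y i) < min \<delta>0 (1/4)" and gp: "general_position (nodes G) p"
    using general_position_exists[OF finite_nodes[OF fin], of "min \<delta>0 (1/4)" "target y"] \<delta>0(1) by auto
  define f where "f = draw G p"
  have pgi: "plane_generic_immersion G f"
    unfolding f_def by (rule plane_generic_immersion_draw[OF fin gp])
  then have f_cont: "continuous_map (realization G) euclidean f" and f_inj: "locally_injective (realization G) f"
    by (auto simp: plane_generic_immersion_def plane_immersion_def)
  have "has_rotation_number (cycle_curve f h) 0"
    if C: "is_cycle_of C G" and h: "homeomorphic_map circle (realization C) h" for C h
  proof -
    obtain ds h0 \<psi> and m :: int where ds: "cyc G ds" and h0: "homeomorphic_map circle (realization (cyc_graph G ds)) h0"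
      and h0_eq: "\<forall>i<length ds. \<forall>s\<in>{0..1}.
        h0 (cis (2 * pi * ((real i + s) / real (length ds)))) = dpoint G (ds ! i) s"
      and \<psi>: "continuous_on UNIV \<psi>" "\<forall>t. h (cis (2 * pi * t)) = h0 (cis (2 * pi * \<psi> t))"
        "\<forall>t. \<psi> (t + 1) = \<psi> t + of_int m" "\<forall>t t'. \<psi> t - \<psi> t' \<in> \<int> \<longrightarrow> t - t' \<in> \<int>"
      by (rule cycle_reparametrization[OF fin C h])
    define c where "c = cycle_curve f h0"
    have sub: "subgraph (cyc_graph G ds) G"
      by (rule subgraph_cyc_graph[OF wf_digraph ds])
    have c_cont: "continuous_on UNIV c"
      unfolding c_def by (rule continuous_cycle_curve[OF sub f_cont h0])
    have c_per: "c (t + 1) = c t" for t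
      unfolding c_def by (rule cycle_curve_periodic)
    obtain \<delta> where \<delta>: "0 < \<delta>" "\<And>s d. 0 < d \<Longrightarrow> d < \<delta> \<Longrightarrow> c (s + d) \<noteq> c s"
      using cycle_curve_locally_injective[OF sub f_inj h0] unfolding c_def by blast
    define N where "N = 4 * length ds"
    have N: "0 < real N"
      using ds by (simp add: N_def cyc_def)
    \<comment> \<open>The step \<open>\<epsilon> / real N\<close> stays below \<delta>, where all
      secants are nonzero, and \<epsilon> stays below 1 for the decomposition into sides and
      corners.\<close>
    define \<epsilon> where "\<epsilon> = min (1/2) (\<delta> / 2 * real N)"
    have \<epsilon>: "0 < \<epsilon>" "\<epsilon> < 1"
      using \<delta>(1) N by (auto simp: \<epsilon>_def)
    have "\<epsilon> \<le> \<delta> / 2 * real N"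
      by (simp add: \<epsilon>_def)
    then have "\<epsilon> / real N \<le> \<delta> / 2"
      using N by (simp add: pos_divide_le_eq)
    then have \<delta>1: "0 < \<epsilon> / real N" "\<epsilon> / real N < \<delta>"
      using \<epsilon> N \<delta>(1) by (simp, linarith)
    have "turn (\<lambda>t. c (t + \<epsilon> / real N) - c t) 0 1 = 0"
      unfolding N_def
    proof (rule turn_draw_cycle[OF fin y ds _ _ c_cont c_per \<epsilon>])
      show "dist (p i) (target y i) < 1/4" if "i \<in> nodes G" for i
        using p[OF that] by simp
      show "sgn (orient (p i) (p j) (p k)) = sgn (orient (target y i) (target y j) (target y k))"
        if "i \<in> nodes G" "j \<in> nodes G" "k \<in> nodes G" "orient (target y i) (target y j) (target y k) \<noteq> 0" for i j k
        using p by (intro \<delta>0(2) that) auto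
      show "c (t + \<epsilon> / real (4 * length ds)) \<noteq> c t" for t
        using \<delta>(2)[OF \<delta>1] by (simp add: N_def)
      show "c ((real i + s) / real (length ds)) = draw G p (dpoint G (ds ! i) s)"
        if "i < length ds" "s \<in> {0..1}" for i s
        using h0_eq that by (simp add: c_def cycle_curve_def f_def)
    qed
    then have "has_rotation_number (\<lambda>t. c (\<psi> t)) 0"
      using \<psi> by (intro has_rotation_number_0_reparametrize[OF c_cont c_per \<delta> \<delta>1]) auto
    moreover have "(\<lambda>t. c (\<psi> t)) = cycle_curve f h"
      by (simp add: c_def cycle_curve_def \<psi>(2) fun_eq_iff)
    ultimately show ?thesis
      by simp
  qed
  then show ?thesis
    using pgi by blast
qed

theorem theorem1p15:
  fixes G :: "('v, 'e) pre_digraph"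
  assumes "fin_digraph G"
  shows "(\<exists>f. plane_generic_immersion G f \<and>
            (\<forall>C h. is_cycle_of C G \<and> homeomorphic_map circle (realization C) h \<longrightarrow>
               has_rotation_number (cycle_curve f h) 0))
         \<longleftrightarrow> \<not> has_complete_minor 4 G"
proof
  assume "\<exists>f. plane_generic_immersion G f \<and>
    (\<forall>C h. is_cycle_of C G \<and> homeomorphic_map circle (realization C) h \<longrightarrow> has_rotation_number (cycle_curve f h) 0)"
  then obtain f where f: "plane_immersion G f"
    "\<And>C h. is_cycle_of C G \<Longrightarrow> homeomorphic_map circle (realization C) h \<Longrightarrow> has_rotation_number (cycle_curve f h) 0"
    unfolding plane_generic_immersion_def by blast
  have "\<exists>k c. odd_system G k c"
    by (rule odd_system_of_rotation_free[OF assms f(1)]) (rule f(2))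
  then obtain k c where "odd_system G k c"
    by blast
  then show "\<not> has_complete_minor 4 G"
    unfolding has_complete_minor_def using odd_system_minor no_odd_system_K4 by blast
next
  assume "\<not> has_complete_minor 4 G"
  then obtain y where "balanced G y"
    using balanced_exists[OF assms] by blast
  then show "\<exists>f. plane_generic_immersion G f \<and>
    (\<forall>C h. is_cycle_of C G \<and> homeomorphic_map circle (realization C) h \<longrightarrow> has_rotation_number (cycle_curve f h) 0)"
    by (rule rotation_free_drawing[OF assms])
qed

end
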